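(* Let $\mathcal N_{X_1X_2\to B_2B_3}:(x_1,x_2)\mapsto\rho_{B_2B_3}^{(x_1x_2)}$ be a classical-quantum relay channel, let $p_{X_1},p_{X_2}$ be probability distributions on $\mathcal X_1,\mathcal X_2$, and let $$\rho_{X_1X_2B_2B_3}=\sum_{x_1,x_2}p_{X_1}(x_1)p_{X_2}(x_2)|x_1x_2\rangle\langle x_1x_2|_{X_1X_2}\otimes\rho_{B_2B_3}^{(x_1x_2)} .$$ Given $R\in\mathbb R_{\ge0}$, $\varepsilon\in(0,1)$ and $b\in\mathbb N$, set $$\delta=b\Big[f(1,\varepsilon)+f(2,\varepsilon)+4\cdot2^{R-D_H^\varepsilon\left(\rho_{X_2B_3}\Vert\rho_{X_2B_3}^{(\{X_2,B_3\})}\right)}+4\cdot2^{R-D_H^\varepsilon\left(\rho_{X_1X_2B_2}\Vert\rho_{X_1X_2B_2}^{(\{X_1,B_2\})}\right)}\Big].$$ If $\delta\in[0,1]$, then the triple $\left(\frac{b-1}{b}R,\,b,\,\delta\right)$ is achievable for $\mathcal N$.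
   Context: All alphabets are finite, all Hilbert spaces finite-dimensional, and $\log$ is base 2. Universal function: $f(k,\varepsilon)=\big(1+6\cdot2^{\frac{k+1}{2}}+4\cdot2^{2^{k+5}+k^2+2k}\big)\varepsilon^{1/3}$. Hypothesis-testing relative entropy: $D_H^\varepsilon(\rho\Vert\sigma)=\max_{0\le\Pi\le I,\ \mathrm{tr}(\Pi\rho)\ge1-\varepsilon}-\log\mathrm{tr}(\Pi\sigma)$ (with $-\log0=+\infty$). Conditional product states: for a classical-quantum state $\rho_{XB}=\sum_xp_X(x)|x\rangle\langle x|_X\otimes\rho_B^{(x)}$ with $X=(X_v)_{v\in V}$ and $S\subseteq V$, $\overline S=V\setminus S$, define $\rho_{XB}^{(\{X_S,B\})}=\sum_xp_X(x)|x\rangle\langle x|_X\otimes\rho_B^{(x_{\overline S})}$, where $\rho_B^{(x_{\overline S})}=\sum_{x_S}p_{X_S|X_{\overline S}}(x_S|x_{\overline S})\rho_B^{(x_S,x_{\overline S})}$. In particular $\rho_{X_2B_3}^{(\{X_2,B_3\})}=\rho_{X_2}\otimes\rho_{B_3}$. States with fewer subscripts are reduced states (partial traces). Classical-quantum relay channel: a map $\mathcal N_{X_1X_2\to B_2B_3}$ assigning to each $(x_1,x_2)\in\mathcal X_1\times\mathcal X_2$ a quantum state $\rho_{B_2B_3}^{(x_1x_2)}$ on $\mathcal H_{B_2}\otimes\mathcal H_{B_3}$. The sender inputs $x_1$, the relay inputs $x_2$ and obtains $B_2$, the receiver obtains $B_3$. Code: an $(n,2^{nR})$ code consists of (1) a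 message set $M$ with $|M|=2^{nR}$; (2) an encoding $x_1^n(m)\in\mathcal X_1^n$ for each $m\in M$; (3) relay operations (quantum channels) $\mathcal R_{(B_2)_{j-1}(B_2')_{j-1}\to(X_2)_j(B_2')_j}$, $j\in[n]$, where $(B_2)_j\cong B_2$, $(X_2)_j\cong X_2$ is classical, $(B_2')_j$ is an arbitrary quantum system, and $(B_2)_0(B_2')_0$ is trivial (dimension 1); (4) a receiver POVM $\{Q_{B_3^n}^{(m)}\}_{m\in M}$. In round $j$ the sender transmits $(x_1)_j(m)$, while the relay applies its $j$-th operation to $(B_2)_{j-1}(B_2')_{j-1}$, transmits $(X_2)_j$ and keeps $(B_2')_j$; the channel outputs $(B_2)_j$ to the relay and $(B_3)_j$ to the receiver. With $\rho_{B_3^n}(m)$ the receiver's final state, the average error probability is $p_e=\frac1{|M|}\sum_{m}\mathrm{tr}[(I-Q_{B_3^n}^{(m)})\rho_{B_3^n}(m)]$. Achievability: for $R\ge0$, $n\in\mathbb N$, $\delta\in[0,1]$, the triple $(R,n,\delta)$ is achievable if there is an $(n,2^{nR'})$ code with $R'\ge R$ and $p_e\le\delta$. *)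

theory Defs
  imports "Jordan_Normal_Form.Matrix" "HOL-Library.Extended_Real"
begin

text \<open>
  A system of dimension \<open>d\<close> is \<open>\<complex>\<^sup>d\<close>, and an alphabet of size \<open>k\<close> is \<open>{..<k}\<close>, identified
  with the computational basis of \<open>\<complex>\<^sup>k\<close>.  In a tensor product the leftmost factor is the most
  significant digit of the index.
\<close>

subsection \<open>Finite-dimensional operators\<close>

definition tr :: "complex mat \<Rightarrow> complex" where
  "tr A = sum_list (diag_mat A)"

definition psd :: "nat \<Rightarrow> complex mat \<Rightarrow> bool" where
  "psd n A \<longleftrightarrow> A \<in> carrier_mat n n \<and> (\<forall>v \<in> carrier_vec n. 0 \<le> (A *\<^sub>v v) \<bullet>c v)"

definition density :: "nat \<Rightarrow> complex mat \<Rightarrow> bool" where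
  "density n \<rho> \<longleftrightarrow> psd n \<rho> \<and> tr \<rho> = 1"

definition msum :: "nat \<Rightarrow> ('a \<Rightarrow> complex mat) \<Rightarrow> 'a set \<Rightarrow> complex mat" where
  "msum n F S = mat n n (\<lambda>ij. \<Sum>s\<in>S. F s $$ ij)"

definition kron :: "complex mat \<Rightarrow> complex mat \<Rightarrow> complex mat" (infixr \<open>\<otimes>\<^sub>m\<close> 75) where
  "A \<otimes>\<^sub>m B = mat (dim_row A * dim_row B) (dim_col A * dim_col B)
     (\<lambda>(i, j). A $$ (i div dim_row B, j div dim_col B) * B $$ (i mod dim_row B, j mod dim_col B))"

text \<open>
  For an operator \<open>M\<close> on \<open>\<complex>\<^sup>a \<otimes> \<complex>\<^sup>m \<otimes> \<complex>\<^sup>c\<close>, the operator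
  \<open>(\<langle>i| \<otimes> I \<otimes> \<langle>k|) M (|j\<rangle> \<otimes> I \<otimes> |l\<rangle>)\<close> on the middle factor.
\<close>
definition slice :: "nat \<Rightarrow> nat \<Rightarrow> complex mat \<Rightarrow> nat \<Rightarrow> nat \<Rightarrow> nat \<Rightarrow> nat \<Rightarrow> complex mat" where
  "slice m c M i k j l = mat m m (\<lambda>(p, q). M $$ ((i * m + p) * c + k, (j * m + q) * c + l))"

text \<open>Partial trace over the middle factor of \<open>\<complex>\<^sup>a \<otimes> \<complex>\<^sup>m \<otimes> \<complex>\<^sup>c\<close>.\<close>
definition ptrace :: "nat \<Rightarrow> nat \<Rightarrow> nat \<Rightarrow> complex mat \<Rightarrow> complex mat" where
  "ptrace a m c M = mat (a * c) (a * c)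
     (\<lambda>(r, s). tr (slice m c M (r div c) (r mod c) (s div c) (s mod c)))"

text \<open>\<open>id\<^sub>a \<otimes> \<Phi> \<otimes> id\<^sub>c\<close> for a linear map \<open>\<Phi>\<close> from \<open>m \<times> m\<close> to \<open>n \<times> n\<close> matrices.\<close>
definition local_op ::
  "nat \<Rightarrow> nat \<Rightarrow> nat \<Rightarrow> nat \<Rightarrow> (complex mat \<Rightarrow> complex mat) \<Rightarrow> complex mat \<Rightarrow> complex mat" where
  "local_op a m n c \<Phi> M = mat (a * n * c) (a * n * c)
     (\<lambda>(r, s). \<Phi> (slice m c M (r div c div n) (r mod c) (s div c div n) (s mod c))
                 $$ (r div c mod n, s div c mod n))"

definition linear_map :: "nat \<Rightarrow> nat \<Rightarrow> (complex mat \<Rightarrow> complex mat) \<Rightarrow> bool" where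
  "linear_map m n \<Phi> \<longleftrightarrow>
     (\<forall>A \<in> carrier_mat m m. \<Phi> A \<in> carrier_mat n n) \<and>
     (\<forall>A \<in> carrier_mat m m. \<forall>B \<in> carrier_mat m m. \<Phi> (A + B) = \<Phi> A + \<Phi> B) \<and>
     (\<forall>A \<in> carrier_mat m m. \<forall>z. \<Phi> (z \<cdot>\<^sub>m A) = z \<cdot>\<^sub>m \<Phi> A)"

definition completely_positive :: "nat \<Rightarrow> nat \<Rightarrow> (complex mat \<Rightarrow> complex mat) \<Rightarrow> bool" where
  "completely_positive m n \<Phi> \<longleftrightarrow> (\<forall>k A. psd (m * k) A \<longrightarrow> psd (n * k) (local_op 1 m n k \<Phi> A))"

definition trace_preserving :: "nat \<Rightarrow> (complex mat \<Rightarrow> complex mat) \<Rightarrow> bool" where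
  "trace_preserving m \<Phi> \<longleftrightarrow> (\<forall>A \<in> carrier_mat m m. tr (\<Phi> A) = tr A)"

definition quantum_channel :: "nat \<Rightarrow> nat \<Rightarrow> (complex mat \<Rightarrow> complex mat) \<Rightarrow> bool" where
  "quantum_channel m n \<Phi> \<longleftrightarrow> linear_map m n \<Phi> \<and> completely_positive m n \<Phi> \<and> trace_preserving m \<Phi>"

definition povm :: "nat \<Rightarrow> 'a set \<Rightarrow> ('a \<Rightarrow> complex mat) \<Rightarrow> bool" where
  "povm n S Q \<longleftrightarrow> finite S \<and> (\<forall>s\<in>S. psd n (Q s)) \<and> msum n Q S = 1\<^sub>m n"

subsection \<open>Hypothesis-testing relative entropy\<close>

definition neg_log2 :: "real \<Rightarrow> ereal" where
  "neg_log2 t = (if t = 0 then \<infinity> else ereal (- log 2 t))"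

text \<open>For states the feasible set is nonempty and compact, so the supremum is attained.\<close>
definition hyp_test_rel_ent :: "real \<Rightarrow> complex mat \<Rightarrow> complex mat \<Rightarrow> ereal" where
  "hyp_test_rel_ent \<epsilon> \<rho> \<sigma> =
     (SUP T \<in> {T. psd (dim_row \<rho>) T \<and> psd (dim_row \<rho>) (1\<^sub>m (dim_row \<rho>) - T) \<and>
                  Re (tr (T * \<rho>)) \<ge> 1 - \<epsilon>}.
        neg_log2 (Re (tr (T * \<sigma>))))"

text \<open>
  \<open>2\<^sup>x\<close> with \<open>2\<^sup>-\<^sup>\<infinity> = 0\<close>.  It is only applied to \<open>R - hyp_test_rel_ent \<epsilon> \<rho> \<sigma>\<close> with \<open>R\<close> real and
  \<open>\<rho>, \<sigma>\<close> states, which is never \<open>\<infinity>\<close>, so the value there is immaterial.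
\<close>
definition exp2 :: "ereal \<Rightarrow> real" where
  "exp2 x = (if x = - \<infinity> then 0 else 2 powr real_of_ereal x)"

subsection \<open>Classical-quantum states and conditional product states\<close>

definition prob_dist :: "nat \<Rightarrow> (nat \<Rightarrow> real) \<Rightarrow> bool" where
  "prob_dist k p \<longleftrightarrow> (\<forall>x<k. 0 \<le> p x) \<and> (\<Sum>x<k. p x) = 1"

text \<open>
  A classical system \<open>X = (X\<^sub>v)\<^sub>v\<close> is given by the list \<open>ks\<close> of its alphabet sizes; the positions
  in the list form the index set \<open>V\<close>, and the values of \<open>X\<close> are the tuples in \<open>tuples ks\<close>.
\<close>
definition tuples :: "nat list \<Rightarrow> nat list set" where
  "tuples ks = listset (map lessThan ks)"

definition basis_proj :: "nat \<Rightarrow> nat \<Rightarrow> complex mat" where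
  "basis_proj k x = mat k k (\<lambda>(i, j). if i = x \<and> j = x then 1 else 0)"

definition tuple_proj :: "nat list \<Rightarrow> nat list \<Rightarrow> complex mat" where
  "tuple_proj ks x = foldr kron (map2 basis_proj ks x) (1\<^sub>m 1)"

definition cq_state ::
  "nat list \<Rightarrow> nat \<Rightarrow> (nat list \<Rightarrow> real) \<Rightarrow> (nat list \<Rightarrow> complex mat) \<Rightarrow> complex mat" where
  "cq_state ks d p \<rho> = msum (prod_list ks * d)
     (\<lambda>x. complex_of_real (p x) \<cdot>\<^sub>m (tuple_proj ks x \<otimes>\<^sub>m \<rho> x)) (tuples ks)"

text \<open>
  Recovering \<open>p\<^sub>X(x)\<close> and \<open>\<rho>\<^sub>B\<^sup>(\<^sup>x\<^sup>)\<close> from \<open>\<rho>\<^sub>X\<^sub>B\<close>: \<open>cq_block\<close> is \<open>p\<^sub>X(x) \<rho>\<^sub>B\<^sup>(\<^sup>x\<^sup>)\<close>.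
  If \<open>p\<^sub>X(x) = 0\<close> then \<open>cq_cond\<close> is \<open>0\<close>, but it then only occurs with weight \<open>0\<close>.
\<close>
definition cq_block :: "nat list \<Rightarrow> nat \<Rightarrow> complex mat \<Rightarrow> nat list \<Rightarrow> complex mat" where
  "cq_block ks d \<rho> x = ptrace 1 (prod_list ks) d ((tuple_proj ks x \<otimes>\<^sub>m 1\<^sub>m d) * \<rho>)"

definition cq_prob :: "nat list \<Rightarrow> nat \<Rightarrow> complex mat \<Rightarrow> nat list \<Rightarrow> real" where
  "cq_prob ks d \<rho> x = Re (tr (cq_block ks d \<rho> x))"

definition cq_cond :: "nat list \<Rightarrow> nat \<Rightarrow> complex mat \<Rightarrow> nat list \<Rightarrow> complex mat" where
  "cq_cond ks d \<rho> x = complex_of_real (1 / cq_prob ks d \<rho> x) \<cdot>\<^sub>m cq_block ks d \<rho> x"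

definition agree_off :: "nat list \<Rightarrow> nat set \<Rightarrow> nat list \<Rightarrow> nat list set" where
  "agree_off ks S x = {y \<in> tuples ks. \<forall>v < length ks. v \<notin> S \<longrightarrow> y ! v = x ! v}"

text \<open>
  The weights are \<open>p(y\<^sub>S | x\<^sub>V\<^sub>-\<^sub>S)\<close>, where \<open>y\<close> ranges over the tuples equal to \<open>x\<close> outside \<open>S\<close>.
\<close>
definition cq_cond_off :: "nat list \<Rightarrow> nat \<Rightarrow> nat set \<Rightarrow> complex mat \<Rightarrow> nat list \<Rightarrow> complex mat" where
  "cq_cond_off ks d S \<rho> x = msum d
     (\<lambda>y. complex_of_real (cq_prob ks d \<rho> y / (\<Sum>z \<in> agree_off ks S x. cq_prob ks d \<rho> z))
            \<cdot>\<^sub>m cq_cond ks d \<rho> y)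
     (agree_off ks S x)"

definition cond_product_state :: "nat list \<Rightarrow> nat \<Rightarrow> nat set \<Rightarrow> complex mat \<Rightarrow> complex mat" where
  "cond_product_state ks d S \<rho> = cq_state ks d (cq_prob ks d \<rho>) (cq_cond_off ks d S \<rho>)"

subsection \<open>Classical-quantum relay channels and codes\<close>

text \<open>\<open>out N x\<^sub>1 x\<^sub>2\<close> is the output state on \<open>B\<^sub>2 \<otimes> B\<^sub>3\<close>.\<close>
record relay_channel =
  nX1 :: nat
  nX2 :: nat
  dB2 :: nat
  dB3 :: nat
  out :: "nat \<Rightarrow> nat \<Rightarrow> complex mat"

definition cq_relay_channel :: "relay_channel \<Rightarrow> bool" where
  "cq_relay_channel N \<longleftrightarrow> 0 < nX1 N \<and> 0 < nX2 N \<and>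
     (\<forall>x1 < nX1 N. \<forall>x2 < nX2 N. density (dB2 N * dB3 N) (out N x1 x2))"

text \<open>Time steps \<open>j\<close> run from \<open>1\<close> to \<open>n\<close>; \<open>mem C j\<close> is the dimension of \<open>(B\<^sub>2')\<^sub>j\<close>.\<close>
record relay_code =
  msgs :: "nat set"
  enc :: "nat \<Rightarrow> nat \<Rightarrow> nat"
  mem :: "nat \<Rightarrow> nat"
  relay_op :: "nat \<Rightarrow> complex mat \<Rightarrow> complex mat"
  dec :: "nat \<Rightarrow> complex mat"

text \<open>The dimension of \<open>(B\<^sub>2')\<^sub>j \<otimes> (B\<^sub>2)\<^sub>j\<close>, which is trivial for \<open>j = 0\<close>.\<close>
definition relay_dim :: "relay_channel \<Rightarrow> relay_code \<Rightarrow> nat \<Rightarrow> nat" where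
  "relay_dim N C j = (if j = 0 then 1 else mem C j * dB2 N)"

text \<open>The right factor, of dimension \<open>k\<close>, of the output of \<open>\<Phi>\<close> is classical.\<close>
definition classical_right :: "nat \<Rightarrow> nat \<Rightarrow> nat \<Rightarrow> (complex mat \<Rightarrow> complex mat) \<Rightarrow> bool" where
  "classical_right m e k \<Phi> \<longleftrightarrow>
     (\<forall>A \<in> carrier_mat m m. \<forall>r < e * k. \<forall>s < e * k. r mod k \<noteq> s mod k \<longrightarrow> \<Phi> A $$ (r, s) = 0)"

definition is_relay_code :: "relay_channel \<Rightarrow> nat \<Rightarrow> real \<Rightarrow> relay_code \<Rightarrow> bool" where
  "is_relay_code N n R C \<longleftrightarrow>
     finite (msgs C) \<and> real (card (msgs C)) = 2 powr (real n * R) \<and>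
     (\<forall>m \<in> msgs C. \<forall>j \<in> {1..n}. enc C m j < nX1 N) \<and>
     (\<forall>j \<in> {1..n}. 0 < mem C j \<and>
        quantum_channel (relay_dim N C (j - 1)) (mem C j * nX2 N) (relay_op C j) \<and>
        classical_right (relay_dim N C (j - 1)) (mem C j) (nX2 N) (relay_op C j)) \<and>
     povm (dB3 N ^ n) (msgs C) (dec C)"

text \<open>The channel as a map from operators on \<open>X\<^sub>2\<close> to operators on \<open>B\<^sub>2 \<otimes> B\<^sub>3\<close>, given \<open>x\<^sub>1\<close>.\<close>
definition channel_use :: "relay_channel \<Rightarrow> nat \<Rightarrow> complex mat \<Rightarrow> complex mat" where
  "channel_use N x1 \<omega> = msum (dB2 N * dB3 N) (\<lambda>x2. \<omega> $$ (x2, x2) \<cdot>\<^sub>m out N x1 x2) {..<nX2 N}"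

text \<open>
  The joint state after \<open>j\<close> rounds, on \<open>(B\<^sub>2')\<^sub>j \<otimes> (B\<^sub>2)\<^sub>j \<otimes> (B\<^sub>3)\<^sub>j \<otimes> \<dots> \<otimes> (B\<^sub>3)\<^sub>1\<close>.  In each round
  the relay maps \<open>(B\<^sub>2') \<otimes> (B\<^sub>2)\<close> to \<open>(B\<^sub>2') \<otimes> X\<^sub>2\<close> and then the channel maps \<open>X\<^sub>2\<close> to \<open>B\<^sub>2 \<otimes> B\<^sub>3\<close>.
\<close>
fun round_state :: "relay_channel \<Rightarrow> relay_code \<Rightarrow> nat \<Rightarrow> nat \<Rightarrow> complex mat" where
  "round_state N C m 0 = 1\<^sub>m 1"
| "round_state N C m (Suc j) =
     local_op (mem C (Suc j)) (nX2 N) (dB2 N * dB3 N) (dB3 N ^ j) (channel_use N (enc C m (Suc j)))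
       (local_op 1 (relay_dim N C j) (mem C (Suc j) * nX2 N) (dB3 N ^ j) (relay_op C (Suc j))
         (round_state N C m j))"

definition receiver_state :: "relay_channel \<Rightarrow> relay_code \<Rightarrow> nat \<Rightarrow> nat \<Rightarrow> complex mat" where
  "receiver_state N C n m = ptrace 1 (relay_dim N C n) (dB3 N ^ n) (round_state N C m n)"

definition error_prob :: "relay_channel \<Rightarrow> nat \<Rightarrow> relay_code \<Rightarrow> real" where
  "error_prob N n C = 1 / real (card (msgs C)) *
     (\<Sum>m \<in> msgs C. Re (tr ((1\<^sub>m (dB3 N ^ n) - dec C m) * receiver_state N C n m)))"

definition achievable :: "relay_channel \<Rightarrow> real \<Rightarrow> nat \<Rightarrow> real \<Rightarrow> bool" where
  "achievable N R n \<delta> \<longleftrightarrow> 0 \<le> R \<and> 0 \<le> \<delta> \<and> \<delta> \<le> 1 \<and>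
     (\<exists>R' C. R' \<ge> R \<and> is_relay_code N n R' C \<and> error_prob N n C \<le> \<delta>)"

definition f_univ :: "nat \<Rightarrow> real \<Rightarrow> real" where
  "f_univ k \<epsilon> = (1 + 6 * 2 powr ((real k + 1) / 2) + 4 * 2 ^ (2 ^ (k + 5) + k\<^sup>2 + 2 * k))
                 * \<epsilon> powr (1 / 3)"

end

theory Submission
  imports Defs "HOL-Library.FuncSet"
begin

text \<open>
  Block-Markov decode-and-forward with one channel use per block and one random codebook pair
  \<open>(c\<^sub>1, c\<^sub>2)\<close> of size \<open>L = \<lceil>2\<^sup>R\<rceil>\<close>, reused in every block.  In block \<open>j\<close> the sender transmits
  \<open>c\<^sub>1(m\<^sub>j)\<close> and the relay transmits \<open>c\<^sub>2\<close> of its estimate of \<open>m\<^sub>j\<^sub>-\<^sub>1\<close>; the relay then decodes \<open>m\<^sub>j\<close>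
  from \<open>(B\<^sub>2)\<^sub>j\<close> and the receiver decodes \<open>m\<^sub>j\<^sub>-\<^sub>1\<close> from \<open>(B\<^sub>3)\<^sub>j\<close>.  As long as the relay has been
  correct the blocks are in a product state, so the errors of the individual steps add up.

  Each step decodes sequentially: with tests \<open>T\<^sub>i\<close> and \<open>S\<^sub>m = (I - T\<^sub>m\<^sub>-\<^sub>1) \<dots> (I - T\<^sub>0)\<close>, outcome \<open>m\<close> is
  \<open>S\<^sub>m\<^sup>* S\<^sub>m - S\<^sub>m\<^sub>+\<^sub>1\<^sup>* S\<^sub>m\<^sub>+\<^sub>1\<close> (without the subtrahend for the last \<open>m\<close>).  Gao's union bound limits its error to
  \<open>4 (\<Sum>i<m. tr (T\<^sub>i \<rho>)) + 4 tr ((I - T\<^sub>m) \<rho>)\<close>, which replaces the square-root measurement and the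
  Hayashi-Nagaoka inequality, and averages to \<open>4 (L - 1) tr (T \<sigma>) + 4 \<epsilon>\<close> over the codebooks.
\<close>

subsection \<open>Operators as kernels\<close>

text \<open>The relay's wrong guesses never have to be followed. Its memory is a classical register,
  so the success probability is a sum of nonnegative terms over the sequences of its estimates, and
  dropping all terms but the one with every estimate correct leaves a lower bound. There the factor
  of a block depends only on the pair (a, a') of previous and current message. This is why reusing
  the codebooks is harmless: only the mean error of each pair matters, never independence between
  blocks, and a = a' is no exception because the two codebooks are drawn independently of each
  other. Inside a block, relay and receiver measure different factors of a possibly entangled
  output; positivity of (I - E) \<otimes> (I - F) adds up their errors with no extra constant. Gao's
  argument is run with 0 \<le> T and T^2 \<le> T alone, so the tests may be arbitrary effects.
  Constants: the two decoders cost 4 \<epsilon> each, and taking tests only within \<epsilon> of the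
  optimum costs 4 \<epsilon> more for each; f(1, \<epsilon>) covers these 16 \<epsilon> since
  \<epsilon> \<le> \<epsilon>^(1/3). Rounding 2^R up keeps the rate, while only L - 1 \<le> 2^R
  wrong codewords compete.\<close>

text \<open>
  An operator on \<open>\<complex>\<^sup>n\<close> is given by its entries, as a function on \<open>nat \<times> nat\<close>, and a vector by its
  components; values at indices \<open>\<ge> n\<close> are irrelevant.
\<close>

definition sesq :: "nat \<Rightarrow> (nat \<Rightarrow> nat \<Rightarrow> complex) \<Rightarrow> (nat \<Rightarrow> complex) \<Rightarrow> (nat \<Rightarrow> complex) \<Rightarrow> complex" where
  "sesq n T f g = (\<Sum>i<n. \<Sum>j<n. cnj (f i) * T i j * g j)"

definition pos :: "nat \<Rightarrow> (nat \<Rightarrow> nat \<Rightarrow> complex) \<Rightarrow> bool" where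
  "pos n T \<longleftrightarrow> (\<forall>f. 0 \<le> sesq n T f f)"

definition idk :: "nat \<Rightarrow> nat \<Rightarrow> complex" where
  "idk i j = (if i = j then 1 else 0)"

definition trp :: "nat \<Rightarrow> (nat \<Rightarrow> nat \<Rightarrow> complex) \<Rightarrow> (nat \<Rightarrow> nat \<Rightarrow> complex) \<Rightarrow> complex" where
  "trp n A B = (\<Sum>i<n. \<Sum>j<n. A i j * B j i)"

lemma sum_rotate3:
  "(\<Sum>i\<in>A. \<Sum>j\<in>B. \<Sum>k\<in>C. F i j k) = (\<Sum>k\<in>C. \<Sum>i\<in>A. \<Sum>j\<in>B. F i j k)"
proof -
  have "(\<Sum>i\<in>A. \<Sum>j\<in>B. \<Sum>k\<in>C. F i j k) = (\<Sum>i\<in>A. \<Sum>k\<in>C. \<Sum>j\<in>B. F i j k)"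
    by (intro sum.cong refl sum.swap)
  also have "\<dots> = (\<Sum>k\<in>C. \<Sum>i\<in>A. \<Sum>j\<in>B. F i j k)"
    by (rule sum.swap)
  finally show ?thesis .
qed

lemma sesq_add_left: "sesq n T (\<lambda>i. f i + g i) h = sesq n T f h + sesq n T g h"
  by (simp add: sesq_def algebra_simps sum.distrib)

lemma sesq_add_right: "sesq n T h (\<lambda>i. f i + g i) = sesq n T h f + sesq n T h g"
  by (simp add: sesq_def algebra_simps sum.distrib)

lemma sesq_diff_left: "sesq n T (\<lambda>i. f i - g i) h = sesq n T f h - sesq n T g h"
  by (simp add: sesq_def algebra_simps sum_subtractf)

lemma sesq_diff_right: "sesq n T h (\<lambda>i. f i - g i) = sesq n T h f - sesq n T h g"
  by (simp add: sesq_def algebra_simps sum_subtractf)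

lemma sesq_scale_left: "sesq n T (\<lambda>i. c * f i) h = cnj c * sesq n T f h"
  by (simp add: sesq_def algebra_simps sum_distrib_left)

lemma sesq_scale_right: "sesq n T h (\<lambda>i. c * f i) = c * sesq n T h f"
  by (simp add: sesq_def algebra_simps sum_distrib_left)

lemma sesq_sum_right: "sesq n T h (\<lambda>i. \<Sum>k\<in>K. f k i) = (\<Sum>k\<in>K. sesq n T h (f k))"
  by (induction K rule: infinite_finite_induct) (simp_all add: sesq_add_right, simp_all add: sesq_def)

lemma sesq_op_diff: "sesq n (\<lambda>i j. S i j - T i j) f g = sesq n S f g - sesq n T f g"
  by (simp add: sesq_def algebra_simps sum_subtractf)

lemma sesq_op_sum: "sesq n (\<lambda>i j. \<Sum>k\<in>K. T k i j) f g = (\<Sum>k\<in>K. sesq n (T k) f g)"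
proof -
  have "sesq n (\<lambda>i j. \<Sum>k\<in>K. T k i j) f g = (\<Sum>i<n. \<Sum>j<n. \<Sum>k\<in>K. cnj (f i) * T k i j * g j)"
    by (simp add: sesq_def sum_distrib_left sum_distrib_right)
  also have "\<dots> = (\<Sum>k\<in>K. \<Sum>i<n. \<Sum>j<n. cnj (f i) * T k i j * g j)"
    by (rule sum_rotate3)
  finally show ?thesis by (simp add: sesq_def)
qed

lemma sesq_cong:
  assumes "\<And>i j. i < n \<Longrightarrow> j < n \<Longrightarrow> S i j = T i j" "\<And>i. i < n \<Longrightarrow> f i = f' i" "\<And>i. i < n \<Longrightarrow> g i = g' i"
  shows "sesq n S f g = sesq n T f' g'"
  unfolding sesq_def by (intro sum.cong refl) (simp add: assms)

lemma posD: "pos n T \<Longrightarrow> 0 \<le> sesq n T f f"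
  by (simp add: pos_def)

lemma pos_cong: "(\<And>i j. i < n \<Longrightarrow> j < n \<Longrightarrow> S i j = T i j) \<Longrightarrow> pos n S \<longleftrightarrow> pos n T"
  by (simp add: pos_def cong: sesq_cong)

text \<open>Polarisation. Nonnegativity of a complex number includes being real, and realness of the
  form at f + g and at f + \<i> g settles the imaginary and the real part of the claim.\<close>

lemma pos_sesq_cnj:
  assumes "pos n T"
  shows "sesq n T g f = cnj (sesq n T f g)"
proof -
  have "Im (sesq n T (\<lambda>i. f i + g i) (\<lambda>i. f i + g i)) = 0"
       "Im (sesq n T (\<lambda>i. f i + \<i> * g i) (\<lambda>i. f i + \<i> * g i)) = 0"
       "Im (sesq n T f f) = 0" "Im (sesq n T g g) = 0"
    using posD[OF assms] by (simp_all add: less_eq_complex_def)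
  then show ?thesis
    by (simp add: sesq_add_left sesq_add_right sesq_scale_left sesq_scale_right complex_eq_iff)
qed

lemma sesq_unit:
  assumes "i < n" "j < n"
  shows "sesq n T (idk i) (idk j) = T i j"
proof -
  have "sesq n T (idk i) (idk j) = (\<Sum>i'<n. \<Sum>j'<n. if i' = i \<and> j' = j then T i j else 0)"
    unfolding sesq_def idk_def by (intro sum.cong refl) auto
  also have "\<dots> = (\<Sum>i'<n. if i' = i then T i j else 0)"
    using assms by (intro sum.cong refl) auto
  finally show ?thesis using assms by simp
qed

lemma pos_hermitian:
  assumes "pos n T" "i < n" "j < n"
  shows "T j i = cnj (T i j)"
  using pos_sesq_cnj[OF assms(1), of "idk j" "idk i"] assms by (simp add: sesq_unit)

lemma pos_diag: "pos n T \<Longrightarrow> i < n \<Longrightarrow> 0 \<le> T i i"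
  using posD[of n T "idk i"] by (simp add: sesq_unit)

lemma pos_sum: "(\<And>k. k \<in> K \<Longrightarrow> pos n (T k)) \<Longrightarrow> pos n (\<lambda>i j. \<Sum>k\<in>K. T k i j)"
  by (simp add: pos_def sesq_op_sum sum_nonneg)

lemma pos_zero: "pos n (\<lambda>i j. 0)"
  by (simp add: pos_def sesq_def)

lemma sesq_Suc:
  "sesq (Suc n) T f g = sesq n T f g + (\<Sum>i<n. cnj (f i) * T i n) * g n
     + cnj (f n) * (\<Sum>j<n. T n j * g j) + cnj (f n) * T n n * g n"
  by (simp add: sesq_def sum.distrib sum_distrib_left sum_distrib_right algebra_simps)

text \<open>Otherwise the form at e_i + c e_j is affine in c, with nothing quadratic to stop it from
  becoming negative.\<close>

lemma pos_zero_diag: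
  assumes "pos n T" "i < n" "j < n" "T j j = 0"
  shows "T i j = 0"
proof (rule ccontr)
  assume nz: "T i j \<noteq> 0"
  define z where "z = T i j"
  \<comment> \<open>Chosen so that the form takes the value -1 exactly.\<close>
  define t where "t = (Re (T i i) + 1) / (2 * (cmod z)\<^sup>2)"
  define c where "c = - (complex_of_real t * cnj z)"
  have Tji: "T j i = cnj z" using pos_hermitian[OF assms(1-3)] z_def by simp
  have "0 \<le> Re (sesq n T (\<lambda>k. idk i k + c * idk j k) (\<lambda>k. idk i k + c * idk j k))"
    using posD[OF assms(1)] by (simp add: less_eq_complex_def)
  also have "sesq n T (\<lambda>k. idk i k + c * idk j k) (\<lambda>k. idk i k + c * idk j k)
     = T i i + c * z + cnj c * cnj z"
    using assms Tji z_def
    by (simp add: sesq_add_left sesq_add_right sesq_scale_left sesq_scale_right sesq_unit algebra_simps)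
  also have "Re \<dots> = Re (T i i) - 2 * t * (cmod z)\<^sup>2"
    by (simp add: c_def cmod_def algebra_simps power2_eq_square)
  also have "\<dots> = -1" using nz by (simp add: t_def z_def field_simps)
  finally show False by simp
qed

text \<open>The last coordinate of the test vector is set to the value that minimises the form; the
  minimum is the form of the Schur complement.\<close>

lemma pos_schur_complement:
  assumes "pos (Suc n) T" "T n n \<noteq> 0"
  shows "pos n (\<lambda>i j. T i j - T i n * T n j / T n n)"
  unfolding pos_def
proof
  fix f
  define s where "s = (\<Sum>j<n. T n j * f j)"
  define g where "g = f(n := - s / T n n)"
  have herm: "T i n = cnj (T n i)" if "i < n" for i
    using pos_hermitian[OF assms(1), of n i] that by simp
  have real: "cnj (T n n) = T n n"
    using pos_hermitian[OF assms(1), of n n] by simp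
  have s': "(\<Sum>i<n. cnj (f i) * T i n) = cnj s"
    by (simp add: s_def herm mult.commute)
  have "0 \<le> sesq (Suc n) T g g" using posD[OF assms(1)] .
  also have "sesq (Suc n) T g g = sesq n T f f - cnj s * s / T n n"
  proof -
    have "sesq n T g g = sesq n T f f" by (rule sesq_cong) (auto simp: g_def)
    moreover have "(\<Sum>i<n. cnj (g i) * T i n) = cnj s" using s' by (simp add: g_def)
    moreover have "(\<Sum>j<n. T n j * g j) = s" by (simp add: g_def s_def)
    moreover have "g n = - s / T n n" by (simp add: g_def)
    ultimately show ?thesis using assms(2) by (simp add: sesq_Suc real)
  qed
  also have "cnj s * s / T n n = sesq n (\<lambda>i j. T i n * T n j / T n n) f f"
  proof -
    have "cnj s * s = (\<Sum>i<n. \<Sum>j<n. cnj (f i) * T i n * (T n j * f j))"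
      unfolding s'[symmetric] by (simp add: s_def sum_product)
    then show ?thesis
      by (simp add: sesq_def sum_divide_distrib mult.assoc)
  qed
  finally show "0 \<le> sesq n (\<lambda>i j. T i j - T i n * T n j / T n n) f f"
    by (simp add: sesq_op_diff)
qed

text \<open>A Cholesky factorisation, by elimination of the last coordinate. It takes the place of
  the spectral theorem: every later passage from vectors to mixed states or to general positive
  operators goes through it.\<close>

lemma pos_decomposition:
  assumes "pos n T"
  shows "\<exists>W. \<forall>i<n. \<forall>j<n. T i j = (\<Sum>l<n. W l i * cnj (W l j))"
  using assms
proof (induction n arbitrary: T)
  case 0
  then show ?case by simp
next
  case (Suc n)
  have herm: "T i n = cnj (T n i)" "T n i = cnj (T i n)" if "i < n" for i
    using pos_hermitian[OF Suc.prems, of n i] that by simp_all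
  show ?case
  proof (cases "T n n = 0")
    case True
    have z: "T i n = 0" "T n i = 0" if "i < n" for i
      using pos_zero_diag[OF Suc.prems _ _ True, of i] herm(2)[of i] that by simp_all
    have "pos n T"
      unfolding pos_def
    proof
      fix f
      have "0 \<le> sesq (Suc n) T f f" using posD[OF Suc.prems] .
      also have "\<dots> = sesq n T f f" using True by (simp add: sesq_Suc z)
      finally show "0 \<le> sesq n T f f" .
    qed
    from Suc.IH[OF this] obtain W where
      W: "\<And>i j. i < n \<Longrightarrow> j < n \<Longrightarrow> T i j = (\<Sum>l<n. W l i * cnj (W l j))" by blast
    show ?thesis
      by (rule exI[of _ "\<lambda>l i. if l < n \<and> i < n then W l i else 0"])
         (use z True W in \<open>auto simp: less_Suc_eq\<close>)
  next
    case False
    from Suc.IH[OF pos_schur_complement[OF Suc.prems False]] obtain W where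
      W: "\<And>i j. i < n \<Longrightarrow> j < n \<Longrightarrow> T i j - T i n * T n j / T n n = (\<Sum>l<n. W l i * cnj (W l j))"
      by blast
    define r where "r = complex_of_real (sqrt (Re (T n n)))"
    have "0 \<le> T n n" using pos_diag[OF Suc.prems] by simp
    then have rr: "r * r = T n n"
      by (simp add: r_def less_eq_complex_def complex_eq_iff flip: of_real_mult)
    have cr: "cnj r = r" by (simp add: r_def)
    have Tnn: "cnj (T n n) = T n n" using pos_hermitian[OF Suc.prems, of n n] by simp
    have rnz: "r \<noteq> 0" using rr False by auto
    \<comment> \<open>The factors of the Schur complement are extended by 0, and the new one is the
      last column over the root of the pivot, which gives back the rank-one term removed by the
      elimination.\<close>
    define V where "V l i = (if l < n then (if i < n then W l i else 0) else T i n / r)" for l i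
    have "T i j = (\<Sum>l<Suc n. V l i * cnj (V l j))" if ij: "i < Suc n" "j < Suc n" for i j
    proof -
      have Vn: "V n i * cnj (V n j) = T i n * T n j / T n n"
        using herm[of j] Tnn ij by (cases "j = n") (auto simp: V_def cr rr less_Suc_eq)
      show ?thesis
      proof (cases "i < n \<and> j < n")
        case True
        then have "(\<Sum>l<n. V l i * cnj (V l j)) = T i j - T i n * T n j / T n n"
          using W by (simp add: V_def)
        then show ?thesis by (simp add: Vn)
      next
        case nn: False
        then have "(\<Sum>l<n. V l i * cnj (V l j)) = 0" by (auto intro: sum.neutral simp: V_def)
        moreover have "T i n * T n j / T n n = T i j" using nn ij False by (auto simp: less_Suc_eq)
        ultimately show ?thesis by (simp add: Vn)
      qed
    qed
    then show ?thesis by blast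
  qed
qed

text \<open>Together with \<open>pos_decomposition\<close> this lifts inequalities between quadratic
  forms to traces against arbitrary positive operators.\<close>

lemma trp_rank_one_sum:
  assumes "\<And>i j. i < n \<Longrightarrow> j < n \<Longrightarrow> B i j = (\<Sum>l<m. W l i * cnj (W l j))"
  shows "trp n A B = (\<Sum>l<m. sesq n A (W l) (W l))"
proof -
  have "trp n A B = (\<Sum>i<n. \<Sum>j<n. \<Sum>l<m. cnj (W l i) * A i j * W l j)"
    unfolding trp_def using assms by (intro sum.cong refl) (simp add: sum_distrib_left mult_ac)
  also have "\<dots> = (\<Sum>l<m. sesq n A (W l) (W l))"
    unfolding sesq_def by (rule sum_rotate3)
  finally show ?thesis .
qed

lemma trp_nonneg:
  assumes "pos n A" "pos n B"
  shows "0 \<le> trp n A B"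
proof -
  obtain W where "\<forall>i<n. \<forall>j<n. B i j = (\<Sum>l<n. W l i * cnj (W l j))"
    using pos_decomposition[OF assms(2)] by blast
  then have "trp n A B = (\<Sum>l<n. sesq n A (W l) (W l))"
    by (intro trp_rank_one_sum) auto
  then show ?thesis using posD[OF assms(1)] by (simp add: sum_nonneg)
qed

lemma trp_commute: "trp n A B = trp n B A"
  unfolding trp_def using sum.swap[of "\<lambda>i j. A i j * B j i"] by (simp add: mult.commute)

subsection \<open>Sequential decoding\<close>

definition ip :: "nat \<Rightarrow> (nat \<Rightarrow> complex) \<Rightarrow> (nat \<Rightarrow> complex) \<Rightarrow> complex" where
  "ip n f g = (\<Sum>i<n. cnj (f i) * g i)"

definition ap :: "nat \<Rightarrow> (nat \<Rightarrow> nat \<Rightarrow> complex) \<Rightarrow> (nat \<Rightarrow> complex) \<Rightarrow> nat \<Rightarrow> complex" where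
  "ap n T f i = (\<Sum>j<n. T i j * f j)"

definition effect :: "nat \<Rightarrow> (nat \<Rightarrow> nat \<Rightarrow> complex) \<Rightarrow> bool" where
  "effect n T \<longleftrightarrow> pos n T \<and> pos n (\<lambda>i j. idk i j - T i j)"

lemma idk_sum_left: "i < n \<Longrightarrow> (\<Sum>j<n. idk i j * f j) = f i"
  by (simp add: idk_def if_distrib[of "\<lambda>x. x * _"] cong: if_cong)

lemma sesq_idk: "sesq n idk f g = ip n f g"
proof -
  have "sesq n idk f g = (\<Sum>i<n. cnj (f i) * (\<Sum>j<n. idk i j * g j))"
    by (simp add: sesq_def sum_distrib_left mult.assoc)
  also have "\<dots> = ip n f g"
    unfolding ip_def by (intro sum.cong refl) (simp add: idk_sum_left)
  finally show ?thesis .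
qed

lemma sesq_ap: "sesq n T f g = ip n f (ap n T g)"
  by (simp add: sesq_def ip_def ap_def sum_distrib_left mult.assoc)

lemma ip_cnj: "cnj (ip n f g) = ip n g f"
  by (simp add: ip_def mult.commute)

lemma ip_ap_left: "pos n T \<Longrightarrow> ip n (ap n T f) g = sesq n T f g"
  using pos_sesq_cnj[of n T f g] by (simp add: sesq_ap ip_cnj)

lemma ip_self: "ip n f f = complex_of_real (\<Sum>i<n. (cmod (f i))\<^sup>2)"
  by (simp add: ip_def mult.commute complex_norm_square[symmetric])

lemma ip_self_nonneg: "0 \<le> ip n f f"
  by (simp add: ip_self less_eq_complex_def sum_nonneg)

lemma pos_idk: "pos n idk"
  by (simp add: pos_def sesq_idk ip_self_nonneg)

lemma ip_diff_left: "ip n (\<lambda>i. f i - g i) h = ip n f h - ip n g h"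
  by (simp add: ip_def algebra_simps sum_subtractf)

lemma ip_diff_right: "ip n h (\<lambda>i. f i - g i) = ip n h f - ip n h g"
  by (simp add: ip_def algebra_simps sum_subtractf)

lemma ip_cong: "(\<And>i. i < n \<Longrightarrow> f i = f' i) \<Longrightarrow> (\<And>i. i < n \<Longrightarrow> g i = g' i) \<Longrightarrow> ip n f g = ip n f' g'"
  unfolding ip_def by (intro sum.cong refl) simp

lemma effect_complement: "effect n T \<Longrightarrow> effect n (\<lambda>i j. idk i j - T i j)"
  by (simp add: effect_def)

text \<open>T - T^2 = T (I - T) T + (I - T) T (I - T), and both summands are positive. No functional
  calculus is involved.\<close>

lemma effect_square_le:
  assumes "effect n T"
  shows "ip n (ap n T f) (ap n T f) \<le> sesq n T f f"
proof -
  define g where "g = ap n T f"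
  have p: "pos n T" "pos n (\<lambda>i j. idk i j - T i j)" using assms by (auto simp: effect_def)
  have 1: "sesq n T f g = ip n g g" using ip_ap_left[OF p(1), of f g] by (simp add: g_def)
  have 2: "sesq n T g f = ip n g g" by (simp add: sesq_ap g_def)
  have "0 \<le> sesq n (\<lambda>i j. idk i j - T i j) g g + sesq n T (\<lambda>i. f i - g i) (\<lambda>i. f i - g i)"
    by (intro add_nonneg_nonneg posD p)
  also have "\<dots> = sesq n T f f - ip n g g"
    by (simp add: sesq_op_diff sesq_diff_left sesq_diff_right sesq_idk 1 2)
  finally show ?thesis by (simp add: g_def)
qed

text \<open>The vector S_m f of the overview; the test with index 0 acts first.\<close>

fun chain :: "nat \<Rightarrow> (nat \<Rightarrow> nat \<Rightarrow> nat \<Rightarrow> complex) \<Rightarrow> nat \<Rightarrow> (nat \<Rightarrow> complex) \<Rightarrow> nat \<Rightarrow> complex" where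
  "chain n T 0 f = f"
| "chain n T (Suc m) f = (\<lambda>k. chain n T m f k - ap n (T m) (chain n T m f) k)"

lemma chain_cong_tests: "(\<And>i. i < m \<Longrightarrow> S i = T i) \<Longrightarrow> chain n S m f = chain n T m f"
  by (induction m) auto

lemma chain_cong:
  assumes "\<And>k. k < n \<Longrightarrow> f k = g k" "k < n"
  shows "chain n T m f k = chain n T m g k"
  using assms(2)
proof (induction m arbitrary: k)
  case (Suc m)
  have "ap n (T m) (chain n T m f) k = ap n (T m) (chain n T m g) k"
    unfolding ap_def using Suc.IH by (intro sum.cong) auto
  then show ?case using Suc by simp
qed (simp add: assms(1))

lemma chain_linear:
  "chain n T m (\<lambda>k. \<Sum>q\<in>Q. c q * g q k) = (\<lambda>k. \<Sum>q\<in>Q. c q * chain n T m (g q) k)"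
proof (induction m)
  case (Suc m)
  have "ap n (T m) (\<lambda>k. \<Sum>q\<in>Q. c q * chain n T m (g q) k) k
      = (\<Sum>q\<in>Q. c q * ap n (T m) (chain n T m (g q)) k)" for k
  proof -
    have "ap n (T m) (\<lambda>k. \<Sum>q\<in>Q. c q * chain n T m (g q) k) k
       = (\<Sum>j<n. \<Sum>q\<in>Q. c q * (T m k j * chain n T m (g q) j))"
      by (simp add: ap_def sum_distrib_left mult_ac)
    also have "\<dots> = (\<Sum>q\<in>Q. \<Sum>j<n. c q * (T m k j * chain n T m (g q) j))"
      by (rule sum.swap)
    finally show ?thesis by (simp add: ap_def sum_distrib_left)
  qed
  then show ?case using Suc by (simp add: algebra_simps sum_subtractf)
qed simp

lemma chain_step:
  assumes "pos n (T m)"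
  shows "ip n (chain n T (Suc m) f) (chain n T (Suc m) f) =
    ip n (chain n T m f) (chain n T m f) - 2 * sesq n (T m) (chain n T m f) (chain n T m f)
      + ip n (ap n (T m) (chain n T m f)) (ap n (T m) (chain n T m f))"
proof -
  have "ip n (ap n (T m) (chain n T m f)) (chain n T m f) = sesq n (T m) (chain n T m f) (chain n T m f)"
    using ip_ap_left[OF assms] .
  then show ?thesis
    by (simp add: ip_diff_left ip_diff_right sesq_ap)
qed

text \<open>
  A union bound for the non-commuting maps \<open>I - T\<^sub>i\<close>.  The two ways of telescoping
  \<open>\<psi> - \<psi>\<^sub>m\<close> and \<open>\<parallel>\<psi>\<parallel>\<^sup>2 - \<parallel>\<psi>\<^sub>m\<parallel>\<^sup>2\<close> are linked by positivity of \<open>T\<^sub>i\<close> on \<open>2\<psi> - \<psi>\<^sub>i\<close>.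
\<close>
lemma sequential_union_bound:
  assumes "\<And>i. i < m \<Longrightarrow> effect n (T i)"
  shows "Re (ip n f f) - Re (ip n (chain n T m f) (chain n T m f)) \<le> 4 * (\<Sum>i<m. Re (sesq n (T i) f f))"
proof -
  define c where "c i = chain n T i f" for i
  define s where "s i = Re (sesq n (T i) (c i) (c i))" for i
  have p: "pos n (T i)" if "i < m" for i using assms[OF that] by (simp add: effect_def)
  have norms: "(\<Sum>i<k. s i) \<le> Re (ip n f f) - Re (ip n (c k) (c k))" if "k \<le> m" for k
    using that
  proof (induction k)
    case (Suc k)
    have "ip n (c (Suc k)) (c (Suc k)) = ip n (c k) (c k) - 2 * sesq n (T k) (c k) (c k)
      + ip n (ap n (T k) (c k)) (ap n (T k) (c k))"
      unfolding c_def by (rule chain_step) (use Suc.prems p in auto)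
    moreover have "Re (ip n (ap n (T k) (c k)) (ap n (T k) (c k))) \<le> s k"
      unfolding s_def using effect_square_le[OF assms, of k "c k"] Suc.prems
      by (auto simp: less_eq_complex_def)
    ultimately show ?case using Suc by (simp add: s_def)
  qed (simp add: c_def)
  have tele: "ip n f f - ip n f (c k) = (\<Sum>i<k. sesq n (T i) f (c i))" if "k \<le> m" for k
    using that
  proof (induction k)
    case (Suc k)
    have "ip n f (c (Suc k)) = ip n f (c k) - sesq n (T k) f (c k)"
      by (simp add: c_def ip_diff_right sesq_ap)
    then show ?case using Suc by (simp add: algebra_simps)
  qed (simp add: c_def)
  \<comment> \<open>The weight 2 on f is what leaves only half of \<open>s i\<close> on the right,
    so that the \<open>s i\<close> can be absorbed below.\<close>
  have cross: "2 * Re (sesq n (T i) f (c i)) \<le> 2 * Re (sesq n (T i) f f) + s i / 2" if "i < m" for i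
  proof -
    have "0 \<le> sesq n (T i) (\<lambda>k. 2 * f k - c i k) (\<lambda>k. 2 * f k - c i k)"
      by (rule posD[OF p[OF that]])
    also have "\<dots> = 4 * sesq n (T i) f f - 2 * sesq n (T i) f (c i) - 2 * cnj (sesq n (T i) f (c i))
        + sesq n (T i) (c i) (c i)"
      by (simp add: sesq_diff_left sesq_diff_right sesq_scale_left sesq_scale_right
          pos_sesq_cnj[OF p[OF that], of "c i" f])
    finally show ?thesis by (simp add: s_def less_eq_complex_def)
  qed
  have "0 \<le> ip n (\<lambda>i. f i - c m i) (\<lambda>i. f i - c m i)" by (rule ip_self_nonneg)
  also have "\<dots> = ip n f f - ip n f (c m) - cnj (ip n f (c m)) + ip n (c m) (c m)"
    by (simp add: ip_diff_left ip_diff_right ip_cnj)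
  finally have "2 * Re (ip n f (c m)) \<le> Re (ip n f f) + Re (ip n (c m) (c m))"
    by (simp add: less_eq_complex_def)
  \<comment> \<open>Let D be the loss of squared norm. Then D \<le> 2 (Re (ip n f f) - Re (ip n f (c
    m))), which by \<open>cross\<close> is at most twice the sum of the test values at f plus half
    the sum of the \<open>s i\<close>. By \<open>norms\<close> the latter is at most D/2, and
    solving for D gives the constant 4.\<close>
  moreover have "Re (ip n f f) - Re (ip n f (c m)) = (\<Sum>i<m. Re (sesq n (T i) f (c i)))"
    using arg_cong[OF tele[of m], of Re] by simp
  moreover have "(\<Sum>i<m. 2 * Re (sesq n (T i) f (c i))) \<le> (\<Sum>i<m. 2 * Re (sesq n (T i) f f) + s i / 2)"
    by (intro sum_mono cross) simp
  moreover note norms[of m]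
  ultimately show ?thesis
    by (simp add: c_def sum.distrib sum_divide_distrib[symmetric] sum_distrib_left[symmetric])
qed

text \<open>The operator S_m^* S_m; the rows of \<open>idk\<close> serve as the basis
  vectors.\<close>

definition gram :: "nat \<Rightarrow> (nat \<Rightarrow> nat \<Rightarrow> nat \<Rightarrow> complex) \<Rightarrow> nat \<Rightarrow> nat \<Rightarrow> nat \<Rightarrow> complex" where
  "gram n T m p q = ip n (chain n T m (idk p)) (chain n T m (idk q))"

lemma sesq_gram: "sesq n (gram n T m) f f = ip n (chain n T m f) (chain n T m f)"
proof -
  have e: "chain n T m f k = (\<Sum>q<n. f q * chain n T m (idk q) k)" if "k < n" for k
  proof -
    have "chain n T m f k = chain n T m (\<lambda>k. \<Sum>q<n. f q * idk q k) k"
    proof (rule chain_cong[OF _ that])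
      fix k assume "k < n"
      then show "f k = (\<Sum>q<n. f q * idk q k)"
        using idk_sum_left[of k n f] by (simp add: idk_def mult.commute eq_commute cong: if_cong)
    qed
    then show ?thesis by (simp add: chain_linear)
  qed
  have "ip n (chain n T m f) (chain n T m f) =
    (\<Sum>k<n. (\<Sum>p<n. cnj (f p) * cnj (chain n T m (idk p) k)) * (\<Sum>q<n. f q * chain n T m (idk q) k))"
    unfolding ip_def by (intro sum.cong refl) (simp add: e)
  also have "\<dots> = (\<Sum>k<n. \<Sum>p<n. \<Sum>q<n. cnj (f p) * (cnj (chain n T m (idk p) k) * chain n T m (idk q) k) * f q)"
    unfolding sum_product by (simp only: mult_ac)
  also have "\<dots> = (\<Sum>p<n. \<Sum>q<n. \<Sum>k<n. cnj (f p) * (cnj (chain n T m (idk p) k) * chain n T m (idk q) k) * f q)"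
    by (rule sum_rotate3[symmetric])
  also have "\<dots> = sesq n (gram n T m) f f"
    by (simp add: sesq_def gram_def ip_def sum_distrib_left sum_distrib_right)
  finally show ?thesis by simp
qed

text \<open>All that the coding argument needs of a decoder, so that the sequential construction
  stays hidden afterwards. The state is not normalised: its trace stands where 1 would. Only tests
  before \<open>m\<close> count as competitors, because later ones have not yet been
  applied.\<close>

definition decoder_for ::
  "nat \<Rightarrow> nat \<Rightarrow> (nat \<Rightarrow> nat \<Rightarrow> nat \<Rightarrow> complex) \<Rightarrow> (nat \<Rightarrow> nat \<Rightarrow> nat \<Rightarrow> complex) \<Rightarrow> bool" where
  "decoder_for L n T \<Gamma> \<longleftrightarrow>
     (\<forall>i<L. pos n (\<Gamma> i)) \<and> (\<forall>p<n. \<forall>q<n. (\<Sum>i<L. \<Gamma> i p q) = idk p q) \<and>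
     (\<forall>\<rho> m. pos n \<rho> \<longrightarrow> m < L \<longrightarrow> Re (trp n idk \<rho>) - Re (trp n (\<Gamma> m) \<rho>)
        \<le> 4 * ((\<Sum>i<m. Re (trp n (T i) \<rho>)) + Re (trp n idk \<rho>) - Re (trp n (T m) \<rho>)))"

text \<open>To bound the error of message m, the union bound is applied to the tests T_0, ...,
  T_(m-1), I - T_m. The vector that survives them is T_m S_m f, and its squared norm is at most the
  probability of outcome m.\<close>

lemma sequential_decoder:
  assumes L: "0 < L" and eff: "\<And>i. i < L \<Longrightarrow> effect n (T i)"
  shows "\<exists>\<Gamma>. decoder_for L n T \<Gamma>"
proof -
  define \<Gamma> where "\<Gamma> i p q = (if Suc i = L then gram n T i p q else gram n T i p q - gram n T (Suc i) p q)"
    for i p q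
  have p: "pos n (T i)" if "i < L" for i using eff[OF that] by (simp add: effect_def)
  \<comment> \<open>Before the last outcome, \<Gamma>_i = S_i^* (2 T_i - T_i^2) S_i, and 2 T - T^2
    \<ge> T^2. For the last one \<Gamma>_i = S_i^* S_i, and I \<ge> T \<ge> T^2.\<close>
  have form: "ip n (ap n (T i) (chain n T i f)) (ap n (T i) (chain n T i f)) \<le> sesq n (\<Gamma> i) f f"
    if "i < L" for i f
  proof -
    define c where "c = chain n T i f"
    have sq: "ip n (ap n (T i) c) (ap n (T i) c) \<le> sesq n (T i) c c"
      by (rule effect_square_le[OF eff[OF that]])
    have le: "sesq n (T i) c c \<le> ip n c c"
    proof -
      have "0 \<le> sesq n (\<lambda>k j. idk k j - T i k j) c c"
        using eff[OF that] by (intro posD) (simp add: effect_def)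
      then show ?thesis by (simp add: sesq_op_diff sesq_idk)
    qed
    show ?thesis
    proof (cases "Suc i = L")
      case True
      then have "sesq n (\<Gamma> i) f f = ip n c c"
        by (simp add: \<Gamma>_def[abs_def] sesq_gram[symmetric] c_def cong: sesq_cong)
      then show ?thesis using order.trans[OF sq le] by (simp add: c_def)
    next
      case False
      then have "sesq n (\<Gamma> i) f f = ip n c c - ip n (chain n T (Suc i) f) (chain n T (Suc i) f)"
        by (simp add: \<Gamma>_def[abs_def] sesq_op_diff sesq_gram c_def del: chain.simps cong: sesq_cong)
      then have "sesq n (\<Gamma> i) f f = 2 * sesq n (T i) c c - ip n (ap n (T i) c) (ap n (T i) c)"
        using chain_step[of n T i f] p[OF that] by (simp add: c_def del: chain.simps)
      then show ?thesis using sq by (simp add: c_def less_eq_complex_def)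
    qed
  qed
  have "decoder_for L n T \<Gamma>"
    unfolding decoder_for_def
  proof (intro conjI allI impI)
    fix i assume "i < L"
    then show "pos n (\<Gamma> i)"
      unfolding pos_def using form order.trans[OF ip_self_nonneg] by blast
  next
    fix p q assume pq: "p < n" "q < n"
    obtain K where K: "L = Suc K" using L by (cases L) auto
    have "(\<Sum>i<L. \<Gamma> i p q) = (\<Sum>i<K. gram n T i p q - gram n T (Suc i) p q) + gram n T K p q"
      by (simp add: K \<Gamma>_def)
    also have "\<dots> = gram n T 0 p q" by (induction K) simp_all
    also have "\<dots> = idk p q"
      using sesq_unit[OF pq, of idk] by (simp add: gram_def sesq_idk)
    finally show "(\<Sum>i<L. \<Gamma> i p q) = idk p q" .
  next
    fix \<rho> :: "nat \<Rightarrow> nat \<Rightarrow> complex" and m assume \<rho>: "pos n \<rho>" and m: "m < L"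
    have vec: "Re (ip n f f) - Re (sesq n (\<Gamma> m) f f)
       \<le> 4 * ((\<Sum>i<m. Re (sesq n (T i) f f)) + Re (ip n f f) - Re (sesq n (T m) f f))" for f
    proof -
      \<comment> \<open>Complementing test m turns acceptance by T_m into one more event to be
        avoided, so a single union bound covers both kinds of error.\<close>
      define T' where "T' = T(m := (\<lambda>i j. idk i j - T m i j))"
      have c: "chain n T' m f = chain n T m f" by (rule chain_cong_tests) (simp add: T'_def)
      have "ap n (T m) (chain n T m f) k = chain n T' (Suc m) f k" if "k < n" for k
        using idk_sum_left[OF that, of "chain n T m f"]
        by (simp add: c) (simp add: T'_def ap_def algebra_simps sum_subtractf)
      then have "ip n (chain n T' (Suc m) f) (chain n T' (Suc m) f) \<le> sesq n (\<Gamma> m) f f"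
        using form[OF m, of f] by (simp cong: ip_cong del: chain.simps)
      moreover have "Re (ip n f f) - Re (ip n (chain n T' (Suc m) f) (chain n T' (Suc m) f))
         \<le> 4 * (\<Sum>i<Suc m. Re (sesq n (T' i) f f))"
        by (rule sequential_union_bound)
           (use eff m effect_complement in \<open>auto simp: T'_def less_Suc_eq\<close>)
      moreover have "(\<Sum>i<Suc m. Re (sesq n (T' i) f f))
         = (\<Sum>i<m. Re (sesq n (T i) f f)) + Re (ip n f f) - Re (sesq n (T m) f f)"
        by (simp add: T'_def sesq_op_diff sesq_idk)
      ultimately show ?thesis by (simp add: less_eq_complex_def del: chain.simps)
    qed
    \<comment> \<open>The bound is linear in the state, so it passes from the vectors W l to their
      sum of projectors.\<close>
    obtain W where W: "\<And>i j. i < n \<Longrightarrow> j < n \<Longrightarrow> \<rho> i j = (\<Sum>l<n. W l i * cnj (W l j))"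
      using pos_decomposition[OF \<rho>] by blast
    have t: "Re (trp n A \<rho>) = (\<Sum>l<n. Re (sesq n A (W l) (W l)))" for A
      by (simp add: trp_rank_one_sum[OF W])
    have "Re (trp n idk \<rho>) - Re (trp n (\<Gamma> m) \<rho>) = (\<Sum>l<n. Re (ip n (W l) (W l)) - Re (sesq n (\<Gamma> m) (W l) (W l)))"
      by (simp add: t sesq_idk sum_subtractf)
    also have "\<dots> \<le> (\<Sum>l<n. 4 * ((\<Sum>i<m. Re (sesq n (T i) (W l) (W l))) + Re (ip n (W l) (W l)) - Re (sesq n (T m) (W l) (W l))))"
      by (intro sum_mono vec)
    also have "\<dots> = 4 * ((\<Sum>i<m. Re (trp n (T i) \<rho>)) + Re (trp n idk \<rho>) - Re (trp n (T m) \<rho>))"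
      by (simp add: t sesq_idk sum_subtractf sum.distrib sum_distrib_left[symmetric] sum.swap[of _ "{..<m}" "{..<n}"])
    finally show "Re (trp n idk \<rho>) - Re (trp n (\<Gamma> m) \<rho>)
      \<le> 4 * ((\<Sum>i<m. Re (trp n (T i) \<rho>)) + Re (trp n idk \<rho>) - Re (trp n (T m) \<rho>))" .
  qed
  then show ?thesis by blast
qed

subsection \<open>Tensor products and measurement channels\<close>

lemma sum_lessThan_add:
  fixes f :: "nat \<Rightarrow> 'a::comm_monoid_add"
  shows "(\<Sum>i<a + b. f i) = (\<Sum>i<a. f i) + (\<Sum>u<b. f (a + u))"
  by (induction b) (simp_all add: add.assoc)

lemma sum_lessThan_mult:
  fixes f :: "nat \<Rightarrow> 'a::comm_monoid_add"
  shows "(\<Sum>i<m * k. f i) = (\<Sum>p<m. \<Sum>u<k. f (p * k + u))"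
proof (induction m)
  case (Suc m)
  have "(\<Sum>i<Suc m * k. f i) = (\<Sum>i<m * k + k. f i)" by (simp add: add.commute)
  then show ?case using Suc by (simp only: sum_lessThan_add sum.lessThan_Suc)
qed simp

lemma mult_add_less:
  assumes "p < m" "u < (k::nat)"
  shows "p * k + u < m * k"
proof -
  have "p * k + u < Suc p * k" using assms(2) by simp
  also have "\<dots> \<le> m * k" using assms(1) by (intro mult_right_mono) auto
  finally show ?thesis .
qed

lemma sesq_split:
  "sesq (n * k) T f g =
    (\<Sum>r<n. \<Sum>s<n. sesq k (\<lambda>u v. T (r * k + u) (s * k + v)) (\<lambda>u. f (r * k + u)) (\<lambda>v. g (s * k + v)))"
  unfolding sesq_def sum_lessThan_mult
  by (rule sum.cong[OF refl]) (rule sum.swap)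

lemma trp_split:
  "trp (n * k) A B =
    (\<Sum>r<n. \<Sum>s<n. trp k (\<lambda>u v. A (r * k + u) (s * k + v)) (\<lambda>v u. B (s * k + v) (r * k + u)))"
  unfolding trp_def sum_lessThan_mult
  by (rule sum.cong[OF refl]) (rule sum.swap)

lemma trp_cong:
  assumes "\<And>i j. i < n \<Longrightarrow> j < n \<Longrightarrow> A i j = A' i j" "\<And>i j. i < n \<Longrightarrow> j < n \<Longrightarrow> B i j = B' i j"
  shows "trp n A B = trp n A' B'"
  unfolding trp_def by (intro sum.cong refl) (simp add: assms)

lemma trp_scale_right: "trp n A (\<lambda>i j. c * B i j) = c * trp n A B"
  by (simp add: trp_def sum_distrib_left mult_ac)

lemma trp_diff_left: "trp n (\<lambda>i j. A i j - B i j) C = trp n A C - trp n B C"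
  by (simp add: trp_def algebra_simps sum_subtractf)

lemma trp_sum_left: "trp n (\<lambda>i j. \<Sum>k\<in>K. A k i j) B = (\<Sum>k\<in>K. trp n (A k) B)"
proof -
  have "trp n (\<lambda>i j. \<Sum>k\<in>K. A k i j) B = (\<Sum>i<n. \<Sum>j<n. \<Sum>k\<in>K. A k i j * B j i)"
    by (simp add: trp_def sum_distrib_right)
  also have "\<dots> = (\<Sum>k\<in>K. trp n (A k) B)"
    unfolding trp_def by (rule sum_rotate3)
  finally show ?thesis .
qed

lemma trp_sum_right: "trp n A (\<lambda>i j. \<Sum>k\<in>K. B k i j) = (\<Sum>k\<in>K. trp n A (B k))"
  using trp_sum_left[of n B K A] by (simp add: trp_commute)

lemma trp_idk: "trp n idk B = (\<Sum>i<n. B i i)"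
  unfolding trp_def by (intro sum.cong refl) (simp add: idk_sum_left)

lemma pos_block_diag:
  assumes "\<And>r. r < n \<Longrightarrow> pos k (D r)"
    and "\<And>r s u v. r < n \<Longrightarrow> s < n \<Longrightarrow> u < k \<Longrightarrow> v < k \<Longrightarrow>
      T (r * k + u) (s * k + v) = (if r = s then D r u v else 0)"
  shows "pos (n * k) T"
  unfolding pos_def
proof
  fix f :: "nat \<Rightarrow> complex"
  have "sesq (n * k) T f f = (\<Sum>r<n. \<Sum>s<n. if r = s then
      sesq k (D r) (\<lambda>u. f (r * k + u)) (\<lambda>u. f (r * k + u)) else 0)"
    unfolding sesq_split
    by (intro sum.cong refl) (use assms(2) in \<open>auto simp: sesq_def intro!: sum.cong sum.neutral\<close>)
  also have "\<dots> = (\<Sum>r<n. sesq k (D r) (\<lambda>u. f (r * k + u)) (\<lambda>u. f (r * k + u)))"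
    by (simp)
  also have "0 \<le> \<dots>" by (intro sum_nonneg posD assms(1)) simp
  finally show "0 \<le> sesq (n * k) T f f" .
qed

lemma pos_block:
  assumes "pos (n * k) T" "r < n"
  shows "pos k (\<lambda>u v. T (r * k + u) (r * k + v))"
  unfolding pos_def
proof
  fix f :: "nat \<Rightarrow> complex"
  define h where "h x = (if x div k = r then f (x mod k) else 0)" for x
  have h: "h (s * k + v) = (if s = r then f v else 0)" if "v < k" for s v
    using that by (simp add: h_def)
  have "sesq (n * k) T h h = (\<Sum>r'<n. \<Sum>s<n. if s = r then (if r' = r then
      sesq k (\<lambda>u v. T (r * k + u) (r * k + v)) f f else 0) else 0)"
    unfolding sesq_split
    by (intro sum.cong refl) (auto simp: sesq_def h intro!: sum.cong sum.neutral)
  also have "\<dots> = sesq k (\<lambda>u v. T (r * k + u) (r * k + v)) f f"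
    using assms(2) by simp
  finally show "0 \<le> sesq k (\<lambda>u v. T (r * k + u) (r * k + v)) f f"
    using posD[OF assms(1), of h] by simp
qed

lemma effect_block:
  assumes "effect (n * k) T" "r < n"
  shows "effect k (\<lambda>u v. T (r * k + u) (r * k + v))"
proof -
  have "pos (n * k) (\<lambda>i j. idk i j - T i j)" using assms(1) by (simp add: effect_def)
  from pos_block[OF this assms(2)]
  have "pos k (\<lambda>u v. idk u v - T (r * k + u) (r * k + v))"
    by (simp add: idk_def)
  then show ?thesis using pos_block[of n k T r] assms by (simp add: effect_def)
qed

text \<open>The partial trace of (E \<otimes> I) A over the first factor: the unnormalised state of
  the second factor when a measurement of the first has the outcome belonging to E.\<close>

definition contract :: "nat \<Rightarrow> nat \<Rightarrow> (nat \<Rightarrow> nat \<Rightarrow> complex) \<Rightarrow> (nat \<Rightarrow> nat \<Rightarrow> complex) \<Rightarrow> nat \<Rightarrow> nat \<Rightarrow> complex" where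
  "contract m k E A u v = trp m E (\<lambda>p q. A (p * k + u) (q * k + v))"

text \<open>With E a sum of w w^*, the form at f becomes the sum of the forms of A at the product
  vectors w \<otimes> f.\<close>

lemma pos_contract:
  assumes "pos m E" "pos (m * k) A"
  shows "pos k (contract m k E A)"
  unfolding pos_def
proof
  fix f :: "nat \<Rightarrow> complex"
  obtain W where W: "\<And>i j. i < m \<Longrightarrow> j < m \<Longrightarrow> E i j = (\<Sum>l<m. W l i * cnj (W l j))"
    using pos_decomposition[OF assms(1)] by blast
  define h where "h l x = W l (x div k) * f (x mod k)" for l x
  define F where "F r s = sesq k (\<lambda>u v. A (r * k + u) (s * k + v)) f f" for r s
  have "sesq k (contract m k E A) f f = sesq k (\<lambda>u v. \<Sum>i<m. \<Sum>j<m. E i j * A (j * k + u) (i * k + v)) f f"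
    by (simp add: contract_def[abs_def] trp_def)
  also have "\<dots> = (\<Sum>i<m. \<Sum>j<m. sesq k (\<lambda>u v. E i j * A (j * k + u) (i * k + v)) f f)"
    by (simp add: sesq_op_sum)
  also have "\<dots> = (\<Sum>i<m. \<Sum>j<m. E i j * F j i)"
    by (simp add: F_def sesq_def sum_distrib_left mult_ac)
  also have "\<dots> = trp m F E"
    using trp_commute[of m E F] by (simp add: trp_def)
  also have "\<dots> = (\<Sum>l<m. sesq m F (W l) (W l))"
    by (rule trp_rank_one_sum[OF W])
  also have "\<dots> = (\<Sum>l<m. sesq (m * k) A (h l) (h l))"
  proof (intro sum.cong refl)
    fix l
    have "sesq (m * k) A (h l) (h l) = (\<Sum>r<m. \<Sum>s<m. sesq k (\<lambda>u v. A (r * k + u) (s * k + v))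
        (\<lambda>u. W l r * f u) (\<lambda>u. W l s * f u))"
      unfolding sesq_split by (intro sum.cong refl sesq_cong) (auto simp: h_def)
    also have "\<dots> = sesq m F (W l) (W l)"
      by (simp add: sesq_scale_left sesq_scale_right F_def sesq_def[of m]) (simp add: mult_ac)
    finally show "sesq m F (W l) (W l) = sesq (m * k) A (h l) (h l)" by simp
  qed
  also have "0 \<le> \<dots>" by (intro sum_nonneg posD assms(2))
  finally show "0 \<le> sesq k (contract m k E A) f f" .
qed

definition tensor :: "nat \<Rightarrow> (nat \<Rightarrow> nat \<Rightarrow> complex) \<Rightarrow> (nat \<Rightarrow> nat \<Rightarrow> complex) \<Rightarrow> nat \<Rightarrow> nat \<Rightarrow> complex" where
  "tensor k A B i j = A (i div k) (j div k) * B (i mod k) (j mod k)"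

text \<open>Only A is decomposed. Pairing the first factor of f with each of its vectors leaves
  forms of B at the contracted vectors \<open>h l\<close>.\<close>

lemma pos_tensor:
  assumes "pos n A" "pos k B"
  shows "pos (n * k) (tensor k A B)"
  unfolding pos_def
proof
  fix f :: "nat \<Rightarrow> complex"
  obtain W where W: "\<And>i j. i < n \<Longrightarrow> j < n \<Longrightarrow> A i j = (\<Sum>l<n. W l i * cnj (W l j))"
    using pos_decomposition[OF assms(1)] by blast
  define h where "h l v = (\<Sum>s<n. cnj (W l s) * f (s * k + v))" for l v
  define F where "F s r = sesq k B (\<lambda>u. f (r * k + u)) (\<lambda>u. f (s * k + u))" for r s
  have "sesq (n * k) (tensor k A B) f f = (\<Sum>r<n. \<Sum>s<n. A r s * F s r)"
    unfolding sesq_split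
  proof (intro sum.cong refl)
    fix r s
    have "sesq k (\<lambda>u v. tensor k A B (r * k + u) (s * k + v)) (\<lambda>u. f (r * k + u)) (\<lambda>v. f (s * k + v))
      = sesq k (\<lambda>u v. A r s * B u v) (\<lambda>u. f (r * k + u)) (\<lambda>v. f (s * k + v))"
      by (rule sesq_cong) (auto simp: tensor_def)
    then show "sesq k (\<lambda>u v. tensor k A B (r * k + u) (s * k + v)) (\<lambda>u. f (r * k + u)) (\<lambda>v. f (s * k + v))
      = A r s * F s r"
      by (simp add: F_def sesq_def sum_distrib_left mult_ac)
  qed
  also have "\<dots> = (\<Sum>l<n. sesq n F (W l) (W l))"
    using trp_commute[of n A F] trp_rank_one_sum[OF W, where A = F] by (simp add: trp_def[of n A])
  also have "\<dots> = (\<Sum>l<n. sesq k B (h l) (h l))"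
  proof (intro sum.cong refl)
    fix l
    have cnj_sum: "sesq k B (\<lambda>i. \<Sum>s<n. c s * g s i) y = (\<Sum>s<n. cnj (c s) * sesq k B (g s) y)" for c g y
      using pos_sesq_cnj[OF assms(2), of "\<lambda>i. \<Sum>s<n. c s * g s i" y]
        pos_sesq_cnj[OF assms(2), of _ y]
      by (simp add: sesq_sum_right sesq_scale_right)
    have "sesq k B (h l) (h l) = (\<Sum>s<n. cnj (W l s) * (\<Sum>r<n. W l r * F s r))"
      unfolding h_def by (simp add: cnj_sum sesq_sum_right sesq_scale_right F_def)
    also have "\<dots> = sesq n F (W l) (W l)"
      by (simp add: sesq_def sum_distrib_left mult_ac)
    finally show "sesq n F (W l) (W l) = sesq k B (h l) (h l)" by simp
  qed
  also have "0 \<le> \<dots>" by (intro sum_nonneg posD assms(2))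
  finally show "0 \<le> sesq (n * k) (tensor k A B) f f" .
qed

lemma trp_tensor:
  "trp (n * k) (tensor k A B) (tensor k C D) = trp n A C * trp k B D"
proof -
  have "trp (n * k) (tensor k A B) (tensor k C D) = (\<Sum>r<n. \<Sum>s<n. A r s * C s r * trp k B D)"
    unfolding trp_split
    by (intro sum.cong refl) (simp add: trp_def tensor_def sum_distrib_left mult_ac)
  then show ?thesis by (simp add: trp_def[of n] sum_distrib_right)
qed

lemma tensor_idk: "u < n * k \<Longrightarrow> v < n * k \<Longrightarrow> tensor k idk idk u v = idk u v"
  by (auto simp: tensor_def idk_def) (metis div_mult_mod_eq)

section \<open>Matrices as kernels, and channels that measure and record the outcome\<close>

abbreviation ent :: "complex mat \<Rightarrow> nat \<Rightarrow> nat \<Rightarrow> complex" where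
  "ent A \<equiv> \<lambda>i j. A $$ (i, j)"

lemma psd_iff_pos: "psd n A \<longleftrightarrow> A \<in> carrier_mat n n \<and> pos n (ent A)"
proof -
  have form: "(A *\<^sub>v vec n f) \<bullet>c vec n f = sesq n (ent A) f f" if "A \<in> carrier_mat n n" for f
    using that
    by (auto simp: scalar_prod_def sesq_def sum_distrib_left mult_ac atLeast0LessThan intro!: sum.cong)
  have vec: "v = vec n (\<lambda>i. v $ i)" if "v \<in> carrier_vec n" for v :: "complex vec"
    using that by (intro eq_vecI) auto
  show ?thesis
    unfolding psd_def pos_def
    by (metis form vec vec_carrier)
qed

lemma tr_carrier: "A \<in> carrier_mat n n \<Longrightarrow> tr A = (\<Sum>i<n. A $$ (i, i))"
  by (auto simp: tr_def diag_mat_def sum_list_sum_nth atLeast0LessThan)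

lemma tr_mult:
  assumes "A \<in> carrier_mat n n" "B \<in> carrier_mat n n"
  shows "tr (A * B) = trp n (ent A) (ent B)"
proof -
  have "A * B \<in> carrier_mat n n" using assms by simp
  then have "tr (A * B) = (\<Sum>i<n. (A * B) $$ (i, i))" by (rule tr_carrier)
  also have "\<dots> = trp n (ent A) (ent B)"
    using assms by (auto simp: trp_def scalar_prod_def atLeast0LessThan intro!: sum.cong)
  finally show ?thesis .
qed

text \<open>Measures the POVM E and stores the outcome in a basis state. All relay operations have
  this form, which makes both the memory and the channel input classical.\<close>

definition measurement_map ::
  "nat \<Rightarrow> nat \<Rightarrow> (nat \<Rightarrow> nat \<Rightarrow> nat \<Rightarrow> complex) \<Rightarrow> complex mat \<Rightarrow> complex mat" where
  "measurement_map m n E A = mat n n (\<lambda>(r, s). if r = s then trp m (E r) (ent A) else 0)"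

lemma slice_carrier: "slice m c M i k j l \<in> carrier_mat m m"
  by (simp add: slice_def)

lemma local_op_entry:
  assumes "a < A" "a' < A" "y < n" "y' < n" "u < c" "v < c"
  shows "local_op A m n c \<Phi> M $$ ((a * n + y) * c + u, (a' * n + y') * c + v) =
    \<Phi> (slice m c M a u a' v) $$ (y, y')"
proof -
  have "(a * n + y) * c + u < A * n * c" "(a' * n + y') * c + v < A * n * c"
    using assms by (auto intro!: mult_add_less)
  then show ?thesis using assms by (simp add: local_op_def)
qed

lemma local_op_carrier: "local_op A m n c \<Phi> M \<in> carrier_mat (A * n * c) (A * n * c)"
  by (simp add: local_op_def)

text \<open>For complete positivity, the output with an ancilla is block diagonal in the outcome r,
  and its blocks are the states \<open>contract m k (E r)\<close> of the ancilla. Completeness of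
  the POVM preserves the trace.\<close>

lemma quantum_channel_measurement_map:
  assumes "\<And>r. r < n \<Longrightarrow> pos m (E r)"
    and "\<And>p q. p < m \<Longrightarrow> q < m \<Longrightarrow> (\<Sum>r<n. E r p q) = idk p q"
  shows "quantum_channel m n (measurement_map m n E)"
  unfolding quantum_channel_def
proof (intro conjI)
  show "linear_map m n (measurement_map m n E)"
    unfolding linear_map_def measurement_map_def
    by (auto intro!: eq_matI simp: trp_def sum.distrib algebra_simps sum_distrib_left)
next
  show "trace_preserving m (measurement_map m n E)"
    unfolding trace_preserving_def
  proof
    fix A :: "complex mat" assume A: "A \<in> carrier_mat m m"
    have "tr (measurement_map m n E A) = (\<Sum>r<n. trp m (E r) (ent A))"
      by (subst tr_carrier[of _ n]) (auto simp: measurement_map_def)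
    also have "\<dots> = trp m (\<lambda>p q. \<Sum>r<n. E r p q) (ent A)" by (simp add: trp_sum_left)
    also have "\<dots> = trp m idk (ent A)" by (rule trp_cong) (simp_all add: assms(2))
    also have "\<dots> = tr A" using A by (simp add: trp_idk tr_carrier)
    finally show "tr (measurement_map m n E A) = tr A" .
  qed
next
  show "completely_positive m n (measurement_map m n E)"
    unfolding completely_positive_def
  proof (intro allI impI)
    fix k A assume A: "psd (m * k) A"
    define M where "M = local_op 1 m n k (measurement_map m n E) A"
    have "pos (n * k) (ent M)"
    proof (rule pos_block_diag)
      show "pos k (contract m k (E r) (ent A))" if "r < n" for r
        using pos_contract[OF assms(1)[OF that]] A by (simp add: psd_iff_pos)
      show "M $$ (r * k + u, s * k + v) = (if r = s then contract m k (E r) (ent A) u v else 0)"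
        if "r < n" "s < n" "u < k" "v < k" for r s u v
        using local_op_entry[of 0 1 0 r n s u k v] that
        by (auto simp: M_def measurement_map_def contract_def slice_def intro!: trp_cong)
    qed
    then show "psd (n * k) (local_op 1 m n k (measurement_map m n E) A)"
      using local_op_carrier[of 1 m n k "measurement_map m n E" A] by (simp add: psd_iff_pos M_def)
  qed
qed

subsection \<open>Partial traces and the block-Markov code\<close>

text \<open>The newest factor stands leftmost, in the order in which \<open>round_state\<close>
  collects the receiver's systems.\<close>

fun tensors :: "nat \<Rightarrow> (nat \<Rightarrow> nat \<Rightarrow> nat \<Rightarrow> complex) \<Rightarrow> nat \<Rightarrow> nat \<Rightarrow> nat \<Rightarrow> complex" where
  "tensors d K 0 = idk"
| "tensors d K (Suc j) = tensor (d ^ j) (K (Suc j)) (tensors d K j)"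

lemma pos_tensors: "(\<And>i. 1 \<le> i \<Longrightarrow> i \<le> j \<Longrightarrow> pos d (K i)) \<Longrightarrow> pos (d ^ j) (tensors d K j)"
  by (induction j) (auto intro!: pos_tensor simp: pos_idk)

lemma tensors_cong: "(\<And>i. 1 \<le> i \<Longrightarrow> i \<le> j \<Longrightarrow> K i = K' i) \<Longrightarrow> tensors d K j = tensors d K' j"
  by (induction j) auto

lemma div_less_mult: "u < n * k \<Longrightarrow> u div k < (n::nat)"
  by (metis less_mult_imp_div_less)

lemma mod_less_mult: "u < n * k \<Longrightarrow> u mod k < (k::nat)"
  by (cases "k = 0") auto

lemma tensor_sum_cong:
  assumes "u < n * k" "v < n * k"
    and "\<And>u v. u < n \<Longrightarrow> v < n \<Longrightarrow> A u v = A' u v" "\<And>u v. u < k \<Longrightarrow> v < k \<Longrightarrow> B u v = B' u v"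
  shows "tensor k A B u v = tensor k A' B' u v"
  unfolding tensor_def using assms div_less_mult mod_less_mult by metis

lemma tensors_idk:
  assumes "u < d ^ j" "v < d ^ j"
  shows "tensors d (\<lambda>_. idk) j u v = idk u v"
  using assms
proof (induction j arbitrary: u v)
  case (Suc j)
  then have "tensors d (\<lambda>_. idk) (Suc j) u v = tensor (d ^ j) idk idk u v"
    by (simp) (rule tensor_sum_cong, auto)
  then show ?case using tensor_idk[of u d "d ^ j" v] Suc.prems by simp
qed simp

section \<open>Reduced states and tests on two tensor factors\<close>

definition ptrace_right :: "nat \<Rightarrow> (nat \<Rightarrow> nat \<Rightarrow> complex) \<Rightarrow> nat \<Rightarrow> nat \<Rightarrow> complex" where
  "ptrace_right k A p q = (\<Sum>u<k. A (p * k + u) (q * k + u))"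

definition ptrace_left :: "nat \<Rightarrow> nat \<Rightarrow> (nat \<Rightarrow> nat \<Rightarrow> complex) \<Rightarrow> nat \<Rightarrow> nat \<Rightarrow> complex" where
  "ptrace_left m k A u v = (\<Sum>p<m. A (p * k + u) (p * k + v))"

lemma contract_idk: "contract m k idk A = ptrace_left m k A"
  by (simp add: contract_def ptrace_left_def trp_idk fun_eq_iff)

lemma trp_contract_idk: "trp k idk (contract m k E A) = trp m E (ptrace_right k A)"
proof -
  have "trp k idk (contract m k E A) = (\<Sum>u<k. trp m E (\<lambda>p q. A (p * k + u) (q * k + u)))"
    by (simp add: trp_idk contract_def)
  then show ?thesis by (simp add: ptrace_right_def[abs_def] trp_sum_right)
qed

lemma contract_diff:
  "contract m k (\<lambda>i j. E i j - F i j) A = (\<lambda>u v. contract m k E A u v - contract m k F A u v)"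
  by (simp add: contract_def[abs_def] trp_diff_left)

lemma trp_diff_right: "trp n A (\<lambda>i j. B i j - C i j) = trp n A B - trp n A C"
  by (simp add: trp_def algebra_simps sum_subtractf)

lemma pos_ptrace_left: "pos (m * k) A \<Longrightarrow> pos k (ptrace_left m k A)"
  using pos_contract[OF pos_idk] by (simp add: contract_idk)

text \<open>By duality: the form at f is the trace of A contracted with the rank-one operator f f^*,
  which is positive by \<open>pos_contract\<close>.\<close>

lemma pos_ptrace_right:
  assumes "pos (m * k) A"
  shows "pos m (ptrace_right k A)"
  unfolding pos_def
proof
  fix f :: "nat \<Rightarrow> complex"
  have "sesq m (ptrace_right k A) f f = trp m (\<lambda>i j. f i * cnj (f j)) (ptrace_right k A)"
    using trp_rank_one_sum[where m = "Suc 0" and W = "\<lambda>_. f" and n = m and A = "ptrace_right k A"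
        and B = "\<lambda>i j. f i * cnj (f j)"]
    by (simp add: trp_commute)
  also have "\<dots> = trp k idk (contract m k (\<lambda>i j. f i * cnj (f j)) A)"
    by (simp add: trp_contract_idk)
  also have "0 \<le> \<dots>"
  proof (intro trp_nonneg pos_idk pos_contract assms)
    have "0 \<le> cnj z * z" for z :: complex
      using complex_norm_square[of z] by (simp add: mult.commute less_eq_complex_def)
    then have "0 \<le> cnj (\<Sum>i<m. cnj (f i) * g i) * (\<Sum>i<m. cnj (f i) * g i)" for g by blast
    moreover have "cnj (\<Sum>i<m. cnj (f i) * g i) * (\<Sum>i<m. cnj (f i) * g i) = sesq m (\<lambda>i j. f i * cnj (f j)) g g" for g
      by (simp add: sesq_def sum_product mult_ac)
    ultimately show "pos m (\<lambda>i j. f i * cnj (f j))" by (simp only: pos_def) simp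
  qed
  finally show "0 \<le> sesq m (ptrace_right k A) f f" .
qed

lemma trp_idk_ptrace:
  "trp k idk (ptrace_left m k A) = trp (m * k) idk A"
  "trp m idk (ptrace_right k A) = trp (m * k) idk A"
proof -
  show "trp m idk (ptrace_right k A) = trp (m * k) idk A"
    by (simp add: trp_idk ptrace_right_def sum_lessThan_mult)
  then show "trp k idk (ptrace_left m k A) = trp (m * k) idk A"
    using trp_contract_idk[of k m idk A] by (simp add: contract_idk)
qed

lemma effect_idk: "effect n idk"
  using pos_idk pos_zero by (simp add: effect_def)

lemma effect_trp_le:
  assumes "effect n T" "pos n A"
  shows "trp n T A \<le> trp n idk A"
proof -
  have "0 \<le> trp n (\<lambda>i j. idk i j - T i j) A"
    using assms by (intro trp_nonneg) (auto simp: effect_def)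
  then show ?thesis by (simp add: trp_diff_left)
qed

lemma povm_effect:
  assumes "finite I" "k \<in> I" "\<And>i. i \<in> I \<Longrightarrow> pos n (E i)"
    and "\<And>p q. p < n \<Longrightarrow> q < n \<Longrightarrow> (\<Sum>i\<in>I. E i p q) = idk p q"
  shows "effect n (E k)"
proof -
  have "pos n (\<lambda>p q. \<Sum>i\<in>I - {k}. E i p q)" using assms(3) by (intro pos_sum) auto
  moreover have "pos n (\<lambda>p q. \<Sum>i\<in>I - {k}. E i p q) \<longleftrightarrow> pos n (\<lambda>p q. idk p q - E k p q)"
    by (rule pos_cong) (use assms(1,2,4) in \<open>simp add: sum_diff1\<close>)
  ultimately have "pos n (\<lambda>p q. idk p q - E k p q)" by simp
  then show ?thesis using assms(2,3) by (simp add: effect_def)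
qed

lemma joint_effect_le_one:
  assumes A: "pos (m * k) A" and E: "effect m E" and F: "effect k F"
  shows "trp k F (contract m k E A) \<le> trp (m * k) idk A"
proof -
  have "trp k F (contract m k E A) \<le> trp k idk (contract m k E A)"
    using E by (intro effect_trp_le F pos_contract A) (simp add: effect_def)
  also have "\<dots> \<le> trp m idk (ptrace_right k A)"
    unfolding trp_contract_idk by (intro effect_trp_le E pos_ptrace_right A)
  finally show ?thesis by (simp add: trp_idk_ptrace)
qed

text \<open>E and F act on different factors and commute, so expanding the nonnegative value of (I -
  E) \<otimes> (I - F) gives an ordinary union bound in terms of the two reduced states, even if A
  is entangled.\<close>

lemma joint_effect_union_bound:
  assumes A: "pos (m * k) A" and E: "effect m E" and F: "effect k F"
  shows "trp (m * k) idk A - trp k F (contract m k E A) \<le>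
    (trp (m * k) idk A - trp m E (ptrace_right k A)) + (trp (m * k) idk A - trp k F (ptrace_left m k A))"
proof -
  have "0 \<le> trp k (\<lambda>i j. idk i j - F i j) (contract m k (\<lambda>i j. idk i j - E i j) A)"
    using E F by (intro trp_nonneg pos_contract A) (auto simp: effect_def)
  also have "\<dots> = trp (m * k) idk A - trp m E (ptrace_right k A) - trp k F (ptrace_left m k A)
      + trp k F (contract m k E A)"
    by (simp add: trp_diff_left contract_diff trp_diff_right contract_idk trp_contract_idk trp_idk_ptrace)
  finally show ?thesis by (simp add: algebra_simps less_eq_complex_def)
qed

text \<open>
  The message of block \<open>j\<close> is the \<open>(j-1)\<close>-st base-\<open>L\<close> digit of \<open>m\<close>; the block messages with
  index \<open>0\<close> and \<open>b\<close> are the fixed message \<open>0\<close>.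
\<close>
definition digit :: "nat \<Rightarrow> nat \<Rightarrow> nat \<Rightarrow> nat" where
  "digit L m j = (if j = 0 then 0 else m div L ^ (j - 1) mod L)"

lemma digit_less: "0 < L \<Longrightarrow> digit L m j < L"
  by (simp add: digit_def)

lemma digit_low:
  assumes "0 < L" "j \<le> k"
  shows "digit L (h * L ^ k + l) j = digit L l j"
proof (cases j)
  case (Suc i)
  then obtain e where "k = i + Suc e" using assms(2) less_iff_Suc_add[of i k] by auto
  then have "h * L ^ k + l = l + (h * L ^ e * L) * L ^ i" by (simp add: power_add)
  moreover have "(l + (h * L ^ e * L) * L ^ i) div L ^ i = h * L ^ e * L + l div L ^ i"
    using assms(1) by (intro div_mult_self1) simp
  ultimately have "(h * L ^ k + l) div L ^ i = h * L ^ e * L + l div L ^ i" by (simp only:)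
  then show ?thesis by (simp add: digit_def Suc)
qed (simp add: digit_def)

lemma digit_top:
  assumes "h < L" "l < L ^ k"
  shows "digit L (h * L ^ k + l) (Suc k) = h"
  using assms by (simp add: digit_def)

text \<open>In \<open>\<Lambda> a i\<close>, a is the relay's previous estimate, which it knows and
  which fixes its own input \<open>c2 a\<close>, and i is the message being decoded. Only
  completeness and positivity are assumed; the quality of the decoders enters through
  \<open>block_error\<close>.\<close>

locale relay_scheme =
  fixes N :: relay_channel and L :: nat and c1 c2 :: "nat \<Rightarrow> nat"
    and \<Lambda> :: "nat \<Rightarrow> nat \<Rightarrow> nat \<Rightarrow> nat \<Rightarrow> complex" and \<Gamma> :: "nat \<Rightarrow> nat \<Rightarrow> nat \<Rightarrow> complex"
  assumes channel: "cq_relay_channel N"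
    and L_pos: "0 < L"
    and c1_less: "i < L \<Longrightarrow> c1 i < nX1 N"
    and c2_less: "i < L \<Longrightarrow> c2 i < nX2 N"
    and \<Lambda>_pos: "a < L \<Longrightarrow> i < L \<Longrightarrow> pos (dB2 N) (\<Lambda> a i)"
    and \<Lambda>_sum: "a < L \<Longrightarrow> p < dB2 N \<Longrightarrow> q < dB2 N \<Longrightarrow> (\<Sum>i<L. \<Lambda> a i p q) = idk p q"
    and \<Gamma>_pos: "i < L \<Longrightarrow> pos (dB3 N) (\<Gamma> i)"
    and \<Gamma>_sum: "p < dB3 N \<Longrightarrow> q < dB3 N \<Longrightarrow> (\<Sum>i<L. \<Gamma> i p q) = idk p q"
begin

abbreviation d2 :: nat where "d2 \<equiv> dB2 N"
abbreviation d3 :: nat where "d3 \<equiv> dB3 N"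
abbreviation k2 :: nat where "k2 \<equiv> nX2 N"

text \<open>The outcome r = a' * k2 + x holds the new estimate a' and the channel input x, and has
  weight only for x = c2 a'. From round 2 on the measured index is a * d2 + i with the old estimate
  a, and \<Lambda> a is measured within block a. Round 1 has a trivial input and always yields the
  estimate 0.\<close>

definition relay_povm :: "nat \<Rightarrow> nat \<Rightarrow> nat \<Rightarrow> nat \<Rightarrow> complex" where
  "relay_povm j r p q = (if r mod k2 = c2 (r div k2) then
      (if j = 1 then (if r div k2 = 0 then 1 else 0)
       else if p div d2 = q div d2 then \<Lambda> (p div d2) (r div k2) (p mod d2) (q mod d2) else 0)
     else 0)"

text \<open>Block j carries the relay's word for message j - 1. In block 1 that is the fixed message
  0, so nothing is measured there.\<close>

definition dec_factor :: "nat \<Rightarrow> nat \<Rightarrow> nat \<Rightarrow> nat \<Rightarrow> complex" where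
  "dec_factor m j = (if j \<le> 1 then idk else \<Gamma> (digit L m (j - 1)))"

definition code :: "nat \<Rightarrow> relay_code" where
  "code b = \<lparr>msgs = {..<L ^ (b - 1)}, enc = (\<lambda>m j. c1 (digit L m j)), mem = (\<lambda>_. L),
     relay_op = (\<lambda>j. measurement_map (if j = 1 then 1 else L * d2) (L * k2) (relay_povm j)),
     dec = (\<lambda>m. mat (d3 ^ b) (d3 ^ b) (\<lambda>(u, v). tensors d3 (dec_factor m) b u v))\<rparr>"

abbreviation rho :: "nat \<Rightarrow> nat \<Rightarrow> nat \<Rightarrow> nat \<Rightarrow> nat \<Rightarrow> complex" where
  "rho m j a \<equiv> ent (out N (c1 (digit L m j)) (c2 a))"

text \<open>Unnormalised state of the receiver's system in block j when the relay enters it with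
  estimate a and leaves it with estimate a'.\<close>

definition link :: "nat \<Rightarrow> nat \<Rightarrow> nat \<Rightarrow> nat \<Rightarrow> nat \<Rightarrow> nat \<Rightarrow> complex" where
  "link m j a a' = contract d2 d3 (\<Lambda> a a') (rho m j a)"

text \<open>
  The unnormalised state of \<open>(B\<^sub>3)\<^sub>j \<otimes> \<dots> \<otimes> (B\<^sub>3)\<^sub>1\<close> on the event that the relay decodes the
  \<open>j\<close>-th block as \<open>a\<close>.
\<close>
fun hist :: "nat \<Rightarrow> nat \<Rightarrow> nat \<Rightarrow> nat \<Rightarrow> nat \<Rightarrow> complex" where
  "hist m 0 a = (\<lambda>u v. if a = 0 then 1 else 0)"
| "hist m (Suc j) a' = (\<lambda>u v. \<Sum>a<L. tensor (d3 ^ j) (link m (Suc j) a a') (hist m j a) u v)"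

lemma out_density: "x1 < nX1 N \<Longrightarrow> x2 < k2 \<Longrightarrow> density (d2 * d3) (out N x1 x2)"
  using channel by (simp add: cq_relay_channel_def)

lemma rho_density:
  assumes "a < L"
  shows "density (d2 * d3) (out N (c1 (digit L m j)) (c2 a))"
  using assms by (intro out_density c1_less c2_less digit_less L_pos)

lemma pos_link: "a < L \<Longrightarrow> a' < L \<Longrightarrow> pos d3 (link m j a a')"
  unfolding link_def using rho_density[of a m j]
  by (intro pos_contract \<Lambda>_pos) (auto simp: density_def psd_iff_pos)

lemma link_sum:
  assumes "a < L"
  shows "(\<Sum>a'<L. link m j a a' u v) = (\<Sum>p<d2. rho m j a (p * d3 + u) (p * d3 + v))"
proof -
  have "(\<Sum>a'<L. link m j a a' u v) =
      trp d2 (\<lambda>p q. \<Sum>a'<L. \<Lambda> a a' p q) (\<lambda>p q. rho m j a (p * d3 + u) (q * d3 + v))"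
    by (simp add: link_def contract_def trp_sum_left)
  also have "\<dots> = trp d2 idk (\<lambda>p q. rho m j a (p * d3 + u) (q * d3 + v))"
    by (rule trp_cong) (use assms \<Lambda>_sum in auto)
  finally show ?thesis by (simp add: trp_idk)
qed

lemma relay_povm_pos:
  assumes "r < L * k2"
  shows "pos (if j = 1 then 1 else L * d2) (relay_povm j r)"
proof (cases "r mod k2 = c2 (r div k2) \<and> (j = 1 \<longrightarrow> r div k2 = 0)")
  case True
  have rL: "r div k2 < L" using assms by (rule div_less_mult)
  show ?thesis
  proof (cases "j = 1")
    case j: True
    have "pos 1 (relay_povm j r) \<longleftrightarrow> pos 1 idk"
      by (rule pos_cong) (use True j in \<open>auto simp: relay_povm_def idk_def\<close>)
    then show ?thesis using j by (simp add: pos_idk)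
  next
    case False
    have "pos (L * d2) (relay_povm j r)"
      by (rule pos_block_diag[where D = "\<lambda>a. \<Lambda> a (r div k2)"])
         (use \<Lambda>_pos rL True False in \<open>auto simp: relay_povm_def\<close>)
    then show ?thesis using False by simp
  qed
next
  case False
  then have "relay_povm j r = (\<lambda>p q. 0)" by (auto simp: relay_povm_def fun_eq_iff)
  then show ?thesis by (simp add: pos_zero)
qed

lemma relay_povm_sum:
  assumes "p < (if j = 1 then 1 else L * d2)" "q < (if j = 1 then 1 else L * d2)"
  shows "(\<Sum>r<L * k2. relay_povm j r p q) = idk p q"
proof -
  define G where "G a' = (if j = 1 then (if a' = 0 then 1 else 0)
       else if p div d2 = q div d2 then \<Lambda> (p div d2) a' (p mod d2) (q mod d2) else 0)" for a' :: nat
  have "(\<Sum>r<L * k2. relay_povm j r p q) = (\<Sum>a'<L. \<Sum>x<k2. if x = c2 a' then G a' else 0)"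
    unfolding sum_lessThan_mult by (intro sum.cong refl) (auto simp: relay_povm_def G_def)
  also have "\<dots> = (\<Sum>a'<L. G a')" using c2_less by simp
  also have "\<dots> = idk p q"
  proof (cases "j = 1")
    case True
    then show ?thesis using assms L_pos by (simp add: G_def idk_def)
  next
    case False
    then have pq: "p < L * d2" "q < L * d2" using assms by auto
    show ?thesis
    proof (cases "p div d2 = q div d2")
      case True
      have "(\<Sum>a'<L. G a') = idk (p mod d2) (q mod d2)"
        using \<Lambda>_sum[OF div_less_mult[OF pq(1)] mod_less_mult[OF pq(1)] mod_less_mult[OF pq(2)]]
          True False by (simp add: G_def)
      also have "\<dots> = idk p q"
        using True by (auto simp: idk_def) (metis div_mult_mod_eq)
      finally show ?thesis .
    next
      case F: False
      then show ?thesis using False by (auto simp: G_def idk_def)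
    qed
  qed
  finally show ?thesis .
qed

text \<open>Suc k blocks carry k free messages. Splitting off the top digit splits off the leftmost
  factor, whose \<Gamma> sums to the identity, and the lower digits are the induction
  hypothesis.\<close>

lemma decoder_sum:
  assumes "u < d3 ^ Suc k" "v < d3 ^ Suc k"
  shows "(\<Sum>m<L ^ k. tensors d3 (dec_factor m) (Suc k) u v) = idk u v"
  using assms
proof (induction k arbitrary: u v)
  case 0
  then show ?case by (simp add: dec_factor_def tensor_idk)
next
  case (Suc k)
  define n where "n = d3 ^ Suc k"
  have uv: "u < d3 * n" "v < d3 * n" using Suc.prems by (simp_all add: n_def)
  note bounds = div_less_mult[OF uv(1)] div_less_mult[OF uv(2)] mod_less_mult[OF uv(1)] mod_less_mult[OF uv(2)]
  have split: "tensors d3 (dec_factor (h * L ^ k + l)) (Suc (Suc k)) u v =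
      \<Gamma> h (u div n) (v div n) * tensors d3 (dec_factor l) (Suc k) (u mod n) (v mod n)"
    if "h < L" "l < L ^ k" for h l
  proof -
    have "tensors d3 (dec_factor (h * L ^ k + l)) (Suc k) = tensors d3 (dec_factor l) (Suc k)"
      by (rule tensors_cong) (use L_pos in \<open>auto simp: dec_factor_def digit_low\<close>)
    moreover have "dec_factor (h * L ^ k + l) (Suc (Suc k)) = \<Gamma> h"
      using that by (simp add: dec_factor_def digit_top)
    ultimately show ?thesis
      by (subst tensors.simps(2)) (simp add: tensor_def n_def del: tensors.simps)
  qed
  have "(\<Sum>m<L ^ Suc k. tensors d3 (dec_factor m) (Suc (Suc k)) u v)
      = (\<Sum>h<L. \<Sum>l<L ^ k. \<Gamma> h (u div n) (v div n) * tensors d3 (dec_factor l) (Suc k) (u mod n) (v mod n))"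
    unfolding power_Suc sum_lessThan_mult
    by (intro sum.cong refl) (rule split, auto)
  also have "\<dots> = (\<Sum>h<L. \<Gamma> h (u div n) (v div n)) *
      (\<Sum>l<L ^ k. tensors d3 (dec_factor l) (Suc k) (u mod n) (v mod n))"
    by (simp only: sum_product)
  also have "\<dots> = tensor n idk idk u v"
    using \<Gamma>_sum[OF bounds(1,2)] Suc.IH[of "u mod n" "v mod n"] bounds(3,4)
    by (simp add: tensor_def n_def del: tensors.simps)
  finally show ?case using tensor_idk[OF uv] by simp
qed

lemma dec_factor_pos: "1 \<le> j \<Longrightarrow> pos d3 (dec_factor m j)"
  using \<Gamma>_pos[OF digit_less[OF L_pos]] by (simp add: dec_factor_def pos_idk)

lemma code_simps:
  "msgs (code b) = {..<L ^ (b - 1)}" "enc (code b) m j = c1 (digit L m j)" "mem (code b) j = L"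
  "relay_op (code b) j = measurement_map (if j = 1 then 1 else L * d2) (L * k2) (relay_povm j)"
  "dec (code b) m = mat (d3 ^ b) (d3 ^ b) (\<lambda>(u, v). tensors d3 (dec_factor m) b u v)"
  "relay_dim N (code b) j = (if j = 0 then 1 else L * d2)"
  by (simp_all add: code_def relay_dim_def)

lemma is_relay_code:
  assumes b: "1 \<le> b" and R: "real (L ^ (b - 1)) = 2 powr (real b * R')"
  shows "is_relay_code N b R' (code b)"
  unfolding is_relay_code_def
proof (intro conjI ballI)
  show "finite (msgs (code b))" by (simp add: code_simps)
  show "real (card (msgs (code b))) = 2 powr (real b * R')" using R by (simp add: code_simps)
  show "enc (code b) m j < nX1 N" for m j
    using c1_less[OF digit_less[OF L_pos]] by (simp add: code_simps)
  show "0 < mem (code b) j" for j using L_pos by (simp add: code_simps)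
  show "quantum_channel (relay_dim N (code b) (j - 1)) (mem (code b) j * nX2 N) (relay_op (code b) j)"
    if "j \<in> {1..b}" for j
  proof -
    have "relay_dim N (code b) (j - 1) = (if j = 1 then 1 else L * d2)"
      using that by (auto simp: code_simps)
    then show ?thesis
      unfolding code_simps(3,4)
      by (simp only:) (rule quantum_channel_measurement_map[OF relay_povm_pos relay_povm_sum])
  qed
  show "classical_right (relay_dim N (code b) (j - 1)) (mem (code b) j) (nX2 N) (relay_op (code b) j)" for j
    by (auto simp: classical_right_def code_simps measurement_map_def)
  have "pos (d3 ^ b) (ent (dec (code b) m))" for m
  proof -
    have "pos (d3 ^ b) (ent (dec (code b) m)) \<longleftrightarrow> pos (d3 ^ b) (tensors d3 (dec_factor m) b)"
      by (rule pos_cong) (simp add: code_simps)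
    then show ?thesis using pos_tensors dec_factor_pos by blast
  qed
  moreover have "msum (d3 ^ b) (dec (code b)) (msgs (code b)) = 1\<^sub>m (d3 ^ b)"
  proof -
    obtain k where k: "b = Suc k" using b by (cases b) auto
    show ?thesis
      by (rule eq_matI)
         (auto simp: msum_def code_simps k decoder_sum idk_def simp del: tensors.simps power_Suc)
  qed
  ultimately show "povm (dB3 N ^ b) (msgs (code b)) (dec (code b))"
    by (auto simp: povm_def psd_iff_pos) (auto simp: code_simps)
qed

section \<open>The joint state in the course of the code\<close>

abbreviation after_relay :: "nat \<Rightarrow> nat \<Rightarrow> nat \<Rightarrow> complex mat" where
  "after_relay b m j \<equiv> local_op 1 (relay_dim N (code b) j) (mem (code b) (Suc j) * nX2 N) (dB3 N ^ j)
     (relay_op (code b) (Suc j)) (round_state N (code b) m j)"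

text \<open>Half of the induction invariant, at the moment when the relay has acted in round j + 1
  but the channel has not. The memory now holds the estimate for block j, which is why
  \<open>hist m j\<close> appears, and the state is diagonal in memory and input together.\<close>

definition relay_ok :: "nat \<Rightarrow> nat \<Rightarrow> nat \<Rightarrow> bool" where
  "relay_ok b m j \<longleftrightarrow> (\<forall>r<L * k2. \<forall>s<L * k2. \<forall>u<d3 ^ j. \<forall>v<d3 ^ j.
     after_relay b m j $$ (r * d3 ^ j + u, s * d3 ^ j + v) =
       (if r = s \<and> r mod k2 = c2 (r div k2) then hist m j (r div k2) u v else 0))"

text \<open>The other half, after the channel use: given the estimate a, the fresh output (indices
  y, y') is in a product state with the receiver's earlier systems.\<close>

definition round_ok :: "nat \<Rightarrow> nat \<Rightarrow> nat \<Rightarrow> bool" where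
  "round_ok b m j \<longleftrightarrow> (\<forall>a<L. \<forall>a'<L. \<forall>y<d2 * d3. \<forall>y'<d2 * d3. \<forall>u<d3 ^ j. \<forall>v<d3 ^ j.
     round_state N (code b) m (Suc j) $$
       ((a * (d2 * d3) + y) * d3 ^ j + u, (a' * (d2 * d3) + y') * d3 ^ j + v) =
       (if a = a' then rho m (Suc j) a y y' * hist m j a u v else 0))"

lemma after_relay_entry:
  assumes "r < L * k2" "s < L * k2" "u < d3 ^ j" "v < d3 ^ j"
  shows "after_relay b m j $$ (r * d3 ^ j + u, s * d3 ^ j + v) =
    (if r = s then trp (if j = 0 then 1 else L * d2) (relay_povm (Suc j) r)
       (\<lambda>x y. round_state N (code b) m j $$ (x * d3 ^ j + u, y * d3 ^ j + v)) else 0)"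
proof -
  have "after_relay b m j $$ (r * d3 ^ j + u, s * d3 ^ j + v) =
    relay_op (code b) (Suc j) (slice (relay_dim N (code b) j) (d3 ^ j) (round_state N (code b) m j) 0 u 0 v) $$ (r, s)"
    using local_op_entry[of 0 1 0 r "L * k2" s u "d3 ^ j" v] assms by (simp add: code_simps)
  also have "\<dots> = (if r = s then trp (if j = 0 then 1 else L * d2) (relay_povm (Suc j) r)
       (\<lambda>x y. round_state N (code b) m j $$ (x * d3 ^ j + u, y * d3 ^ j + v)) else 0)"
    using assms by (auto simp: code_simps measurement_map_def slice_def intro!: trp_cong)
  finally show ?thesis .
qed

lemma relay_ok_0: "relay_ok b m 0"
  unfolding relay_ok_def
proof (intro allI impI)
  fix r s u v assume rs: "r < L * k2" "s < L * k2" and uv: "u < d3 ^ 0" "v < d3 ^ 0"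
  show "after_relay b m 0 $$ (r * d3 ^ 0 + u, s * d3 ^ 0 + v) =
       (if r = s \<and> r mod k2 = c2 (r div k2) then hist m 0 (r div k2) u v else 0)"
    unfolding after_relay_entry[OF rs uv] using uv by (simp add: trp_def relay_povm_def)
qed

lemma round_ok_step:
  assumes "relay_ok b m j"
  shows "round_ok b m j"
  unfolding round_ok_def
proof (intro allI impI)
  fix a a' y y' u v
  assume a: "a < L" "a' < L" and y: "y < d2 * d3" "y' < d2 * d3" and uv: "u < d3 ^ j" "v < d3 ^ j"
  let ?D = "d3 ^ j"
  let ?M = "after_relay b m j"
  let ?o = "\<lambda>x2. out N (c1 (digit L m (Suc j))) x2 $$ (y, y')"
  have "round_state N (code b) m (Suc j) $$
       ((a * (d2 * d3) + y) * ?D + u, (a' * (d2 * d3) + y') * ?D + v)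
     = channel_use N (c1 (digit L m (Suc j))) (slice k2 ?D ?M a u a' v) $$ (y, y')"
    using local_op_entry[OF a y uv] by (simp add: code_simps)
  also have "\<dots> = (\<Sum>x<k2. ?M $$ ((a * k2 + x) * ?D + u, (a' * k2 + x) * ?D + v) * ?o x)"
  proof -
    have "dim_row (out N (c1 (digit L m (Suc j))) x) = d2 * d3"
      "dim_col (out N (c1 (digit L m (Suc j))) x) = d2 * d3" if "x < k2" for x
      using out_density[OF c1_less[OF digit_less[OF L_pos]] that] carrier_matD
      by (auto simp: density_def psd_def)
    then show ?thesis
      unfolding channel_use_def msum_def using y
      by (auto simp: slice_def intro!: sum.cong)
  qed
  also have "\<dots> = (\<Sum>x<k2. if x = c2 a then (if a = a' then ?o x * hist m j a u v else 0) else 0)"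
  proof (intro sum.cong refl)
    fix x assume "x \<in> {..<k2}"
    then have x: "x < k2" by simp
    then have "?M $$ ((a * k2 + x) * ?D + u, (a' * k2 + x) * ?D + v) =
       (if a * k2 + x = a' * k2 + x \<and> (a * k2 + x) mod k2 = c2 ((a * k2 + x) div k2)
        then hist m j ((a * k2 + x) div k2) u v else 0)"
      using assms a uv mult_add_less[OF a(1) x] mult_add_less[OF a(2) x] unfolding relay_ok_def by blast
    then show "?M $$ ((a * k2 + x) * ?D + u, (a' * k2 + x) * ?D + v) * ?o x =
        (if x = c2 a then (if a = a' then ?o x * hist m j a u v else 0) else 0)"
      using x by simp
  qed
  also have "\<dots> = (if a = a' then ?o (c2 a) * hist m j a u v else 0)"
    using c2_less[OF a(1)] by simp
  finally show "round_state N (code b) m (Suc j) $$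
       ((a * (d2 * d3) + y) * d3 ^ j + u, (a' * (d2 * d3) + y') * d3 ^ j + v) =
       (if a = a' then rho m (Suc j) a y y' * hist m j a u v else 0)" .
qed

lemma round_state_entry:
  assumes "round_ok b m j" "a < L" "a' < L" "p < d2" "q < d2" "u < d3 ^ Suc j" "v < d3 ^ Suc j"
  shows "round_state N (code b) m (Suc j) $$ ((a * d2 + p) * d3 ^ Suc j + u, (a' * d2 + q) * d3 ^ Suc j + v) =
    (if a = a' then rho m (Suc j) a (p * d3 + u div d3 ^ j) (q * d3 + v div d3 ^ j)
       * hist m j a (u mod d3 ^ j) (v mod d3 ^ j) else 0)"
proof -
  let ?D = "d3 ^ j"
  have uv: "u < d3 * ?D" "v < d3 * ?D" using assms by simp_all
  \<comment> \<open>Regrouping: the new receiver system leaves the pair with the relay's output and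
    becomes the leftmost of the receiver's systems.\<close>
  have idx: "(a * d2 + p) * d3 ^ Suc j + u = (a * (d2 * d3) + (p * d3 + u div ?D)) * ?D + u mod ?D" for a p u
  proof -
    have "(a * (d2 * d3) + (p * d3 + u div ?D)) * ?D + u mod ?D
        = (a * d2 + p) * (d3 * ?D) + (u div ?D * ?D + u mod ?D)"
      by (simp add: algebra_simps)
    then show ?thesis by (simp only: div_mult_mod_eq power_Suc)
  qed
  show ?thesis
    unfolding idx using assms(1) unfolding round_ok_def
    using assms mult_add_less[OF assms(4) div_less_mult[OF uv(1)]] mult_add_less[OF assms(5) div_less_mult[OF uv(2)]]
      mod_less_mult[OF uv(1)] mod_less_mult[OF uv(2)]
    by blast
qed

text \<open>Diagonality in the memory leaves only a = a' in the trace; measuring \<Lambda> a on the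
  relay's output turns the product with \<open>hist m j a\<close> into a summand of
  \<open>hist m (Suc j)\<close>.\<close>

lemma relay_ok_step:
  assumes "round_ok b m j"
  shows "relay_ok b m (Suc j)"
  unfolding relay_ok_def
proof (intro allI impI)
  fix r s u v assume rs: "r < L * k2" "s < L * k2" and uv: "u < d3 ^ Suc j" "v < d3 ^ Suc j"
  let ?D = "d3 ^ j"
  have "trp (L * d2) (relay_povm (Suc (Suc j)) r)
       (\<lambda>x y. round_state N (code b) m (Suc j) $$ (x * d3 ^ Suc j + u, y * d3 ^ Suc j + v))
     = (\<Sum>a<L. \<Sum>a'<L. if a = a' then (if r mod k2 = c2 (r div k2) then
         link m (Suc j) a (r div k2) (u div ?D) (v div ?D) * hist m j a (u mod ?D) (v mod ?D) else 0) else 0)"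
    unfolding trp_split
  proof (intro sum.cong refl)
    fix a a' assume "a \<in> {..<L}" "a' \<in> {..<L}"
    then have a: "a < L" "a' < L" by auto
    have "trp d2 (\<lambda>p q. relay_povm (Suc (Suc j)) r (a * d2 + p) (a' * d2 + q))
        (\<lambda>q p. round_state N (code b) m (Suc j) $$ ((a' * d2 + q) * d3 ^ Suc j + u, (a * d2 + p) * d3 ^ Suc j + v))
      = trp d2 (\<lambda>p q. if a = a' \<and> r mod k2 = c2 (r div k2) then \<Lambda> a (r div k2) p q else 0)
          (\<lambda>p q. if a = a' then rho m (Suc j) a (p * d3 + u div ?D) (q * d3 + v div ?D)
             * hist m j a (u mod ?D) (v mod ?D) else 0)"
      by (rule trp_cong)
         (auto simp: relay_povm_def round_state_entry[OF assms a(2,1) _ _ uv] simp del: power_Suc round_state.simps)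
    also have "\<dots> = (if a = a' then (if r mod k2 = c2 (r div k2) then
         link m (Suc j) a (r div k2) (u div ?D) (v div ?D) * hist m j a (u mod ?D) (v mod ?D) else 0) else 0)"
      by (simp add: link_def contract_def trp_def sum_distrib_right mult.assoc)
    finally show "trp d2 (\<lambda>p q. relay_povm (Suc (Suc j)) r (a * d2 + p) (a' * d2 + q))
        (\<lambda>q p. round_state N (code b) m (Suc j) $$ ((a' * d2 + q) * d3 ^ Suc j + u, (a * d2 + p) * d3 ^ Suc j + v))
      = (if a = a' then (if r mod k2 = c2 (r div k2) then
         link m (Suc j) a (r div k2) (u div ?D) (v div ?D) * hist m j a (u mod ?D) (v mod ?D) else 0) else 0)" .
  qed
  also have "\<dots> = (if r mod k2 = c2 (r div k2) then hist m (Suc j) (r div k2) u v else 0)"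
    by (simp add: tensor_def)
  finally show "after_relay b m (Suc j) $$ (r * d3 ^ Suc j + u, s * d3 ^ Suc j + v) =
       (if r = s \<and> r mod k2 = c2 (r div k2) then hist m (Suc j) (r div k2) u v else 0)"
    unfolding after_relay_entry[OF rs uv] by (cases "r = s") (simp_all del: round_state.simps power_Suc)
qed

lemma relay_ok: "relay_ok b m j"
  by (induction j) (auto intro: relay_ok_0 relay_ok_step round_ok_step)

lemma receiver_state_carrier: "receiver_state N C n m \<in> carrier_mat (dB3 N ^ n) (dB3 N ^ n)"
  by (simp add: receiver_state_def ptrace_def)

text \<open>The relay does not measure its last output, which is traced out instead. Since \<Lambda>
  a is complete, a final relay measurement may be inserted without changing the receiver's state;
  this puts the last block on the same footing as the others.\<close>

lemma receiver_state_entry: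
  assumes "u < d3 ^ Suc j" "v < d3 ^ Suc j"
  shows "receiver_state N (code b) (Suc j) m $$ (u, v) = (\<Sum>a<L. hist m (Suc j) a u v)"
proof -
  let ?D = "d3 ^ j"
  have ok: "round_ok b m j" by (intro round_ok_step relay_ok)
  have "receiver_state N (code b) (Suc j) m $$ (u, v)
     = (\<Sum>x<L * d2. round_state N (code b) m (Suc j) $$ (x * d3 ^ Suc j + u, x * d3 ^ Suc j + v))"
    using assms tr_carrier[OF slice_carrier]
    by (simp add: receiver_state_def ptrace_def code_simps del: round_state.simps power_Suc)
       (simp add: slice_def del: round_state.simps power_Suc)
  also have "\<dots> = (\<Sum>a<L. \<Sum>p<d2. rho m (Suc j) a (p * d3 + u div ?D) (p * d3 + v div ?D)
       * hist m j a (u mod ?D) (v mod ?D))"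
    unfolding sum_lessThan_mult
    by (intro sum.cong refl) (simp add: round_state_entry[OF ok] assms del: round_state.simps power_Suc)
  also have "\<dots> = (\<Sum>a<L. \<Sum>a'<L. link m (Suc j) a a' (u div ?D) (v div ?D) * hist m j a (u mod ?D) (v mod ?D))"
    by (rule sum.cong[OF refl]) (simp add: link_sum flip: sum_distrib_right)
  also have "\<dots> = (\<Sum>a'<L. hist m (Suc j) a' u v)"
    by (subst sum.swap) (simp add: tensor_def)
  finally show ?thesis .
qed

section \<open>Error probability of the code\<close>

lemma trp_hist_Suc:
  "trp (d3 ^ Suc j) (tensors d3 K (Suc j)) (hist m (Suc j) a') =
    (\<Sum>a<L. trp d3 (K (Suc j)) (link m (Suc j) a a') * trp (d3 ^ j) (tensors d3 K j) (hist m j a))"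
  by (simp add: trp_sum_right trp_tensor)

text \<open>Here a is the previous and a' the current message, and the relay's input is correct. The
  first bracket is the relay's failure to find a', the second the receiver's failure to find a, each
  on its own reduced output.\<close>

definition block_error :: "nat \<Rightarrow> nat \<Rightarrow> real" where
  "block_error a a' = (1 - Re (trp d2 (\<Lambda> a a') (ptrace_right d3 (ent (out N (c1 a') (c2 a))))))
     + (1 - Re (trp d3 (\<Gamma> a) (ptrace_left d2 d3 (ent (out N (c1 a') (c2 a))))))"

lemma \<Lambda>_effect: "a < L \<Longrightarrow> i < L \<Longrightarrow> effect d2 (\<Lambda> a i)"
  by (rule povm_effect[where I = "{..<L}"]) (auto intro: \<Lambda>_pos simp: \<Lambda>_sum)

lemma \<Gamma>_effect: "i < L \<Longrightarrow> effect d3 (\<Gamma> i)"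
  by (rule povm_effect[where I = "{..<L}"]) (auto intro: \<Gamma>_pos simp: \<Gamma>_sum)

lemma rho_pos_trace:
  assumes "a < L"
  shows "pos (d2 * d3) (rho m j a)" "trp (d2 * d3) idk (rho m j a) = 1"
  using rho_density[OF assms, of m j]
  by (auto simp: density_def psd_iff_pos trp_idk tr_carrier)

lemma dec_factor_effect: "1 \<le> j \<Longrightarrow> effect d3 (dec_factor m j)"
  using \<Gamma>_effect[OF digit_less[OF L_pos]] by (simp add: dec_factor_def effect_idk)

text \<open>Completeness of \<Lambda> a makes the traces of the links leaving a add up to the trace
  of the channel output, so the total weight is conserved.\<close>

lemma hist_total: "(\<Sum>a<L. trp (d3 ^ j) (tensors d3 (\<lambda>_. idk) j) (hist m j a)) = 1"
proof (induction j)
  case 0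
  then show ?case using L_pos by (simp add: trp_idk)
next
  case (Suc j)
  have one: "(\<Sum>a'<L. trp d3 idk (link m (Suc j) a a')) = 1" if "a < L" for a
  proof -
    have "(\<Sum>a'<L. trp d3 idk (link m (Suc j) a a')) = trp d3 idk (\<lambda>u v. \<Sum>a'<L. link m (Suc j) a a' u v)"
      by (simp add: trp_sum_right)
    also have "\<dots> = trp d3 idk (ptrace_left d2 d3 (rho m (Suc j) a))"
      by (simp add: link_sum[OF that] ptrace_left_def[abs_def])
    finally show ?thesis using rho_pos_trace[OF that] by (simp add: trp_idk_ptrace)
  qed
  have "(\<Sum>a'<L. trp (d3 ^ Suc j) (tensors d3 (\<lambda>_. idk) (Suc j)) (hist m (Suc j) a')) =
    (\<Sum>a<L. (\<Sum>a'<L. trp d3 idk (link m (Suc j) a a')) * trp (d3 ^ j) (tensors d3 (\<lambda>_. idk) j) (hist m j a))"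
    unfolding trp_hist_Suc sum_distrib_right by (rule sum.swap)
  then show ?case using Suc by (simp add: one)
qed

lemma hist_nonneg:
  assumes "a < L" "\<And>i. 1 \<le> i \<Longrightarrow> pos d3 (K i)"
  shows "0 \<le> trp (d3 ^ j) (tensors d3 K j) (hist m j a)"
  using assms(1)
proof (induction j arbitrary: a)
  case 0
  then show ?case by (simp add: trp_def idk_def less_eq_complex_def)
next
  case (Suc j)
  have "0 \<le> trp d3 (K (Suc j)) (link m (Suc j) a' a)" if "a' < L" for a'
    using that Suc.prems assms(2) by (intro trp_nonneg pos_link) auto
  then show ?case unfolding trp_hist_Suc using Suc by (intro sum_nonneg mult_nonneg_nonneg) auto
qed

text \<open>By \<open>trp_hist_Suc\<close> the weights obey a nonnegative linear recursion over
  estimates. Keeping only the correct predecessor in each round gives a product of one factor per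
  block, and such a product is at least 1 minus the sum of the deficits.\<close>

lemma hist_correct:
  "1 - (\<Sum>j=1..k. 1 - Re (trp d3 (dec_factor m j) (link m j (digit L m (j - 1)) (digit L m j))))
    \<le> Re (trp (d3 ^ k) (tensors d3 (dec_factor m) k) (hist m k (digit L m k)))"
proof -
  define h where "h j a = trp (d3 ^ j) (tensors d3 (dec_factor m) j) (hist m j a)" for j a
  define w where "w j a a' = trp d3 (dec_factor m j) (link m j a a')" for j a a'
  define g where "g j = (\<Prod>i=1..j. Re (w i (digit L m (i - 1)) (digit L m i)))" for j
  note dL = digit_less[OF L_pos]
  have w0: "0 \<le> w j a a'" if "1 \<le> j" "a < L" "a' < L" for j a a'
    unfolding w_def using that by (intro trp_nonneg dec_factor_pos pos_link)
  have w1: "Re (w j a a') \<le> 1" if "1 \<le> j" "a < L" "a' < L" for j a a'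
    using joint_effect_le_one[OF rho_pos_trace(1)[OF that(2), of m j] \<Lambda>_effect[OF that(2,3)] dec_factor_effect[OF that(1), of m]]
      rho_pos_trace(2)[OF that(2), of m j]
    by (simp add: w_def link_def less_eq_complex_def)
  have hS: "h (Suc j) a' = (\<Sum>a<L. w (Suc j) a a' * h j a)" for j a'
    unfolding h_def w_def by (rule trp_hist_Suc)
  have h0: "0 \<le> h j a" if "a < L" for j a
    unfolding h_def using that by (intro hist_nonneg dec_factor_pos)
  have g01: "0 \<le> g j \<and> g j \<le> 1" for j
    unfolding g_def using w0 w1 dL
    by (auto intro!: prod_nonneg prod_le_1 simp: less_eq_complex_def)
  have hg: "g j \<le> Re (h j (digit L m j))" for j
  proof (induction j)
    case 0
    then show ?case by (simp add: g_def h_def trp_def idk_def digit_def)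
  next
    case (Suc j)
    let ?a = "digit L m j" and ?a' = "digit L m (Suc j)"
    have "g (Suc j) = Re (w (Suc j) ?a ?a') * g j" by (simp add: g_def mult.commute)
    also have "\<dots> \<le> Re (w (Suc j) ?a ?a') * Re (h j ?a)"
      using w0[of "Suc j" ?a ?a'] dL by (intro mult_left_mono Suc) (auto simp: less_eq_complex_def)
    also have "\<dots> = Re (w (Suc j) ?a ?a' * h j ?a)"
      using h0[OF dL] by (simp add: less_eq_complex_def)
    also have "\<dots> \<le> Re (h (Suc j) ?a')"
    proof -
      have "w (Suc j) ?a ?a' * h j ?a \<le> h (Suc j) ?a'"
        unfolding hS using w0 h0 dL by (intro member_le_sum) auto
      then show ?thesis by (simp add: less_eq_complex_def)
    qed
    finally show ?case .
  qed
  \<comment> \<open>For numbers in [0, 1], (1 - x) (1 - g) \<ge> 0 gives x g \<ge> x + g -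
    1.\<close>
  have gs: "1 - (\<Sum>i=1..j. 1 - Re (w i (digit L m (i - 1)) (digit L m i))) \<le> g j" for j
  proof (induction j)
    case (Suc j)
    define x where "x = Re (w (Suc j) (digit L m j) (digit L m (Suc j)))"
    have x: "0 \<le> x" "x \<le> 1" using w0 w1 dL by (auto simp: x_def less_eq_complex_def)
    have "0 \<le> (1 - x) * (1 - g j)" using x g01[of j] by (intro mult_nonneg_nonneg) auto
    moreover have "g (Suc j) = x * g j" by (simp add: g_def x_def mult.commute)
    ultimately show ?case using Suc by (simp add: x_def[symmetric] algebra_simps)
  qed (simp add: g_def)
  show ?thesis using order.trans[OF gs hg] by (simp add: w_def h_def)
qed

lemma error_prob_le:
  assumes b: "1 \<le> b"
  shows "error_prob N b (code b) \<le>
    1 / real (L ^ (b - 1)) * (\<Sum>m<L ^ (b - 1). \<Sum>j=1..b. block_error (digit L m (j - 1)) (digit L m j))"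
proof -
  obtain k where k: "b = Suc k" using b by (cases b) auto
  note dL = digit_less[OF L_pos]
  have "Re (tr ((1\<^sub>m (d3 ^ b) - dec (code b) m) * receiver_state N (code b) b m))
     \<le> (\<Sum>j=1..b. block_error (digit L m (j - 1)) (digit L m j))" for m
  proof -
    define h where "h K a = trp (d3 ^ b) (tensors d3 K b) (hist m b a)" for K a
    have trK: "trp (d3 ^ b) (tensors d3 K b) (ent (receiver_state N (code b) b m)) = (\<Sum>a<L. h K a)" for K
    proof -
      have "trp (d3 ^ b) (tensors d3 K b) (ent (receiver_state N (code b) b m))
        = trp (d3 ^ b) (tensors d3 K b) (\<lambda>u v. \<Sum>a<L. hist m b a u v)"
        by (rule trp_cong) (simp_all add: k receiver_state_entry del: power_Suc hist.simps)
      then show ?thesis by (simp add: h_def trp_sum_right)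
    qed
    have "tr ((1\<^sub>m (d3 ^ b) - dec (code b) m) * receiver_state N (code b) b m)
      = trp (d3 ^ b) (\<lambda>u v. tensors d3 (\<lambda>_. idk) b u v - tensors d3 (dec_factor m) b u v)
          (ent (receiver_state N (code b) b m))"
      by (subst tr_mult[OF _ receiver_state_carrier])
         (auto simp: code_simps tensors_idk idk_def intro!: trp_cong)
    also have "\<dots> = 1 - (\<Sum>a<L. h (dec_factor m) a)"
      by (simp add: trp_diff_left trK) (simp add: h_def hist_total)
    finally have "Re (tr ((1\<^sub>m (d3 ^ b) - dec (code b) m) * receiver_state N (code b) b m))
      = 1 - (\<Sum>a<L. Re (h (dec_factor m) a))" by simp
    \<comment> \<open>Success of the receiver after a wrong final estimate of the relay is simply
      not counted.\<close>
    also have "\<dots> \<le> 1 - Re (h (dec_factor m) (digit L m b))"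
    proof -
      have "0 \<le> Re (h (dec_factor m) a)" if "a < L" for a
        using hist_nonneg[OF that, of "dec_factor m" b m] dec_factor_pos by (simp add: h_def less_eq_complex_def)
      then show ?thesis using member_le_sum[of "digit L m b" "{..<L}" "\<lambda>a. Re (h (dec_factor m) a)"] dL by simp
    qed
    also have "\<dots> \<le> (\<Sum>j=1..b. 1 - Re (trp d3 (dec_factor m j) (link m j (digit L m (j - 1)) (digit L m j))))"
      using hist_correct[of m b] by (simp add: h_def)
    also have "\<dots> \<le> (\<Sum>j=1..b. block_error (digit L m (j - 1)) (digit L m j))"
    proof (rule sum_mono)
      fix j assume j: "j \<in> {1..b}"
      define a where "a = digit L m (j - 1)"
      have a: "a < L" and a': "digit L m j < L" using dL by (auto simp: a_def)
      note pt = rho_pos_trace[OF a, of m j]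
      \<comment> \<open>In block 1 the receiver measures nothing and cannot fail; charging it the
        error of \<Gamma> a there as well only enlarges the bound and treats all blocks
        alike.\<close>
      have "trp d3 (\<Gamma> a) (ptrace_left d2 d3 (rho m j a)) \<le> trp d3 (dec_factor m j) (ptrace_left d2 d3 (rho m j a))"
      proof -
        have "dec_factor m j = (if j = 1 then idk else \<Gamma> a)"
          using j by (auto simp: dec_factor_def a_def)
        then show ?thesis
          using effect_trp_le[OF \<Gamma>_effect[OF a] pos_ptrace_left[OF pt(1)]] by auto
      qed
      moreover have "1 - trp d3 (dec_factor m j) (link m j a (digit L m j)) \<le>
          (1 - trp d2 (\<Lambda> a (digit L m j)) (ptrace_right d3 (rho m j a)))
           + (1 - trp d3 (dec_factor m j) (ptrace_left d2 d3 (rho m j a)))"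
        using joint_effect_union_bound[OF pt(1) \<Lambda>_effect[OF a a'] dec_factor_effect[of j m]] j pt(2)
        by (simp add: link_def)
      ultimately show "1 - Re (trp d3 (dec_factor m j) (link m j (digit L m (j - 1)) (digit L m j)))
         \<le> block_error (digit L m (j - 1)) (digit L m j)"
        by (simp add: block_error_def a_def less_eq_complex_def)
    qed
    finally show ?thesis .
  qed
  then have "(\<Sum>m<L ^ (b - 1). Re (tr ((1\<^sub>m (d3 ^ b) - dec (code b) m) * receiver_state N (code b) b m)))
    \<le> (\<Sum>m<L ^ (b - 1). \<Sum>j=1..b. block_error (digit L m (j - 1)) (digit L m j))"
    by (rule sum_mono)
  then show ?thesis
    unfolding error_prob_def by (simp add: code_simps divide_right_mono)
qed

end

subsection \<open>Random codebooks and hypothesis tests\<close>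

lemma exists_le_average:
  fixes w F :: "'a \<Rightarrow> real"
  assumes "finite S" "\<And>s. s \<in> S \<Longrightarrow> 0 \<le> w s" "sum w S = 1" "(\<Sum>s\<in>S. w s * F s) \<le> B"
  shows "\<exists>s\<in>S. F s \<le> B"
proof (rule ccontr)
  assume "\<not> ?thesis"
  then have F: "B < F s" if "s \<in> S" for s using that by auto
  have "\<exists>s\<in>S. 0 < w s"
  proof (rule ccontr)
    assume "\<not> ?thesis"
    then have "w s = 0" if "s \<in> S" for s using assms(2)[OF that] that by force
    then show False using assms(3) by simp
  qed
  then obtain s where "s \<in> S" "0 < w s" by blast
  moreover have "w s * B \<le> w s * F s" if "s \<in> S" for s
    using assms(2)[OF that] F[OF that] by (intro mult_left_mono) auto
  ultimately have "(\<Sum>s\<in>S. w s * B) < (\<Sum>s\<in>S. w s * F s)"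
    using assms(1) F by (intro sum_strict_mono_ex1) (auto intro: mult_strict_left_mono)
  then show False using assms(3,4) by (simp flip: sum_distrib_right)
qed

definition codebooks :: "nat \<Rightarrow> nat \<Rightarrow> (nat \<Rightarrow> nat) set" where
  "codebooks L K = PiE {..<L} (\<lambda>_. {..<K})"

definition codebook_prob :: "nat \<Rightarrow> (nat \<Rightarrow> real) \<Rightarrow> (nat \<Rightarrow> nat) \<Rightarrow> real" where
  "codebook_prob L p c = (\<Prod>i<L. p (c i))"

lemma finite_codebooks: "finite (codebooks L K)"
  by (simp add: codebooks_def finite_PiE)

lemma codebooks_less: "c \<in> codebooks L K \<Longrightarrow> i < L \<Longrightarrow> c i < K"
  by (auto simp: codebooks_def)

text \<open>Independence of the codewords. Factors \<open>h i\<close> that are constantly 1 drop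
  out, which is how the marginals below are read off.\<close>

lemma codebook_prob_product:
  "(\<Sum>c\<in>codebooks L K. codebook_prob L p c * (\<Prod>i<L. h i (c i))) = (\<Prod>i<L. \<Sum>x<K. p x * h i x)"
  unfolding codebooks_def codebook_prob_def prod.distrib[symmetric]
  by (rule prod_sum_PiE[symmetric]) auto

lemma codebook_prob_sum: "prob_dist K p \<Longrightarrow> (\<Sum>c\<in>codebooks L K. codebook_prob L p c) = 1"
  using codebook_prob_product[of L p "\<lambda>_ _. 1" K] by (simp add: prob_dist_def)

lemma codebook_prob_nonneg: "prob_dist K p \<Longrightarrow> c \<in> codebooks L K \<Longrightarrow> 0 \<le> codebook_prob L p c"
  unfolding codebook_prob_def by (intro prod_nonneg) (auto simp: prob_dist_def codebooks_less)

lemma codebook_marginal: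
  assumes "prob_dist K p" "m < L"
  shows "(\<Sum>c\<in>codebooks L K. codebook_prob L p c * g (c m)) = (\<Sum>x<K. p x * g x)"
proof -
  define h where "h i x = (if i = m then g x else 1)" for i x
  have "(\<Prod>i<L. h i (c i)) = g (c m)" for c
    using assms(2) by (simp add: h_def)
  then have "(\<Sum>c\<in>codebooks L K. codebook_prob L p c * g (c m)) = (\<Prod>i<L. \<Sum>x<K. p x * h i x)"
    using codebook_prob_product[of L p h K] by simp
  also have "\<dots> = (\<Prod>i<L. if i = m then (\<Sum>x<K. p x * g x) else 1)"
    using assms(1) by (intro prod.cong refl) (simp add: h_def prob_dist_def)
  finally show ?thesis using assms(2) by simp
qed

lemma codebook_marginal2:
  assumes "prob_dist K p" "i < L" "m < L" "i \<noteq> m"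
  shows "(\<Sum>c\<in>codebooks L K. codebook_prob L p c * g (c i) (c m)) = (\<Sum>x<K. \<Sum>y<K. p x * p y * g x y)"
proof -
  \<comment> \<open>A general g of two codewords is not a product; fixing the value x of the first
    by an indicator makes it one, and summing over x recovers g.\<close>
  have ind: "(\<Sum>c\<in>codebooks L K. codebook_prob L p c * (of_bool (c i = x) * G (c m))) = p x * (\<Sum>y<K. p y * G y)"
    if "x < K" for x G
  proof -
    define h where "h j y = (if j = i then of_bool (y = x) else if j = m then G y else 1)" for j y
    have "(\<Prod>j<L. h j (c j)) = of_bool (c i = x) * G (c m)" for c
    proof -
      have "(\<Prod>j<L. h j (c j)) = h i (c i) * (\<Prod>j\<in>{..<L} - {i}. h j (c j))"
        using assms(2) by (intro prod.remove) auto
      also have "(\<Prod>j\<in>{..<L} - {i}. h j (c j)) = h m (c m) * (\<Prod>j\<in>{..<L} - {i} - {m}. h j (c j))"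
        using assms(3,4) by (intro prod.remove) auto
      also have "(\<Prod>j\<in>{..<L} - {i} - {m}. h j (c j)) = 1"
        by (intro prod.neutral) (auto simp: h_def)
      finally show ?thesis using assms(4) by (simp add: h_def)
    qed
    then have "(\<Sum>c\<in>codebooks L K. codebook_prob L p c * (of_bool (c i = x) * G (c m))) = (\<Prod>j<L. \<Sum>y<K. p y * h j y)"
      using codebook_prob_product[of L p h K] by simp
    also have "\<dots> = (\<Prod>j<L. if j = i then p x else if j = m then (\<Sum>y<K. p y * G y) else 1)"
    proof (intro prod.cong refl)
      fix j
      have "(\<Sum>y<K. p y * of_bool (y = x)) = p x"
        using that by (simp add: of_bool_def if_distrib[of "\<lambda>z. _ * z"] cong: if_cong)
      then show "(\<Sum>y<K. p y * h j y) = (if j = i then p x else if j = m then (\<Sum>y<K. p y * G y) else 1)"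
        using assms(1) by (simp add: h_def prob_dist_def)
    qed
    also have "\<dots> = p x * (\<Prod>j\<in>{..<L} - {i}. if j = m then (\<Sum>y<K. p y * G y) else 1)"
      using assms(2) by (subst prod.remove[of _ i]) (auto intro!: prod.cong)
    also have "\<dots> = p x * (\<Sum>y<K. p y * G y)"
      using assms(3,4) by simp
    finally show ?thesis .
  qed
  have "(\<Sum>c\<in>codebooks L K. codebook_prob L p c * g (c i) (c m)) =
    (\<Sum>c\<in>codebooks L K. \<Sum>x<K. codebook_prob L p c * (of_bool (c i = x) * g x (c m)))"
  proof (rule sum.cong[OF refl])
    fix c assume "c \<in> codebooks L K"
    then have "c i < K" using assms(2) codebooks_less by blast
    then show "codebook_prob L p c * g (c i) (c m) = (\<Sum>x<K. codebook_prob L p c * (of_bool (c i = x) * g x (c m)))"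
      by (simp add: of_bool_def if_distrib[of "\<lambda>z. z * _"] if_distrib[of "\<lambda>z. _ * z"] cong: if_cong)
  qed
  also have "\<dots> = (\<Sum>x<K. p x * (\<Sum>y<K. p y * g x y))"
    by (subst sum.swap) (simp add: ind)
  finally show ?thesis by (simp add: sum_distrib_left mult.assoc)
qed

text \<open>\<open>t2 y x1 x2\<close> and \<open>t3 y x1 x2\<close> are the probabilities that the
  relay's and the receiver's test for word y accepts when x1, x2 are sent. A competing codeword is
  independent of the one sent, hence the means \<beta>2, \<beta>3. By linearity a single codebook
  pair is good for the sum over all q at once, however the indices \<alpha> q and \<alpha>' q
  repeat.\<close>

lemma random_codebooks:
  fixes t2 t3 :: "nat \<Rightarrow> nat \<Rightarrow> nat \<Rightarrow> real"
  assumes p1: "prob_dist K1 p1" and p2: "prob_dist K2 p2"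
    and good2: "(\<Sum>x1<K1. \<Sum>x2<K2. p1 x1 * p2 x2 * t2 x1 x1 x2) \<ge> 1 - \<epsilon>"
    and good3: "(\<Sum>x1<K1. \<Sum>x2<K2. p1 x1 * p2 x2 * t3 x2 x1 x2) \<ge> 1 - \<epsilon>"
    and beta2: "(\<Sum>y<K1. \<Sum>x1<K1. \<Sum>x2<K2. p1 y * p1 x1 * p2 x2 * t2 y x1 x2) = \<beta>2"
    and beta3: "(\<Sum>x1<K1. \<Sum>y<K2. \<Sum>x2<K2. p1 x1 * p2 y * p2 x2 * t3 y x1 x2) = \<beta>3"
    and nonneg: "0 \<le> \<beta>2" "0 \<le> \<beta>3"
    and Q: "\<And>q. q \<in> Q \<Longrightarrow> \<alpha> q < L" "\<And>q. q \<in> Q \<Longrightarrow> \<alpha>' q < L"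
  shows "\<exists>c1\<in>codebooks L K1. \<exists>c2\<in>codebooks L K2.
    (\<Sum>q\<in>Q. 4 * ((\<Sum>i<\<alpha>' q. t2 (c1 i) (c1 (\<alpha>' q)) (c2 (\<alpha> q))) + 1 - t2 (c1 (\<alpha>' q)) (c1 (\<alpha>' q)) (c2 (\<alpha> q)))
       + 4 * ((\<Sum>i<\<alpha> q. t3 (c2 i) (c1 (\<alpha>' q)) (c2 (\<alpha> q))) + 1 - t3 (c2 (\<alpha> q)) (c1 (\<alpha>' q)) (c2 (\<alpha> q))))
    \<le> real (card Q) * (8 * \<epsilon> + 4 * real (L - 1) * (\<beta>2 + \<beta>3))"
proof -
  define W1 where "W1 = codebook_prob L p1"
  define W2 where "W2 = codebook_prob L p2"
  define E where "E F = (\<Sum>c1\<in>codebooks L K1. \<Sum>c2\<in>codebooks L K2. W1 c1 * W2 c2 * F c1 c2)"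
    for F :: "(nat \<Rightarrow> nat) \<Rightarrow> (nat \<Rightarrow> nat) \<Rightarrow> real"
  define B where "B c1 c2 a a' = 4 * ((\<Sum>i<a'. t2 (c1 i) (c1 a') (c2 a)) + 1 - t2 (c1 a') (c1 a') (c2 a))
     + 4 * ((\<Sum>i<a. t3 (c2 i) (c1 a') (c2 a)) + 1 - t3 (c2 a) (c1 a') (c2 a))" for c1 c2 and a a' :: nat
  have E_add: "E (\<lambda>c1 c2. F c1 c2 + G c1 c2) = E F + E G" for F G
    by (simp add: E_def sum.distrib algebra_simps)
  have E_diff: "E (\<lambda>c1 c2. F c1 c2 - G c1 c2) = E F - E G" for F G
    by (simp add: E_def sum_subtractf algebra_simps)
  have E_scale: "E (\<lambda>c1 c2. r * F c1 c2) = r * E F" for F r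
    by (simp add: E_def sum_distrib_left mult_ac)
  have E_sum: "E (\<lambda>c1 c2. \<Sum>q\<in>I. F q c1 c2) = (\<Sum>q\<in>I. E (F q))" for F and I :: "'b set"
    by (induction I rule: infinite_finite_induct) (simp_all add: E_add, simp_all add: E_def)
  have E_one: "E (\<lambda>_ _. 1) = 1"
    using codebook_prob_sum[OF p1] codebook_prob_sum[OF p2]
    by (simp add: E_def W1_def W2_def flip: sum_distrib_left)
  have E_const: "E (\<lambda>_ _. r) = r" for r
    using E_scale[of r "\<lambda>_ _. 1"] E_one by simp
  have E1: "E (\<lambda>c1 c2. F (c1 a') (c2 a)) = (\<Sum>x1<K1. \<Sum>x2<K2. p1 x1 * p2 x2 * F x1 x2)"
    if "a < L" "a' < L" for F a a'
  proof -
    have "E (\<lambda>c1 c2. F (c1 a') (c2 a)) = (\<Sum>c1\<in>codebooks L K1. W1 c1 * (\<Sum>x2<K2. p2 x2 * F (c1 a') x2))"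
      using codebook_marginal[OF p2 that(1)] by (simp add: E_def W2_def mult.assoc flip: sum_distrib_left)
    also have "\<dots> = (\<Sum>x1<K1. p1 x1 * (\<Sum>x2<K2. p2 x2 * F x1 x2))"
      unfolding W1_def by (rule codebook_marginal[OF p1 that(2)])
    finally show ?thesis by (simp add: sum_distrib_left mult.assoc)
  qed
  have E2: "E (\<lambda>c1 c2. t2 (c1 i) (c1 a') (c2 a)) = \<beta>2" if "a < L" "a' < L" "i < a'" for i a a'
  proof -
    have "E (\<lambda>c1 c2. t2 (c1 i) (c1 a') (c2 a)) = (\<Sum>c1\<in>codebooks L K1. W1 c1 * (\<Sum>x2<K2. p2 x2 * t2 (c1 i) (c1 a') x2))"
      using codebook_marginal[OF p2 that(1)] by (simp add: E_def W2_def mult.assoc flip: sum_distrib_left)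
    also have "\<dots> = (\<Sum>y<K1. \<Sum>x1<K1. p1 y * p1 x1 * (\<Sum>x2<K2. p2 x2 * t2 y x1 x2))"
      unfolding W1_def by (rule codebook_marginal2[OF p1]) (use that in auto)
    finally show ?thesis using beta2 by (simp add: sum_distrib_left mult.assoc)
  qed
  have E3: "E (\<lambda>c1 c2. t3 (c2 i) (c1 a') (c2 a)) = \<beta>3" if "a < L" "a' < L" "i < a" for i a a'
  proof -
    have "E (\<lambda>c1 c2. t3 (c2 i) (c1 a') (c2 a)) = (\<Sum>c1\<in>codebooks L K1. W1 c1 * (\<Sum>c2\<in>codebooks L K2. W2 c2 * t3 (c2 i) (c1 a') (c2 a)))"
      by (simp add: E_def mult.assoc flip: sum_distrib_left)
    also have "\<dots> = (\<Sum>c1\<in>codebooks L K1. W1 c1 * (\<Sum>y<K2. \<Sum>x2<K2. p2 y * p2 x2 * t3 y (c1 a') x2))"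
    proof (rule sum.cong[OF refl])
      fix c1
      have "(\<Sum>c2\<in>codebooks L K2. W2 c2 * t3 (c2 i) (c1 a') (c2 a)) = (\<Sum>y<K2. \<Sum>x2<K2. p2 y * p2 x2 * t3 y (c1 a') x2)"
        unfolding W2_def by (rule codebook_marginal2[OF p2]) (use that in auto)
      then show "W1 c1 * (\<Sum>c2\<in>codebooks L K2. W2 c2 * t3 (c2 i) (c1 a') (c2 a)) =
        W1 c1 * (\<Sum>y<K2. \<Sum>x2<K2. p2 y * p2 x2 * t3 y (c1 a') x2)" by simp
    qed
    also have "\<dots> = (\<Sum>x1<K1. p1 x1 * (\<Sum>y<K2. \<Sum>x2<K2. p2 y * p2 x2 * t3 y x1 x2))"
      unfolding W1_def by (rule codebook_marginal[OF p1 that(2)])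
    finally show ?thesis using beta3 by (simp add: sum_distrib_left mult.assoc)
  qed
  \<comment> \<open>There are a' and a earlier competitors, each at most L - 1, whatever the
    position of the right message in the order of testing.\<close>
  have EB: "E (\<lambda>c1 c2. B c1 c2 a a') \<le> 8 * \<epsilon> + 4 * real (L - 1) * (\<beta>2 + \<beta>3)" if a: "a < L" "a' < L" for a a'
  proof -
    have "E (\<lambda>c1 c2. B c1 c2 a a') =
      4 * (real a' * \<beta>2 + 1 - (\<Sum>x1<K1. \<Sum>x2<K2. p1 x1 * p2 x2 * t2 x1 x1 x2))
       + 4 * (real a * \<beta>3 + 1 - (\<Sum>x1<K1. \<Sum>x2<K2. p1 x1 * p2 x2 * t3 x2 x1 x2))"
      unfolding B_def
      using E1[OF a, of "\<lambda>x1 x2. t2 x1 x1 x2"] E1[OF a, of "\<lambda>x1 x2. t3 x2 x1 x2"]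
      by (simp add: E_add E_diff E_scale E_sum E_const E2[OF a] E3[OF a])
    also have "\<dots> \<le> 4 * (real (L - 1) * \<beta>2 + \<epsilon>) + 4 * (real (L - 1) * \<beta>3 + \<epsilon>)"
    proof -
      have "real a' * \<beta>2 \<le> real (L - 1) * \<beta>2" "real a * \<beta>3 \<le> real (L - 1) * \<beta>3"
        using a nonneg by (auto intro!: mult_right_mono)
      moreover have "4 * (x + 1 - g) + 4 * (y + 1 - h) \<le> 4 * (x' + \<epsilon>) + 4 * (y' + \<epsilon>)"
        if "x \<le> x'" "y \<le> y'" "1 - \<epsilon> \<le> g" "1 - \<epsilon> \<le> h" for x y x' y' g h :: real
        using that by (simp add: algebra_simps)
      ultimately show ?thesis using good2 good3 by blast
    qed
    finally show ?thesis by (simp add: algebra_simps)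
  qed
  let ?C = "codebooks L K1 \<times> codebooks L K2"
  let ?F = "\<lambda>c. \<Sum>q\<in>Q. B (fst c) (snd c) (\<alpha> q) (\<alpha>' q)"
  have conv: "(\<Sum>c\<in>?C. W1 (fst c) * W2 (snd c) * F (fst c) (snd c)) = E F" for F
    by (simp add: E_def sum.cartesian_product case_prod_beta)
  have "(\<Sum>c\<in>?C. W1 (fst c) * W2 (snd c) * ?F c) = (\<Sum>q\<in>Q. E (\<lambda>c1 c2. B c1 c2 (\<alpha> q) (\<alpha>' q)))"
    using conv[of "\<lambda>c1 c2. \<Sum>q\<in>Q. B c1 c2 (\<alpha> q) (\<alpha>' q)"] E_sum[of "\<lambda>q c1 c2. B c1 c2 (\<alpha> q) (\<alpha>' q)" Q] by simp
  also have "\<dots> \<le> (\<Sum>q\<in>Q. 8 * \<epsilon> + 4 * real (L - 1) * (\<beta>2 + \<beta>3))"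
    by (intro sum_mono EB Q)
  finally have avg: "(\<Sum>c\<in>?C. W1 (fst c) * W2 (snd c) * ?F c) \<le> real (card Q) * (8 * \<epsilon> + 4 * real (L - 1) * (\<beta>2 + \<beta>3))"
    by simp
  have "\<exists>c\<in>?C. ?F c \<le> real (card Q) * (8 * \<epsilon> + 4 * real (L - 1) * (\<beta>2 + \<beta>3))"
  proof (rule exists_le_average[OF _ _ _ avg])
    show "finite ?C" by (simp add: finite_codebooks)
    show "0 \<le> W1 (fst c) * W2 (snd c)" if "c \<in> ?C" for c
      using that codebook_prob_nonneg[OF p1] codebook_prob_nonneg[OF p2] by (auto simp: W1_def W2_def)
    show "(\<Sum>c\<in>?C. W1 (fst c) * W2 (snd c)) = 1"
      using conv[of "\<lambda>_ _. 1"] E_one by simp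
  qed
  then show ?thesis unfolding B_def by auto
qed

text \<open>The slack \<eta> lets a test strictly below the supremum suffice, and it treats an
  infinite relative entropy, where \<open>exp2\<close> gives 0, together with the finite
  case.\<close>

lemma near_optimal_test:
  assumes \<rho>: "density n \<rho>" and \<sigma>: "psd n \<sigma>" and \<epsilon>: "0 < \<epsilon>" and \<eta>: "0 < \<eta>"
  obtains T where "effect n T" "1 - \<epsilon> \<le> Re (trp n T (ent \<rho>))"
    "2 powr R * Re (trp n T (ent \<sigma>)) \<le> exp2 (ereal R - hyp_test_rel_ent \<epsilon> \<rho> \<sigma>) + \<eta>"
proof -
  define S where "S = {T. psd n T \<and> psd n (1\<^sub>m n - T) \<and> Re (tr (T * \<rho>)) \<ge> 1 - \<epsilon>}"
  define D where "D = hyp_test_rel_ent \<epsilon> \<rho> \<sigma>"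
  have \<rho>c: "\<rho> \<in> carrier_mat n n" and \<sigma>c: "\<sigma> \<in> carrier_mat n n"
    using \<rho> \<sigma> by (auto simp: density_def psd_def)
  have D: "D = (SUP T\<in>S. neg_log2 (Re (tr (T * \<sigma>))))"
    using \<rho>c by (simp add: D_def S_def hyp_test_rel_ent_def)
  have one: "1\<^sub>m n \<in> S"
  proof -
    have "pos n (ent (1\<^sub>m n :: complex mat)) \<longleftrightarrow> pos n idk"
      by (rule pos_cong) (simp add: idk_def)
    moreover have "pos n (ent (1\<^sub>m n - 1\<^sub>m n :: complex mat)) \<longleftrightarrow> pos n (\<lambda>i j. 0)"
      by (rule pos_cong) simp
    ultimately show ?thesis using \<rho> \<rho>c \<epsilon>
      by (simp add: S_def psd_iff_pos pos_idk pos_zero density_def minus_carrier_mat)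
  qed
  have D_ninf: "D \<noteq> -\<infinity>"
  proof
    assume "D = -\<infinity>"
    moreover have "neg_log2 (Re (tr (1\<^sub>m n * \<sigma>))) \<le> D" unfolding D by (rule SUP_upper[OF one])
    ultimately show False by (simp add: neg_log2_def split: if_splits)
  qed
  \<comment> \<open>The bound to be reached. Since e > 2^(R - D), the number R - log e lies strictly
    below the supremum D, so some feasible test exceeds it.\<close>
  define e where "e = exp2 (ereal R - D) + \<eta>"
  have e: "0 < e" using \<eta> by (simp add: e_def exp2_def add_nonneg_pos)
  have "ereal (R - log 2 e) < D"
  proof (cases D)
    case (real d)
    have "2 powr (R - d) < e" using \<eta> by (simp add: e_def exp2_def real)
    then have "R - d < log 2 e" using e by (simp add: less_log_iff)
    then show ?thesis by (simp add: real)
  qed (use D_ninf in auto)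
  then obtain A where A: "A \<in> S" "ereal (R - log 2 e) < neg_log2 (Re (tr (A * \<sigma>)))"
    unfolding D less_SUP_iff by blast
  have Ac: "A \<in> carrier_mat n n" and psdA: "psd n A" "psd n (1\<^sub>m n - A)"
    using A(1) by (auto simp: S_def psd_def)
  have eff: "effect n (ent A)"
  proof -
    have "pos n (ent (1\<^sub>m n - A)) \<longleftrightarrow> pos n (\<lambda>i j. idk i j - ent A i j)"
      by (rule pos_cong) (use Ac in \<open>simp add: idk_def\<close>)
    then show ?thesis using psdA by (simp add: effect_def psd_iff_pos)
  qed
  define t where "t = Re (trp n (ent A) (ent \<sigma>))"
  have t: "Re (tr (A * \<sigma>)) = t" by (simp add: t_def tr_mult[OF Ac \<sigma>c])
  have "0 \<le> t"
    using trp_nonneg[of n "ent A" "ent \<sigma>"] psdA \<sigma> by (simp add: t_def psd_iff_pos less_eq_complex_def)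
  have "2 powr R * t \<le> e"
  proof (cases "t = 0")
    case False
    then have tp: "0 < t" using \<open>0 \<le> t\<close> by simp
    have "log 2 t < log 2 e - R" using A(2) False by (simp add: t neg_log2_def)
    then have "log 2 (2 powr R * t) < log 2 e" using tp by (simp add: log_mult)
    then show ?thesis using tp e by simp
  qed (use e in simp)
  then show thesis
    using that[OF eff] A(1) tr_mult[OF Ac \<rho>c] by (simp add: S_def t_def e_def D_def)
qed

subsection \<open>Classical-quantum states\<close>

text \<open>The blocks \<open>B X\<close> are weighted states, so the probability of X is the trace
  of its block.\<close>

definition cq_blocks :: "nat \<Rightarrow> nat \<Rightarrow> complex mat \<Rightarrow> (nat \<Rightarrow> nat \<Rightarrow> nat \<Rightarrow> complex) \<Rightarrow> bool" where
  "cq_blocks K d M B \<longleftrightarrow> M \<in> carrier_mat (K * d) (K * d) \<and>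
     (\<forall>X<K. \<forall>Y<K. \<forall>p<d. \<forall>q<d. M $$ (X * d + p, Y * d + q) = (if X = Y then B X p q else 0))"

text \<open>Numbers the tuples so that their projectors become the standard ones; this reduces
  states defined over tuples to block-diagonal matrices with plain indices.\<close>

definition tuple_enum :: "nat list \<Rightarrow> (nat \<Rightarrow> nat list) \<Rightarrow> bool" where
  "tuple_enum ks t \<longleftrightarrow> bij_betw t {..<prod_list ks} (tuples ks) \<and>
     (\<forall>X<prod_list ks. tuple_proj ks (t X) = basis_proj (prod_list ks) X)"

lemma cq_blocks_entry:
  "cq_blocks K d M B \<Longrightarrow> X < K \<Longrightarrow> Y < K \<Longrightarrow> p < d \<Longrightarrow> q < d \<Longrightarrow>
    M $$ (X * d + p, Y * d + q) = (if X = Y then B X p q else 0)"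
  by (simp add: cq_blocks_def)

lemma trp_cq:
  assumes "cq_blocks K d M B"
  shows "trp (K * d) T (ent M) = (\<Sum>X<K. trp d (\<lambda>p q. T (X * d + p) (X * d + q)) (B X))"
proof -
  have "trp (K * d) T (ent M) = (\<Sum>X<K. \<Sum>Y<K. if X = Y then trp d (\<lambda>p q. T (X * d + p) (X * d + q)) (B X) else 0)"
    unfolding trp_split
    by (intro sum.cong refl) (auto simp: trp_def cq_blocks_entry[OF assms] intro!: sum.cong sum.neutral)
  then show ?thesis by simp
qed

lemma psd_cq:
  assumes "cq_blocks K d M B" "\<And>X. X < K \<Longrightarrow> pos d (B X)"
  shows "psd (K * d) M"
  unfolding psd_iff_pos
proof
  show "M \<in> carrier_mat (K * d) (K * d)" using assms(1) by (simp add: cq_blocks_def)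
  show "pos (K * d) (ent M)"
    by (rule pos_block_diag[OF assms(2)]) (use cq_blocks_entry[OF assms(1)] in auto)
qed

lemma density_cq:
  assumes "cq_blocks K d M B" "\<And>X. X < K \<Longrightarrow> pos d (B X)" "(\<Sum>X<K. trp d idk (B X)) = 1"
  shows "density (K * d) M"
proof -
  have M: "M \<in> carrier_mat (K * d) (K * d)" using assms(1) by (simp add: cq_blocks_def)
  have "tr M = trp (K * d) idk (ent M)" using tr_carrier[OF M] by (simp add: trp_idk)
  also have "\<dots> = (\<Sum>X<K. trp d idk (B X))"
    unfolding trp_cq[OF assms(1)] by (intro sum.cong refl trp_cong) (auto simp: idk_def)
  finally show ?thesis using assms psd_cq[OF assms(1,2)] by (simp add: density_def)
qed

lemma kron_entry:
  assumes "A \<in> carrier_mat a a" "B \<in> carrier_mat b b" "i < a" "j < a" "p < b" "q < b"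
  shows "(A \<otimes>\<^sub>m B) $$ (i * b + p, j * b + q) = A $$ (i, j) * B $$ (p, q)"
  using assms mult_add_less[of i a p b] mult_add_less[of j a q b] by (simp add: kron_def)

lemma kron_carrier:
  "A \<in> carrier_mat a a \<Longrightarrow> B \<in> carrier_mat b b \<Longrightarrow> A \<otimes>\<^sub>m B \<in> carrier_mat (a * b) (a * b)"
  by (simp add: kron_def)

lemma basis_proj_carrier: "basis_proj k x \<in> carrier_mat k k"
  by (simp add: basis_proj_def)

lemma kron_one: "A \<in> carrier_mat n n \<Longrightarrow> A \<otimes>\<^sub>m 1\<^sub>m (Suc 0) = A"
  by (rule eq_matI) (auto simp: kron_def)

lemma tuple_enum_single: "tuple_enum [k] (\<lambda>x. [x])"
  unfolding tuple_enum_def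
proof (intro conjI allI impI)
  show "bij_betw (\<lambda>x. [x]) {..<prod_list [k]} (tuples [k])"
    by (auto simp: bij_betw_def inj_on_def tuples_def set_Cons_def)
  show "tuple_proj [k] [X] = basis_proj (prod_list [k]) X" for X
    by (simp add: tuple_proj_def kron_one[OF basis_proj_carrier])
qed

lemma tuple_enum_pair:
  assumes "0 < k2"
  shows "tuple_enum [k1, k2] (\<lambda>X. [X div k2, X mod k2])"
  unfolding tuple_enum_def
proof (intro conjI allI impI)
  show "bij_betw (\<lambda>X. [X div k2, X mod k2]) {..<prod_list [k1, k2]} (tuples [k1, k2])"
    unfolding bij_betw_def
  proof
    show "inj_on (\<lambda>X. [X div k2, X mod k2]) {..<prod_list [k1, k2]}"
      by (auto simp: inj_on_def) (metis div_mult_mod_eq)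
    show "(\<lambda>X. [X div k2, X mod k2]) ` {..<prod_list [k1, k2]} = tuples [k1, k2]"
    proof (intro equalityI subsetI)
      fix x assume "x \<in> tuples [k1, k2]"
      then obtain x1 x2 where x: "x = [x1, x2]" "x1 < k1" "x2 < k2"
        by (auto simp: tuples_def set_Cons_def)
      then show "x \<in> (\<lambda>X. [X div k2, X mod k2]) ` {..<prod_list [k1, k2]}"
        by (intro image_eqI[of _ _ "x1 * k2 + x2"]) (auto intro: mult_add_less)
    qed (use assms in \<open>auto simp: tuples_def set_Cons_def div_less_mult\<close>)
  qed
  fix X assume "X < prod_list [k1, k2]"
  then have X: "X < k1 * k2" by simp
  have eq: "i div k2 = X div k2 \<and> i mod k2 = X mod k2 \<longleftrightarrow> i = X" for i
    by (metis div_mult_mod_eq)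
  have "tuple_proj [k1, k2] [X div k2, X mod k2] = basis_proj k1 (X div k2) \<otimes>\<^sub>m basis_proj k2 (X mod k2)"
    by (simp add: tuple_proj_def kron_one[OF kron_carrier[OF basis_proj_carrier basis_proj_carrier]]
        kron_one[OF basis_proj_carrier])
  also have "\<dots> = basis_proj (k1 * k2) X"
  proof (rule eq_matI)
    fix i j assume "i < dim_row (basis_proj (k1 * k2) X)" "j < dim_col (basis_proj (k1 * k2) X)"
    then have ij: "i < k1 * k2" "j < k1 * k2" by (auto simp: basis_proj_def)
    then show "(basis_proj k1 (X div k2) \<otimes>\<^sub>m basis_proj k2 (X mod k2)) $$ (i, j) = basis_proj (k1 * k2) X $$ (i, j)"
      using div_less_mult[OF ij(1)] div_less_mult[OF ij(2)] assms eq[of i] eq[of j]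
      by (auto simp: kron_def basis_proj_def)
  qed (simp_all add: kron_def basis_proj_def)
  finally show "tuple_proj [k1, k2] [X div k2, X mod k2] = basis_proj (prod_list [k1, k2]) X" by simp
qed

lemma cq_state_blocks:
  assumes t: "tuple_enum ks t" and c: "\<And>x. x \<in> tuples ks \<Longrightarrow> \<rho> x \<in> carrier_mat d d"
  shows "cq_blocks (prod_list ks) d (cq_state ks d p \<rho>) (\<lambda>X u v. complex_of_real (p (t X)) * \<rho> (t X) $$ (u, v))"
  unfolding cq_blocks_def
proof (intro conjI allI impI)
  let ?K = "prod_list ks"
  show "cq_state ks d p \<rho> \<in> carrier_mat (?K * d) (?K * d)"
    by (simp add: cq_state_def msum_def)
  fix X Y u v assume XY: "X < ?K" "Y < ?K" and uv: "u < d" "v < d"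
  have bij: "bij_betw t {..<?K} (tuples ks)" using t by (simp add: tuple_enum_def)
  have \<rho>: "\<rho> (t Z) \<in> carrier_mat d d" if "Z < ?K" for Z
    using that bij c by (auto simp: bij_betw_def)
  have proj: "tuple_proj ks (t Z) = basis_proj ?K Z" if "Z < ?K" for Z
    using that t by (simp add: tuple_enum_def)
  have "cq_state ks d p \<rho> $$ (X * d + u, Y * d + v) =
     (\<Sum>x\<in>tuples ks. (complex_of_real (p x) \<cdot>\<^sub>m (tuple_proj ks x \<otimes>\<^sub>m \<rho> x)) $$ (X * d + u, Y * d + v))"
    using mult_add_less[OF XY(1) uv(1)] mult_add_less[OF XY(2) uv(2)]
    by (simp add: cq_state_def msum_def)
  also have "\<dots> = (\<Sum>Z<?K. (complex_of_real (p (t Z)) \<cdot>\<^sub>m (tuple_proj ks (t Z) \<otimes>\<^sub>m \<rho> (t Z))) $$ (X * d + u, Y * d + v))"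
    by (rule sum.reindex_bij_betw[OF bij, symmetric])
  also have "\<dots> = (\<Sum>Z<?K. if Z = X then (if X = Y then complex_of_real (p (t X)) * \<rho> (t X) $$ (u, v) else 0) else 0)"
  proof (intro sum.cong refl)
    fix Z assume "Z \<in> {..<?K}"
    then have Z: "Z < ?K" by simp
    note kc = kron_carrier[OF basis_proj_carrier \<rho>[OF Z], of ?K Z]
    have "(complex_of_real (p (t Z)) \<cdot>\<^sub>m (tuple_proj ks (t Z) \<otimes>\<^sub>m \<rho> (t Z))) $$ (X * d + u, Y * d + v)
      = complex_of_real (p (t Z)) * (basis_proj ?K Z $$ (X, Y) * \<rho> (t Z) $$ (u, v))"
      using mult_add_less[OF XY(1) uv(1)] mult_add_less[OF XY(2) uv(2)] kc
        kron_entry[OF basis_proj_carrier \<rho>[OF Z] XY uv, of Z]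
      by (simp add: proj[OF Z])
    then show "(complex_of_real (p (t Z)) \<cdot>\<^sub>m (tuple_proj ks (t Z) \<otimes>\<^sub>m \<rho> (t Z))) $$ (X * d + u, Y * d + v)
      = (if Z = X then (if X = Y then complex_of_real (p (t X)) * \<rho> (t X) $$ (u, v) else 0) else 0)"
      using XY by (auto simp: basis_proj_def)
  qed
  also have "\<dots> = (if X = Y then complex_of_real (p (t X)) * \<rho> (t X) $$ (u, v) else 0)"
    using XY by simp
  finally show "cq_state ks d p \<rho> $$ (X * d + u, Y * d + v) =
    (if X = Y then complex_of_real (p (t X)) * \<rho> (t X) $$ (u, v) else 0)" .
qed

lemma cq_block_entry:
  assumes t: "tuple_enum ks t" and M: "cq_blocks (prod_list ks) d M B"
    and Z: "Z < prod_list ks" and uv: "u < d" "v < d"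
  shows "cq_block ks d M (t Z) $$ (u, v) = B Z u v"
proof -
  let ?K = "prod_list ks"
  define P where "P = basis_proj ?K Z \<otimes>\<^sub>m (1\<^sub>m d :: complex mat)"
  have P: "P \<in> carrier_mat (?K * d) (?K * d)"
    unfolding P_def by (intro kron_carrier basis_proj_carrier) simp
  have Mc: "M \<in> carrier_mat (?K * d) (?K * d)" using M by (simp add: cq_blocks_def)
  have prod: "(P * M) $$ (X * d + u, X * d + v) = (if X = Z then B Z u v else 0)" if X: "X < ?K" for X
  proof -
    have "(P * M) $$ (X * d + u, X * d + v) = (\<Sum>i<?K * d. P $$ (X * d + u, i) * M $$ (i, X * d + v))"
      using P Mc mult_add_less[OF X uv(1)] mult_add_less[OF X uv(2)]
      by (simp add: scalar_prod_def atLeast0LessThan)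
    also have "\<dots> = (\<Sum>Y<?K. \<Sum>r<d. if r = u then (if Y = X then (if X = Z then B Z u v else 0) else 0) else 0)"
      unfolding sum_lessThan_mult
    proof (intro sum.cong refl)
      fix Y r assume "Y \<in> {..<?K}" "r \<in> {..<d}"
      then have Yr: "Y < ?K" "r < d" by auto
      have "P $$ (X * d + u, Y * d + r) = (if X = Z \<and> Y = Z \<and> r = u then 1 else 0)"
        unfolding P_def
        using kron_entry[OF basis_proj_carrier one_carrier_mat X Yr(1) uv(1) Yr(2), of Z] X Yr uv
        by (auto simp: basis_proj_def)
      then show "P $$ (X * d + u, Y * d + r) * M $$ (Y * d + r, X * d + v)
        = (if r = u then (if Y = X then (if X = Z then B Z u v else 0) else 0) else 0)"
        using cq_blocks_entry[OF M Yr(1) X Yr(2) uv(2)] by auto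
    qed
    also have "\<dots> = (if X = Z then B Z u v else 0)" using X uv by simp
    finally show ?thesis .
  qed
  have "cq_block ks d M (t Z) $$ (u, v) = tr (slice ?K d (P * M) 0 u 0 v)"
    using uv Z t by (simp add: cq_block_def ptrace_def P_def tuple_enum_def)
  also have "\<dots> = (\<Sum>X<?K. (P * M) $$ (X * d + u, X * d + v))"
    by (simp add: tr_carrier[OF slice_carrier]) (simp add: slice_def)
  also have "\<dots> = B Z u v" using Z by (simp add: prod)
  finally show ?thesis .
qed

lemma cq_block_carrier: "cq_block ks d M x \<in> carrier_mat d d"
  by (simp add: cq_block_def ptrace_def)

text \<open>Unit traces of the \<sigma> X make the probability extracted from the matrix equal to w
  X, and dividing it out again recovers \<sigma> X wherever w X is nonzero.\<close>

lemma cond_product_state_blocks: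
  assumes t: "tuple_enum ks t"
    and M: "cq_blocks (prod_list ks) d M (\<lambda>X u v. complex_of_real (w X) * \<sigma> X u v)"
    and tr1: "\<And>X. X < prod_list ks \<Longrightarrow> trp d idk (\<sigma> X) = 1"
  shows "cq_blocks (prod_list ks) d (cond_product_state ks d S M) (\<lambda>X u v. complex_of_real (w X) *
     (\<Sum>Y | Y < prod_list ks \<and> t Y \<in> agree_off ks S (t X).
        complex_of_real (w Y / (\<Sum>Z | Z < prod_list ks \<and> t Z \<in> agree_off ks S (t X). w Z)) * \<sigma> Y u v))"
proof -
  let ?K = "prod_list ks"
  define A where "A X = {Y. Y < ?K \<and> t Y \<in> agree_off ks S (t X)}" for X
  have bij: "bij_betw t {..<?K} (tuples ks)" using t by (simp add: tuple_enum_def)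
  have re: "sum f (agree_off ks S (t X)) = (\<Sum>Y\<in>A X. f (t Y))" for f :: "nat list \<Rightarrow> 'z::comm_monoid_add" and X
  proof -
    have "agree_off ks S (t X) = t ` A X"
      using bij by (auto simp: A_def agree_off_def bij_betw_def)
    moreover have "inj_on t (A X)" using bij by (auto simp: bij_betw_def A_def inj_on_def)
    ultimately show ?thesis by (simp add: sum.reindex)
  qed
  have prob: "cq_prob ks d M (t X) = w X" if "X < ?K" for X
  proof -
    have "tr (cq_block ks d M (t X)) = (\<Sum>u<d. complex_of_real (w X) * \<sigma> X u u)"
      using tr_carrier[OF cq_block_carrier] cq_block_entry[OF t M that] by simp
    also have "\<dots> = complex_of_real (w X)" using tr1[OF that] by (simp add: trp_idk flip: sum_distrib_left)
    finally show ?thesis by (simp add: cq_prob_def)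
  qed
  have off: "cq_cond_off ks d S M (t X) $$ (u, v) =
      (\<Sum>Y\<in>A X. complex_of_real (w Y / (\<Sum>Z\<in>A X. w Z)) * \<sigma> Y u v)"
    if uv: "u < d" "v < d" for X u v
  proof -
    have "cq_cond_off ks d S M (t X) $$ (u, v) = (\<Sum>Y\<in>A X.
        (complex_of_real (cq_prob ks d M (t Y) / (\<Sum>Z\<in>A X. cq_prob ks d M (t Z))) \<cdot>\<^sub>m cq_cond ks d M (t Y)) $$ (u, v))"
      using uv by (simp add: cq_cond_off_def msum_def re)
    also have "\<dots> = (\<Sum>Y\<in>A X. complex_of_real (w Y / (\<Sum>Z\<in>A X. w Z)) * \<sigma> Y u v)"
    proof (rule sum.cong[OF refl])
      fix Y assume "Y \<in> A X"
      then have Y: "Y < ?K" by (simp add: A_def)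
      have P: "(\<Sum>Z\<in>A X. cq_prob ks d M (t Z)) = (\<Sum>Z\<in>A X. w Z)"
        by (intro sum.cong refl prob) (simp add: A_def)
      have "cq_cond ks d M (t Y) $$ (u, v) = complex_of_real (1 / w Y) * (complex_of_real (w Y) * \<sigma> Y u v)"
        using cq_block_carrier[of ks d M "t Y"] uv
        by (simp add: cq_cond_def prob[OF Y] cq_block_entry[OF t M Y uv])
      moreover have "cq_cond ks d M (t Y) \<in> carrier_mat d d"
        using cq_block_carrier[of ks d M "t Y"] by (simp add: cq_cond_def)
      \<comment> \<open>If w Y = 0, the extracted conditional state is 0 instead of \<sigma> Y, but
        both sides carry the factor w Y.\<close>
      ultimately show "(complex_of_real (cq_prob ks d M (t Y) / (\<Sum>Z\<in>A X. cq_prob ks d M (t Z)))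
          \<cdot>\<^sub>m cq_cond ks d M (t Y)) $$ (u, v) = complex_of_real (w Y / (\<Sum>Z\<in>A X. w Z)) * \<sigma> Y u v"
        using uv by (simp add: P prob[OF Y])
    qed
    finally show ?thesis .
  qed
  have "cq_blocks ?K d (cond_product_state ks d S M)
     (\<lambda>X u v. complex_of_real (cq_prob ks d M (t X)) * cq_cond_off ks d S M (t X) $$ (u, v))"
    unfolding cond_product_state_def
    by (rule cq_state_blocks[OF t]) (simp add: cq_cond_off_def msum_def)
  then show ?thesis by (simp add: cq_blocks_def prob off A_def)
qed

section \<open>Reduced states of the channel state and their conditional products\<close>

lemma ptrace_carrier: "ptrace a m c M \<in> carrier_mat (a * c) (a * c)"
  by (simp add: ptrace_def)

lemma ptrace_entry:
  assumes "i < a" "j < a" "u < c" "v < c"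
  shows "ptrace a m c M $$ (i * c + u, j * c + v) = (\<Sum>p<m. M $$ ((i * m + p) * c + u, (j * m + p) * c + v))"
proof -
  have "ptrace a m c M $$ (i * c + u, j * c + v) = tr (slice m c M i u j v)"
    using assms mult_add_less[of i a u c] mult_add_less[of j a v c] by (simp add: ptrace_def)
  then show ?thesis by (simp add: tr_carrier[OF slice_carrier]) (simp add: slice_def)
qed

lemma cq_blocks_ptrace_first:
  assumes M: "cq_blocks (k1 * k2) (d2 * d3) M B"
  shows "cq_blocks k2 d3 (ptrace k2 d2 d3 (ptrace 1 k1 (k2 * d2 * d3) M))
    (\<lambda>x u v. \<Sum>x1<k1. ptrace_left d2 d3 (B (x1 * k2 + x)) u v)"
  unfolding cq_blocks_def
proof (intro conjI ptrace_carrier allI impI)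
  fix x y u v assume xy: "x < k2" "y < k2" and uv: "u < d3" "v < d3"
  let ?M = "ptrace 1 k1 (k2 * d2 * d3) M"
  have idx: "x1 * (k2 * d2 * d3) + ((x * d2 + p) * d3 + u) = (x1 * k2 + x) * (d2 * d3) + (p * d3 + u)" for x1 x p u :: nat
    by (simp add: algebra_simps)
  have "?M $$ ((x * d2 + p) * d3 + u, (y * d2 + p) * d3 + v) =
      (\<Sum>x1<k1. if x = y then B (x1 * k2 + x) (p * d3 + u) (p * d3 + v) else 0)" if p: "p < d2" for p
  proof -
    have lt: "(x * d2 + p) * d3 + u < k2 * d2 * d3" "(y * d2 + p) * d3 + v < k2 * d2 * d3"
      using xy uv p by (auto intro!: mult_add_less)
    have "?M $$ ((x * d2 + p) * d3 + u, (y * d2 + p) * d3 + v) =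
      (\<Sum>x1<k1. M $$ (x1 * (k2 * d2 * d3) + ((x * d2 + p) * d3 + u), x1 * (k2 * d2 * d3) + ((y * d2 + p) * d3 + v)))"
      using ptrace_entry[of 0 1 0 "(x * d2 + p) * d3 + u" "k2 * d2 * d3" "(y * d2 + p) * d3 + v" k1 M] lt by simp
    also have "\<dots> = (\<Sum>x1<k1. if x = y then B (x1 * k2 + x) (p * d3 + u) (p * d3 + v) else 0)"
      unfolding idx
      by (intro sum.cong refl, subst cq_blocks_entry[OF M])
         (use xy uv p in \<open>auto intro!: mult_add_less\<close>)
    finally show ?thesis .
  qed
  then have "ptrace k2 d2 d3 ?M $$ (x * d3 + u, y * d3 + v) =
      (\<Sum>p<d2. \<Sum>x1<k1. if x = y then B (x1 * k2 + x) (p * d3 + u) (p * d3 + v) else 0)"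
    by (simp add: ptrace_entry[OF xy uv])
  then show "ptrace k2 d2 d3 ?M $$ (x * d3 + u, y * d3 + v) =
      (if x = y then \<Sum>x1<k1. ptrace_left d2 d3 (B (x1 * k2 + x)) u v else 0)"
    by (simp add: ptrace_left_def sum.swap[of _ "{..<k1}"])
qed

lemma cq_blocks_ptrace_last:
  assumes M: "cq_blocks K (d2 * d3) M B"
  shows "cq_blocks K d2 (ptrace (K * d2) d3 1 M) (\<lambda>X. ptrace_right d3 (B X))"
  unfolding cq_blocks_def
proof (intro conjI allI impI)
  show "ptrace (K * d2) d3 1 M \<in> carrier_mat (K * d2) (K * d2)"
    using ptrace_carrier[of "K * d2" d3 1 M] by simp
  fix X Y p q assume XY: "X < K" "Y < K" and pq: "p < d2" "q < d2"
  have idx: "(X * d2 + p) * d3 + u = X * (d2 * d3) + (p * d3 + u)" for X p u :: nat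
    by (simp add: algebra_simps)
  have "ptrace (K * d2) d3 1 M $$ (X * d2 + p, Y * d2 + q) =
      (\<Sum>u<d3. M $$ ((X * d2 + p) * d3 + u, (Y * d2 + q) * d3 + u))"
    using ptrace_entry[of "X * d2 + p" "K * d2" "Y * d2 + q" 0 1 0 d3 M] XY pq
    by (simp add: mult_add_less)
  also have "\<dots> = (\<Sum>u<d3. if X = Y then B X (p * d3 + u) (q * d3 + u) else 0)"
    unfolding idx
    by (intro sum.cong refl, subst cq_blocks_entry[OF M]) (use XY pq in \<open>auto intro!: mult_add_less\<close>)
  finally show "ptrace (K * d2) d3 1 M $$ (X * d2 + p, Y * d2 + q) =
      (if X = Y then ptrace_right d3 (B X) p q else 0)"
    by (simp add: ptrace_right_def)
qed

lemma cq_blocks_cong: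
  assumes "cq_blocks K d M B" "\<And>X p q. X < K \<Longrightarrow> p < d \<Longrightarrow> q < d \<Longrightarrow> B X p q = B' X p q"
  shows "cq_blocks K d M B'"
  using assms by (simp add: cq_blocks_def)

lemma pos_scale: "0 \<le> r \<Longrightarrow> pos n A \<Longrightarrow> pos n (\<lambda>i j. complex_of_real r * A i j)"
proof -
  assume "0 \<le> r" "pos n A"
  moreover have "sesq n (\<lambda>i j. complex_of_real r * A i j) f f = complex_of_real r * sesq n A f f" for f
    by (simp add: sesq_def sum_distrib_left mult_ac)
  ultimately show ?thesis by (simp add: pos_def less_eq_complex_def)
qed

lemma cond_product_state_single:
  assumes M: "cq_blocks k d M (\<lambda>x u v. complex_of_real (p x) * \<sigma> x u v)"
    and tr1: "\<And>x. x < k \<Longrightarrow> trp d idk (\<sigma> x) = 1" and p: "prob_dist k p"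
  shows "cq_blocks k d (cond_product_state [k] d {0} M)
    (\<lambda>x u v. complex_of_real (p x) * (\<Sum>y<k. complex_of_real (p y) * \<sigma> y u v))"
proof -
  have "{Y. Y < k \<and> [Y] \<in> agree_off [k] {0} [X]} = {..<k}" for X
    by (auto simp: agree_off_def tuples_def set_Cons_def)
  then show ?thesis
    using cond_product_state_blocks[OF tuple_enum_single[of k], of d M p \<sigma> "{0}"] M tr1 p
    by (simp add: prob_dist_def del: of_real_divide of_real_sum)
qed

text \<open>Averaging over the first letter with the second fixed: the weights p1 y p2 x / p2 x
  reduce to p1 y.\<close>

lemma cond_product_state_pair:
  assumes k2: "0 < k2"
    and M: "cq_blocks (k1 * k2) d M (\<lambda>X u v. complex_of_real (p1 (X div k2) * p2 (X mod k2)) * \<sigma> (X div k2) (X mod k2) u v)"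
    and tr1: "\<And>x1 x2. x1 < k1 \<Longrightarrow> x2 < k2 \<Longrightarrow> trp d idk (\<sigma> x1 x2) = 1"
    and p1: "prob_dist k1 p1"
  shows "cq_blocks (k1 * k2) d (cond_product_state [k1, k2] d {0} M)
    (\<lambda>X u v. complex_of_real (p1 (X div k2) * p2 (X mod k2)) *
       (\<Sum>y<k1. complex_of_real (p1 y) * \<sigma> y (X mod k2) u v))"
proof -
  have A: "{Y. Y < k1 * k2 \<and> [Y div k2, Y mod k2] \<in> agree_off [k1, k2] {0} [X div k2, X mod k2]}
      = (\<lambda>y. y * k2 + X mod k2) ` {..<k1}" for X
  proof (intro equalityI subsetI)
    fix Y assume "Y \<in> {Y. Y < k1 * k2 \<and> [Y div k2, Y mod k2] \<in> agree_off [k1, k2] {0} [X div k2, X mod k2]}"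
    then have Y: "Y < k1 * k2" and "[Y div k2, Y mod k2] ! 1 = [X div k2, X mod k2] ! 1"
      by (auto simp: agree_off_def)
    then have "Y = (Y div k2) * k2 + X mod k2" by simp (metis div_mult_mod_eq)
    then show "Y \<in> (\<lambda>y. y * k2 + X mod k2) ` {..<k1}" using div_less_mult[OF Y] by blast
  next
    fix Y assume "Y \<in> (\<lambda>y. y * k2 + X mod k2) ` {..<k1}"
    then obtain y where "Y = y * k2 + X mod k2" "y < k1" by blast
    then show "Y \<in> {Y. Y < k1 * k2 \<and> [Y div k2, Y mod k2] \<in> agree_off [k1, k2] {0} [X div k2, X mod k2]}"
      using k2 by (auto simp: agree_off_def tuples_def set_Cons_def less_Suc_eq intro: mult_add_less)
  qed
  have sumA: "sum f ((\<lambda>y. y * k2 + X mod k2) ` {..<k1}) = (\<Sum>y<k1. f (y * k2 + X mod k2))"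
    for f :: "nat \<Rightarrow> 'z::comm_monoid_add" and X
    using k2 by (subst sum.reindex) (auto simp: inj_on_def)
  have w: "(\<Sum>y<k1. p1 y * p2 x) = p2 x" for x
    using p1 by (simp add: prob_dist_def flip: sum_distrib_right)
  have "prod_list [k1, k2] = k1 * k2" by simp
  note blocks = cond_product_state_blocks[OF tuple_enum_pair[OF k2, of k1], unfolded this, OF M, of "{0}"]
  show ?thesis
  proof (rule cq_blocks_cong[OF blocks])
    show "trp d idk (\<sigma> (X div k2) (X mod k2)) = 1" if "X < k1 * k2" for X
      using tr1 div_less_mult[OF that] k2 by simp
  next
    fix X u v
    show "complex_of_real (p1 (X div k2) * p2 (X mod k2)) *
       (\<Sum>Y | Y < k1 * k2 \<and> [Y div k2, Y mod k2] \<in> agree_off [k1, k2] {0} [X div k2, X mod k2].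
          complex_of_real (p1 (Y div k2) * p2 (Y mod k2) /
            (\<Sum>Z | Z < k1 * k2 \<and> [Z div k2, Z mod k2] \<in> agree_off [k1, k2] {0} [X div k2, X mod k2].
              p1 (Z div k2) * p2 (Z mod k2))) * \<sigma> (Y div k2) (Y mod k2) u v)
      = complex_of_real (p1 (X div k2) * p2 (X mod k2)) *
       (\<Sum>y<k1. complex_of_real (p1 y) * \<sigma> y (X mod k2) u v)"
      \<comment> \<open>If p2 vanishes here the quotient is a default 0, but the outer factor then
        annihilates both sides.\<close>
      unfolding A sumA using k2 by (cases "p2 (X mod k2) = 0") (simp_all add: w)
  qed
qed

theorem proposition5:
  fixes N :: relay_channel and p1 p2 :: "nat \<Rightarrow> real" and R \<epsilon> \<delta> :: real and b :: nat
    and \<rho> \<rho>_X2B3 \<rho>_X1X2B2 :: "complex mat"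
  assumes "cq_relay_channel N"
    and "prob_dist (nX1 N) p1" and "prob_dist (nX2 N) p2"
    and "\<rho> = cq_state [nX1 N, nX2 N] (dB2 N * dB3 N)
               (\<lambda>x. p1 (x ! 0) * p2 (x ! 1)) (\<lambda>x. out N (x ! 0) (x ! 1))"
    and "\<rho>_X2B3 = ptrace (nX2 N) (dB2 N) (dB3 N) (ptrace 1 (nX1 N) (nX2 N * dB2 N * dB3 N) \<rho>)"
    and "\<rho>_X1X2B2 = ptrace (nX1 N * nX2 N * dB2 N) (dB3 N) 1 \<rho>"
    and "0 \<le> R" and "0 < \<epsilon>" and "\<epsilon> < 1" and "1 \<le> b"
    and "\<delta> = real b * (f_univ 1 \<epsilon> + f_univ 2 \<epsilon>
          + 4 * exp2 (ereal R - hyp_test_rel_ent \<epsilon> \<rho>_X2B3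
                        (cond_product_state [nX2 N] (dB3 N) {0} \<rho>_X2B3))
          + 4 * exp2 (ereal R - hyp_test_rel_ent \<epsilon> \<rho>_X1X2B2
                        (cond_product_state [nX1 N, nX2 N] (dB2 N) {0} \<rho>_X1X2B2)))"
    and "\<delta> \<in> {0..1}"
  shows "achievable N ((real b - 1) / real b * R) b \<delta>"
proof -
  define k1 k2 d2 d3 where dims: "k1 = nX1 N" "k2 = nX2 N" "d2 = dB2 N" "d3 = dB3 N"
  note p1 = assms(2)[folded dims] and p2 = assms(3)[folded dims]
  have k2: "0 < k2" using assms(1) by (simp add: cq_relay_channel_def dims)
  have out: "density (d2 * d3) (out N x1 x2)" if "x1 < k1" "x2 < k2" for x1 x2
    using assms(1) that by (simp add: cq_relay_channel_def dims)
  define \<omega> where "\<omega> x1 x2 = ent (out N x1 x2)" for x1 x2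
  have \<omega>: "pos (d2 * d3) (\<omega> x1 x2)" "trp (d2 * d3) idk (\<omega> x1 x2) = 1" if "x1 < k1" "x2 < k2" for x1 x2
    using out[OF that] by (auto simp: \<omega>_def density_def psd_iff_pos trp_idk tr_carrier)
  define S2 where "S2 x1 x2 = ptrace_right d3 (\<omega> x1 x2)" for x1 x2
  define S3 where "S3 x1 x2 = ptrace_left d2 d3 (\<omega> x1 x2)" for x1 x2
  have S2: "pos d2 (S2 x1 x2)" "trp d2 idk (S2 x1 x2) = 1" if "x1 < k1" "x2 < k2" for x1 x2
    using \<omega>[OF that] pos_ptrace_right by (auto simp: S2_def trp_idk_ptrace)
  have S3: "pos d3 (S3 x1 x2)" "trp d3 idk (S3 x1 x2) = 1" if "x1 < k1" "x2 < k2" for x1 x2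
    using \<omega>[OF that] pos_ptrace_left by (auto simp: S3_def trp_idk_ptrace)
  \<comment> \<open>The receiver's test looks only at x2, so the sender's letter acts as noise and
    is averaged out.\<close>
  define A3 where "A3 x2 u v = (\<Sum>x1<k1. complex_of_real (p1 x1) * S3 x1 x2 u v)" for x2 u v
  have p1n: "0 \<le> p1 x" if "x < k1" for x using p1 that by (simp add: prob_dist_def)
  have p2n: "0 \<le> p2 x" if "x < k2" for x using p2 that by (simp add: prob_dist_def)
  have p1s: "(\<Sum>x<k1. p1 x) = 1" and p2s: "(\<Sum>x<k2. p2 x) = 1" using p1 p2 by (auto simp: prob_dist_def)
  have A3: "pos d3 (A3 x2)" "trp d3 idk (A3 x2) = 1" if "x2 < k2" for x2
  proof -
    show "pos d3 (A3 x2)"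
      unfolding A3_def using that by (intro pos_sum pos_scale S3 p1n) auto
    have "trp d3 idk (A3 x2) = (\<Sum>x1<k1. complex_of_real (p1 x1) * trp d3 idk (S3 x1 x2))"
      by (simp add: A3_def[abs_def] trp_sum_right trp_scale_right)
    also have "\<dots> = complex_of_real (\<Sum>x1<k1. p1 x1)" using S3 that by simp
    finally show "trp d3 idk (A3 x2) = 1" by (simp add: p1s)
  qed

  have \<rho>: "cq_blocks (k1 * k2) (d2 * d3) \<rho>
     (\<lambda>X u v. complex_of_real (p1 (X div k2) * p2 (X mod k2)) * \<omega> (X div k2) (X mod k2) u v)"
  proof -
    have "out N (x ! 0) (x ! 1) \<in> carrier_mat (d2 * d3) (d2 * d3)" if "x \<in> tuples [k1, k2]" for x
      using that out by (auto simp: tuples_def set_Cons_def density_def psd_def)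
    from cq_state_blocks[OF tuple_enum_pair[OF k2, of k1], where p = "\<lambda>x. p1 (x ! 0) * p2 (x ! 1)"
        and \<rho> = "\<lambda>x. out N (x ! 0) (x ! 1)", OF this]
    show ?thesis by (simp add: assms(4) dims[symmetric] \<omega>_def)
  qed
  have \<rho>3: "cq_blocks k2 d3 \<rho>_X2B3 (\<lambda>x u v. complex_of_real (p2 x) * A3 x u v)"
    unfolding assms(5) dims[symmetric]
    by (rule cq_blocks_cong[OF cq_blocks_ptrace_first[OF \<rho>]])
       (simp add: A3_def S3_def ptrace_left_def sum_distrib_left mult_ac)
  have \<rho>2: "cq_blocks (k1 * k2) d2 \<rho>_X1X2B2
     (\<lambda>X u v. complex_of_real (p1 (X div k2) * p2 (X mod k2)) * S2 (X div k2) (X mod k2) u v)"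
    unfolding assms(6) dims[symmetric]
    by (rule cq_blocks_cong[OF cq_blocks_ptrace_last[OF \<rho>]])
       (simp add: S2_def ptrace_right_def sum_distrib_left mult_ac)
  define \<sigma>3 where "\<sigma>3 = cond_product_state [k2] d3 {0} \<rho>_X2B3"
  define \<sigma>2 where "\<sigma>2 = cond_product_state [k1, k2] d2 {0} \<rho>_X1X2B2"
  have \<sigma>3: "cq_blocks k2 d3 \<sigma>3 (\<lambda>x u v. complex_of_real (p2 x) * (\<Sum>y<k2. complex_of_real (p2 y) * A3 y u v))"
    unfolding \<sigma>3_def by (rule cond_product_state_single[OF \<rho>3 A3(2) p2])
  have \<sigma>2: "cq_blocks (k1 * k2) d2 \<sigma>2 (\<lambda>X u v. complex_of_real (p1 (X div k2) * p2 (X mod k2)) *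
       (\<Sum>y<k1. complex_of_real (p1 y) * S2 y (X mod k2) u v))"
    unfolding \<sigma>2_def by (rule cond_product_state_pair[OF k2 \<rho>2 S2(2) p1])
  have w: "0 \<le> p1 (X div k2) * p2 (X mod k2)" if "X < k1 * k2" for X
    using p1n[OF div_less_mult[OF that]] p2n[of "X mod k2"] k2 by simp
  have dens3: "density (k2 * d3) \<rho>_X2B3"
    by (rule density_cq[OF \<rho>3 pos_scale[OF p2n A3(1)]])
       (simp_all add: trp_scale_right A3 p2s flip: of_real_sum)
  have dens2: "density (k1 * k2 * d2) \<rho>_X1X2B2"
  proof (rule density_cq[OF \<rho>2])
    show "pos d2 (\<lambda>u v. complex_of_real (p1 (X div k2) * p2 (X mod k2)) * S2 (X div k2) (X mod k2) u v)"
      if "X < k1 * k2" for X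
      using div_less_mult[OF that] k2 by (intro pos_scale S2 w that) auto
    have "(\<Sum>X<k1 * k2. trp d2 idk (\<lambda>u v. complex_of_real (p1 (X div k2) * p2 (X mod k2)) * S2 (X div k2) (X mod k2) u v))
      = complex_of_real (\<Sum>x1<k1. \<Sum>x2<k2. p1 x1 * p2 x2)"
      unfolding sum_lessThan_mult trp_scale_right by (simp add: S2)
    also have "\<dots> = 1" by (simp add: p1s p2s flip: sum_distrib_left sum_distrib_right)
    finally show "(\<Sum>X<k1 * k2. trp d2 idk (\<lambda>u v. complex_of_real (p1 (X div k2) * p2 (X mod k2)) * S2 (X div k2) (X mod k2) u v)) = 1" .
  qed
  have psd3: "psd (k2 * d3) \<sigma>3"
    by (rule psd_cq[OF \<sigma>3]) (intro pos_scale pos_sum p2n A3(1), auto)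
  have psd2: "psd (k1 * k2 * d2) \<sigma>2"
  proof (rule psd_cq[OF \<sigma>2])
    show "pos d2 (\<lambda>u v. complex_of_real (p1 (X div k2) * p2 (X mod k2)) *
       (\<Sum>y<k1. complex_of_real (p1 y) * S2 y (X mod k2) u v))" if "X < k1 * k2" for X
      using k2 by (intro pos_scale[OF w[OF that]] pos_sum pos_scale p1n S2) auto
  qed
  define e3 where "e3 = exp2 (ereal R - hyp_test_rel_ent \<epsilon> \<rho>_X2B3 \<sigma>3)"
  define e2 where "e2 = exp2 (ereal R - hyp_test_rel_ent \<epsilon> \<rho>_X1X2B2 \<sigma>2)"
  \<comment> \<open>The fact \<open>0 < \<epsilon>\<close> is passed twice: the slack of the test is
    \<epsilon> itself, to be paid for by \<open>f_univ\<close>.\<close>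
  obtain T3 where T3: "effect (k2 * d3) T3" "1 - \<epsilon> \<le> Re (trp (k2 * d3) T3 (ent \<rho>_X2B3))"
    "2 powr R * Re (trp (k2 * d3) T3 (ent \<sigma>3)) \<le> e3 + \<epsilon>"
    using near_optimal_test[OF dens3 psd3 assms(8,8), of R] unfolding e3_def by blast
  obtain T2 where T2: "effect (k1 * k2 * d2) T2" "1 - \<epsilon> \<le> Re (trp (k1 * k2 * d2) T2 (ent \<rho>_X1X2B2))"
    "2 powr R * Re (trp (k1 * k2 * d2) T2 (ent \<sigma>2)) \<le> e2 + \<epsilon>"
    using near_optimal_test[OF dens2 psd2 assms(8,8), of R] unfolding e2_def by blast
  \<comment> \<open>The states are block diagonal, so only the diagonal blocks of the tests
    contribute to their traces; these blocks are the tests for the single codewords.\<close>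
  define U3 where "U3 x p q = T3 (x * d3 + p) (x * d3 + q)" for x p q
  define U2 where "U2 x1 x2 p q = T2 ((x1 * k2 + x2) * d2 + p) ((x1 * k2 + x2) * d2 + q)" for x1 x2 p q
  have U3: "effect d3 (U3 x)" if "x < k2" for x
    unfolding U3_def by (rule effect_block[OF T3(1) that])
  have U2: "effect d2 (U2 x1 x2)" if "x1 < k1" "x2 < k2" for x1 x2
    unfolding U2_def by (rule effect_block[OF T2(1)]) (use that in \<open>simp add: mult_add_less\<close>)
  define t2 where "t2 y x1 x2 = Re (trp d2 (U2 y x2) (S2 x1 x2))" for y x1 x2
  define t3 where "t3 y x1 x2 = Re (trp d3 (U3 y) (S3 x1 x2))" for y x1 x2
  define \<beta>2 where "\<beta>2 = Re (trp (k1 * k2 * d2) T2 (ent \<sigma>2))"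
  define \<beta>3 where "\<beta>3 = Re (trp (k2 * d3) T3 (ent \<sigma>3))"
  have trA3: "Re (trp d3 (U3 y) (A3 x2)) = (\<Sum>x1<k1. p1 x1 * t3 y x1 x2)" for y x2
    by (simp add: A3_def[abs_def] trp_sum_right trp_scale_right t3_def)
  have good2: "1 - \<epsilon> \<le> (\<Sum>x1<k1. \<Sum>x2<k2. p1 x1 * p2 x2 * t2 x1 x1 x2)"
  proof -
    have "Re (trp (k1 * k2 * d2) T2 (ent \<rho>_X1X2B2)) = (\<Sum>x1<k1. \<Sum>x2<k2. p1 x1 * p2 x2 * t2 x1 x1 x2)"
      unfolding trp_cq[OF \<rho>2] sum_lessThan_mult trp_scale_right
      by (simp add: t2_def U2_def[abs_def])
    then show ?thesis using T2(2) by simp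
  qed
  have good3: "1 - \<epsilon> \<le> (\<Sum>x1<k1. \<Sum>x2<k2. p1 x1 * p2 x2 * t3 x2 x1 x2)"
  proof -
    have "Re (trp (k2 * d3) T3 (ent \<rho>_X2B3)) = (\<Sum>x2<k2. p2 x2 * (\<Sum>x1<k1. p1 x1 * t3 x2 x1 x2))"
      unfolding trp_cq[OF \<rho>3] trp_scale_right
      by (simp add: trA3[symmetric] U3_def[abs_def])
    also have "\<dots> = (\<Sum>x1<k1. \<Sum>x2<k2. p1 x1 * p2 x2 * t3 x2 x1 x2)"
      unfolding sum_distrib_left by (subst sum.swap) (simp add: mult_ac)
    finally show ?thesis using T3(2) by simp
  qed
  \<comment> \<open>In \<sigma>2 the classical letter y is what the test checks, while the output
    comes from an independent x1 and the same x2: exactly the situation of a wrong codeword at the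
    relay.\<close>
  have beta2: "(\<Sum>y<k1. \<Sum>x1<k1. \<Sum>x2<k2. p1 y * p1 x1 * p2 x2 * t2 y x1 x2) = \<beta>2"
  proof -
    have "\<beta>2 = (\<Sum>y<k1. \<Sum>x2<k2. p1 y * p2 x2 * (\<Sum>x1<k1. p1 x1 * t2 y x1 x2))"
      unfolding \<beta>2_def trp_cq[OF \<sigma>2] sum_lessThan_mult trp_scale_right
      by (simp add: t2_def U2_def[abs_def] trp_sum_right trp_scale_right)
    also have "\<dots> = (\<Sum>y<k1. \<Sum>x2<k2. \<Sum>x1<k1. p1 y * p1 x1 * p2 x2 * t2 y x1 x2)"
      by (simp add: sum_distrib_left mult_ac)
    also have "\<dots> = (\<Sum>y<k1. \<Sum>x1<k1. \<Sum>x2<k2. p1 y * p1 x1 * p2 x2 * t2 y x1 x2)"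
      by (rule sum.cong[OF refl]) (rule sum.swap)
    finally show ?thesis by simp
  qed
  have beta3: "(\<Sum>x1<k1. \<Sum>y<k2. \<Sum>x2<k2. p1 x1 * p2 y * p2 x2 * t3 y x1 x2) = \<beta>3"
  proof -
    have "\<beta>3 = (\<Sum>y<k2. p2 y * (\<Sum>x2<k2. p2 x2 * (\<Sum>x1<k1. p1 x1 * t3 y x1 x2)))"
      unfolding \<beta>3_def trp_cq[OF \<sigma>3] trp_scale_right trp_sum_right
      by (simp add: trA3[symmetric] U3_def[abs_def])
    also have "\<dots> = (\<Sum>y<k2. \<Sum>x2<k2. \<Sum>x1<k1. p1 x1 * p2 y * p2 x2 * t3 y x1 x2)"
      by (simp add: sum_distrib_left mult_ac)
    also have "\<dots> = (\<Sum>x1<k1. \<Sum>y<k2. \<Sum>x2<k2. p1 x1 * p2 y * p2 x2 * t3 y x1 x2)"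
      by (rule sum_rotate3)
    finally show ?thesis by simp
  qed
  have \<beta>n: "0 \<le> \<beta>2" "0 \<le> \<beta>3"
    using trp_nonneg[of "k1 * k2 * d2" T2 "ent \<sigma>2"] trp_nonneg[of "k2 * d3" T3 "ent \<sigma>3"] T2(1) T3(1) psd2 psd3
    by (auto simp: \<beta>2_def \<beta>3_def effect_def psd_iff_pos less_eq_complex_def)

  \<comment> \<open>Rounding up serves both needs: L \<ge> 2^R for the rate, and L - 1 \<le> 2^R for
    the competing codewords.\<close>
  define L where "L = nat \<lceil>2 powr R\<rceil>"
  have L1: "2 powr R \<le> real L" and L2: "real L - 1 \<le> 2 powr R"
    using ceiling_correct[of "2 powr R"] by (auto simp: L_def)
  have "1 \<le> 2 powr R" using assms(7) by (simp add: ge_one_powr_ge_zero)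
  then have L0: "0 < L" using L1 by (cases L) auto
  \<comment> \<open>One index q per message and block, so that the average error over messages is
    among the quantities bounded by the one choice of codebooks.\<close>
  define Q where "Q = {..<L ^ (b - 1)} \<times> {1..b}"
  define \<alpha> where "\<alpha> q = digit L (fst q) (snd q - 1)" for q :: "nat \<times> nat"
  define \<alpha>' where "\<alpha>' q = digit L (fst q) (snd q)" for q :: "nat \<times> nat"
  have "\<alpha> q < L" "\<alpha>' q < L" for q using digit_less[OF L0] by (auto simp: \<alpha>_def \<alpha>'_def)
  from random_codebooks[where Q = Q and \<alpha> = \<alpha> and \<alpha>' = \<alpha>',
      OF p1 p2 good2 good3 beta2 beta3 \<beta>n this]
  obtain c1 c2 where c: "c1 \<in> codebooks L k1" "c2 \<in> codebooks L k2" and bound: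
    "(\<Sum>q\<in>Q. 4 * ((\<Sum>i<\<alpha>' q. t2 (c1 i) (c1 (\<alpha>' q)) (c2 (\<alpha> q))) + 1 - t2 (c1 (\<alpha>' q)) (c1 (\<alpha>' q)) (c2 (\<alpha> q)))
       + 4 * ((\<Sum>i<\<alpha> q. t3 (c2 i) (c1 (\<alpha>' q)) (c2 (\<alpha> q))) + 1 - t3 (c2 (\<alpha> q)) (c1 (\<alpha>' q)) (c2 (\<alpha> q))))
    \<le> real (card Q) * (8 * \<epsilon> + 4 * real (L - 1) * (\<beta>2 + \<beta>3))"
    by blast
  have c1: "c1 i < k1" and c2: "c2 i < k2" if "i < L" for i
    using c codebooks_less that by blast+
  have "\<exists>\<Lambda>. decoder_for L d2 (\<lambda>i. U2 (c1 i) (c2 a)) \<Lambda>" if "a < L" for a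
    by (rule sequential_decoder[OF L0 U2[OF c1 c2[OF that]]])
  then obtain \<Lambda> where \<Lambda>: "\<And>a. a < L \<Longrightarrow> decoder_for L d2 (\<lambda>i. U2 (c1 i) (c2 a)) (\<Lambda> a)"
    by metis
  have "\<exists>\<Gamma>. decoder_for L d3 (\<lambda>i. U3 (c2 i)) \<Gamma>"
    by (rule sequential_decoder[OF L0 U3[OF c2]])
  then obtain \<Gamma> where \<Gamma>: "decoder_for L d3 (\<lambda>i. U3 (c2 i)) \<Gamma>" by blast
  interpret relay_scheme N L c1 c2 \<Lambda> \<Gamma>
    by unfold_locales (use assms(1) L0 c1 c2 \<Lambda> \<Gamma> in \<open>auto simp: dims decoder_for_def\<close>)
  have block: "block_error a a' \<le>
      4 * ((\<Sum>i<a'. t2 (c1 i) (c1 a') (c2 a)) + 1 - t2 (c1 a') (c1 a') (c2 a))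
       + 4 * ((\<Sum>i<a. t3 (c2 i) (c1 a') (c2 a)) + 1 - t3 (c2 a) (c1 a') (c2 a))"
    if a: "a < L" "a' < L" for a a'
  proof -
    note x = c1[OF a(2)] c2[OF a(1)]
    have "1 - Re (trp d2 (\<Lambda> a a') (S2 (c1 a') (c2 a)))
        \<le> 4 * ((\<Sum>i<a'. t2 (c1 i) (c1 a') (c2 a)) + 1 - t2 (c1 a') (c1 a') (c2 a))"
      using \<Lambda>[OF a(1)] a(2) S2[OF x] unfolding decoder_for_def t2_def by force
    moreover have "1 - Re (trp d3 (\<Gamma> a) (S3 (c1 a') (c2 a)))
        \<le> 4 * ((\<Sum>i<a. t3 (c2 i) (c1 a') (c2 a)) + 1 - t3 (c2 a) (c1 a') (c2 a))"
      using \<Gamma> a(1) S3[OF x] unfolding decoder_for_def t3_def by force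
    ultimately show ?thesis
      unfolding block_error_def S2_def S3_def \<omega>_def dims by (rule add_mono)
  qed
  have err: "error_prob N b (code b) \<le> real b * (8 * \<epsilon> + 4 * real (L - 1) * (\<beta>2 + \<beta>3))"
  proof -
    have "(\<Sum>m<L ^ (b - 1). \<Sum>j=1..b. block_error (digit L m (j - 1)) (digit L m j))
      = (\<Sum>q\<in>Q. block_error (\<alpha> q) (\<alpha>' q))"
      by (simp add: Q_def \<alpha>_def \<alpha>'_def sum.cartesian_product case_prod_beta)
    also have "\<dots> \<le> real (card Q) * (8 * \<epsilon> + 4 * real (L - 1) * (\<beta>2 + \<beta>3))"
      by (rule order.trans[OF sum_mono bound]) (intro block, auto simp: \<alpha>_def \<alpha>'_def digit_less[OF L0])
    also have "real (card Q) = real (L ^ (b - 1)) * real b" by (simp add: Q_def)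
    finally have "1 / real (L ^ (b - 1)) * (\<Sum>m<L ^ (b - 1). \<Sum>j=1..b. block_error (digit L m (j - 1)) (digit L m j))
      \<le> 1 / real (L ^ (b - 1)) * (real (L ^ (b - 1)) * real b * (8 * \<epsilon> + 4 * real (L - 1) * (\<beta>2 + \<beta>3)))"
      by (rule mult_left_mono) simp
    also have "\<dots> = real b * (8 * \<epsilon> + 4 * real (L - 1) * (\<beta>2 + \<beta>3))"
      using L0 by (simp only: mult.assoc[symmetric]) simp
    finally show ?thesis using error_prob_le[OF assms(10)] by (rule order.trans[rotated])
  qed
  \<comment> \<open>The exact rate of L^(b-1) messages in b rounds; one round is lost because the
    receiver lags a block behind.\<close>
  define R' where "R' = (real b - 1) / real b * log 2 (real L)"
  have rate: "(real b - 1) / real b * R \<le> R'"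
  proof -
    have "R \<le> log 2 (real L)" using L0 L1 by (simp add: le_log_iff)
    then show ?thesis unfolding R'_def using assms(10) by (intro mult_left_mono) auto
  qed
  have "real (L ^ (b - 1)) = 2 powr (real b * R')"
  proof -
    have "real b * R' = real (b - 1) * log 2 (real L)" using assms(10) by (simp add: R'_def of_nat_diff)
    then have "2 powr (real b * R') = (2 powr log 2 (real L)) powr real (b - 1)"
      by (simp only: powr_powr mult.commute)
    also have "\<dots> = real (L ^ (b - 1))" using L0 by (simp add: powr_realpow)
    finally show ?thesis by simp
  qed
  then have code: "is_relay_code N b R' (code b)" by (rule is_relay_code[OF assms(10)])
  have "error_prob N b (code b) \<le> \<delta>"
  proof -
    have eps: "\<epsilon> \<le> \<epsilon> powr (1 / 3)" using powr_mono'[of "1 / 3" 1 \<epsilon>] assms(8,9) by simp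
    \<comment> \<open>8 \<epsilon> come from missed correct codewords and 4 \<epsilon> from the
      slack of each of the two tests.\<close>
    have f1: "16 * \<epsilon> \<le> f_univ 1 \<epsilon>"
    proof -
      have "(1::real) \<le> 2 ^ (2 ^ (1 + 5) + 1\<^sup>2 + 2 * 1)" by (rule one_le_power) simp
      then have "16 \<le> 1 + 6 * 2 powr ((real 1 + 1) / 2) + 4 * (2::real) ^ (2 ^ (1 + 5) + 1\<^sup>2 + 2 * 1)"
        by simp
      then show ?thesis unfolding f_univ_def using eps assms(8) by (intro mult_mono) auto
    qed
    have f2: "0 \<le> f_univ 2 \<epsilon>" by (simp add: f_univ_def)
    have "real (L - 1) * \<beta>2 \<le> e2 + \<epsilon>" "real (L - 1) * \<beta>3 \<le> e3 + \<epsilon>"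
      using mult_right_mono[OF L2 \<beta>n(1)] mult_right_mono[OF L2 \<beta>n(2)] T2(3) T3(3) L0
      by (auto simp: \<beta>2_def \<beta>3_def of_nat_diff)
    then have "8 * \<epsilon> + 4 * real (L - 1) * (\<beta>2 + \<beta>3) \<le> f_univ 1 \<epsilon> + f_univ 2 \<epsilon> + 4 * e3 + 4 * e2"
      using f1 f2 by (simp add: algebra_simps)
    then have "real b * (8 * \<epsilon> + 4 * real (L - 1) * (\<beta>2 + \<beta>3)) \<le> \<delta>"
      unfolding assms(11) dims[symmetric] \<sigma>2_def[symmetric] \<sigma>3_def[symmetric] e2_def[symmetric] e3_def[symmetric]
      by (intro mult_left_mono) auto
    then show ?thesis using err by linarith
  qed
  moreover have "0 \<le> (real b - 1) / real b * R" using assms(7,10) by simp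
  ultimately show ?thesis
    unfolding achievable_def using assms(12) rate code by auto
qed

end
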